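(* Suppose that the standing assumptions on the parameter functions and Assumptions B and C stated in the context are satisfied, and that $$\alpha^*+\gamma^*<2\beta^*+d.$$ Then the operator $H$ has a finite number of eigenvalues (counted with multiplicities) below $\min\sigma_{\rm ess}(H)$.
   Context: Let $d\in\mathbb{N}$, $a\in(0,\infty)$, $\Omega=(-a,a)^d\subset\mathbb{R}^d$. Let $\mathcal{H}=\mathcal{H}_0\oplus\mathcal{H}_1\oplus\mathcal{H}_2$ with $\mathcal{H}_0=\mathbb{C}$, $\mathcal{H}_1=L^2(\Omega,\mathbb{C})$, and $\mathcal{H}_2=L^2_{\rm sym}(\Omega^2,\mathbb{C})$ the closed subspace of $L^2(\Omega^2,\mathbb{C})$ of functions with $f(x,y)=f(y,x)$ for almost all $x,y\in\Omega$. Standing assumptions on the parameter functions: $w_0\in\mathbb{R}$; $v_0\in L^2(\Omega,\mathbb{C})$; $w_1\in L^\infty(\Omega,\mathbb{R})$; $w_2\in C(\Omega^2)\cap L^\infty(\Omega^2,\mathbb{R})$ with $w_2(x,y)=w_2(y,x)$ for $x,y\in\Omega$; and $v_1$ is a complex-valued measurable function on $\Omega^2$ such that for some $\varepsilon>0$ $$\operatorname{ess\,sup}_{x\in\Omega}\|v_1(x,\cdot)\|_{L^{2+\varepsilon}(\Omega)}<\infty,\qquad \operatorname{ess\,sup}_{y\in\Omega}\|v_1(\cdot,y)\|_{L^{2+4/\varepsilon}(\Omega)}<\infty.$$ The operator $H$ in $\mathcal{H}$ is the operator matrix $$H=\begin{pmatrix}H_{00}&H_{01}&0\\ H_{01}^*&H_{11}&H_{12}\\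 0&H_{12}^*&H_{22}\end{pmatrix},$$ where $H_{ij}:\mathcal{H}_j\to\mathcal{H}_i$ are given by $H_{00}f_0=w_0f_0$, $H_{01}f_1=\int_\Omega v_0(s)f_1(s)\,ds$, $(H_{11}f_1)(x)=w_1(x)f_1(x)$, $(H_{12}f_2)(x)=\int_\Omega v_1(x,s)f_2(x,s)\,ds$, $(H_{22}f_2)(x,y)=w_2(x,y)f_2(x,y)$ for almost all $x,y\in\Omega$. It is an everywhere defined bounded self-adjoint operator. For $\delta>0$ let $B_\delta(t)$ be the ball of radius $\delta$ centred at $t\in\mathbb{R}^d$, and $\chi_{B_\delta(t)}$ its characteristic function. For $s\ge 0$ and $u,v\in\mathbb{R}^d$ put $\Phi_s(u,v)=\|u\|^s+\|v\|^s$ if $(u,v)\in B_\delta(0)\times B_\delta(0)$ and $\Phi_s(u,v)=1$ otherwise. When one argument is $0$, for any $s\in\mathbb{R}$, $\Phi_s(0,u)=\Phi_s(u,0)$ is understood as $\|u\|^s$ if $u\in B_\delta(0)$ and $1$ otherwise. Assumption B. There exist constants $\alpha\ge0$, $\beta\in\mathbb{R}$, $C_1,C_2>0$, $\delta\in(0,a)$ and a unique point $(t_0,t_0)\in\Omega^2$ such that, for almost all $x,y\in\Omega$, $$w_2(x,y)-\min\sigma_{\rm ess}(H)\ge C_1\,\Phi_\alpha(x-t_0,y-t_0),\qquad \chi_{B_\delta(t_0)}(y)\,|v_1(x,y)|\le C_2\,\Phi_\beta(0,y-t_0).$$ Let $\alpha^*$ be the infimum of the values of $\alpha$, and $\beta^*$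 the supremum of the values of $\beta$, satisfying Assumption B (with $t_0$ and $\delta$ fixed). For $x\in\Omega$ put $$\Delta(x;\min\sigma_{\rm ess}(H)):=w_1(x)-\min\sigma_{\rm ess}(H)-\frac12\int_\Omega\frac{|v_1(x,y)|^2}{w_2(x,y)-\min\sigma_{\rm ess}(H)}\,dy.$$ This is well-defined for almost all $x\in\Omega$, with values in $[0,\infty)$, if $\min\sigma_{\rm ess}(H)\notin\mathrm{cl}(\mathrm{ran}\,w_2)$ (in which case $\alpha^*=0$), and also if $\min\sigma_{\rm ess}(H)\in \mathrm{cl}(\mathrm{ran}\,w_2)$, Assumption B holds and $\alpha^*<2\beta^*+d$. Assumption C. There exist constants $\gamma\ge0$ and $C_3>0$ such that, with $\delta$ and $t_0$ as in Assumption B, whenever $\alpha^*<2\beta^*+d$, then for almost all $x\in\Omega$ $$\Delta(x;\min\sigma_{\rm ess}(H))\ge C_3\,\Phi_\gamma(x-t_0,0).$$ Let $\gamma^*$ be the infimum of the values of $\gamma$ satisfying Assumption C. *)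

theory Defs
  imports "HOL-Analysis.Analysis" "HOL-Library.Function_Algebras"
begin

text \<open>
  Elements of an \<open>L\<^sup>p\<close> space are represented by functions; two representatives are
  identified when they agree almost everywhere. Measurability is Lebesgue measurability, and the
  dimension \<open>d\<close> is \<open>CARD('n)\<close>.
\<close>

definition cube :: "real \<Rightarrow> (real^'n) set" where
  "cube a = {x. \<forall>i. - a < x $ i \<and> x $ i < a}"

definition Lp_space :: "'b measure \<Rightarrow> real \<Rightarrow> ('b \<Rightarrow> complex) set" where
  "Lp_space M p = {f \<in> borel_measurable M. integrable M (\<lambda>x. norm (f x) powr p)}"

definition Lp_norm :: "'b measure \<Rightarrow> real \<Rightarrow> ('b \<Rightarrow> complex) \<Rightarrow> real" where
  "Lp_norm M p f = (\<integral>x. norm (f x) powr p \<partial>M) powr (1 / p)"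

definition L2_inner :: "'b measure \<Rightarrow> ('b \<Rightarrow> complex) \<Rightarrow> ('b \<Rightarrow> complex) \<Rightarrow> complex" where
  "L2_inner M f g = (\<integral>x. f x * cnj (g x) \<partial>M)"

definition L2_cube :: "real \<Rightarrow> (real^'n \<Rightarrow> complex) set" where
  "L2_cube a = Lp_space (lebesgue_on (cube a)) 2"

definition L2_sym :: "real \<Rightarrow> ((real^'n) \<times> (real^'n) \<Rightarrow> complex) set" where
  "L2_sym a = {f \<in> Lp_space (lebesgue_on (cube a \<times> cube a)) 2.
     AE z in lebesgue_on (cube a \<times> cube a). f z = f (snd z, fst z)}"

type_synonym 'n fock = "complex \<times> (real^'n \<Rightarrow> complex) \<times> ((real^'n) \<times> (real^'n) \<Rightarrow> complex)"

definition fock_space :: "real \<Rightarrow> 'n::finite fock set" where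
  "fock_space a = UNIV \<times> L2_cube a \<times> L2_sym a"

definition fock_eq :: "real \<Rightarrow> 'n::finite fock \<Rightarrow> 'n fock \<Rightarrow> bool" where
  "fock_eq a f g \<longleftrightarrow> fst f = fst g
     \<and> (AE x in lebesgue_on (cube a). fst (snd f) x = fst (snd g) x)
     \<and> (AE z in lebesgue_on (cube a \<times> cube a). snd (snd f) z = snd (snd g) z)"

definition fock_scale :: "complex \<Rightarrow> 'n::finite fock \<Rightarrow> 'n fock" where
  "fock_scale c f = (c * fst f, \<lambda>x. c * fst (snd f) x, \<lambda>z. c * snd (snd f) z)"

text \<open>Addition and zero on \<^typ>\<open>'n fock\<close> are the pointwise ones; \<open>fock.span\<close> is the complex span.\<close>

interpretation fock: vector_space fock_scale
  by unfold_locales (auto simp: fock_scale_def algebra_simps fun_eq_iff)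

text \<open>
  Dimensions are taken in the quotient by \<^const>\<open>fock_eq\<close>. The sets \<open>S\<close> and \<open>R\<close> below are meant to
  be (representatives of) linear subspaces of the Fock space.
\<close>

definition fock_finite_dim :: "real \<Rightarrow> 'n::finite fock set \<Rightarrow> bool" where
  "fock_finite_dim a S \<longleftrightarrow>
     (\<exists>B. finite B \<and> B \<subseteq> S \<and> (\<forall>f\<in>S. \<exists>g\<in>fock.span B. fock_eq a f g))"

definition fock_finite_codim :: "real \<Rightarrow> 'n::finite fock set \<Rightarrow> bool" where
  "fock_finite_codim a R \<longleftrightarrow>
     (\<exists>B. finite B \<and> B \<subseteq> fock_space a \<and>
        (\<forall>f\<in>fock_space a. \<exists>r\<in>R. \<exists>g\<in>fock.span B. fock_eq a f (r + g)))"

text \<open>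
  Spectral notions for a bounded, everywhere defined operator \<open>T\<close>. The range of a bounded operator
  is automatically closed if it has finite codimension, so closedness is not required separately.
\<close>

definition eigenspace :: "real \<Rightarrow> ('n::finite fock \<Rightarrow> 'n fock) \<Rightarrow> complex \<Rightarrow> 'n fock set" where
  "eigenspace a T \<mu> = {f \<in> fock_space a. fock_eq a (T f) (fock_scale \<mu> f)}"

definition is_eigenvalue :: "real \<Rightarrow> ('n::finite fock \<Rightarrow> 'n fock) \<Rightarrow> complex \<Rightarrow> bool" where
  "is_eigenvalue a T \<mu> \<longleftrightarrow> (\<exists>f\<in>eigenspace a T \<mu>. \<not> fock_eq a f 0)"

definition fredholm :: "real \<Rightarrow> ('n::finite fock \<Rightarrow> 'n fock) \<Rightarrow> bool" where
  "fredholm a T \<longleftrightarrow>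
     fock_finite_dim a {f \<in> fock_space a. fock_eq a (T f) 0} \<and>
     fock_finite_codim a (T ` fock_space a)"

definition ess_spectrum :: "real \<Rightarrow> ('n::finite fock \<Rightarrow> 'n fock) \<Rightarrow> complex set" where
  "ess_spectrum a T = {\<mu>. \<not> fredholm a (\<lambda>f. T f - fock_scale \<mu> f)}"

definition min_ess_spectrum :: "real \<Rightarrow> ('n::finite fock \<Rightarrow> 'n fock) \<Rightarrow> real" where
  "min_ess_spectrum a T = (LEAST \<mu>. complex_of_real \<mu> \<in> ess_spectrum a T)"

definition finitely_many_eigenvalues_below ::
    "real \<Rightarrow> ('n::finite fock \<Rightarrow> 'n fock) \<Rightarrow> real \<Rightarrow> bool" where
  \<comment> \<open>counted with multiplicities: finitely many, each with finite-dimensional eigenspace\<close>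
  "finitely_many_eigenvalues_below a T m \<longleftrightarrow>
     finite {\<mu>. \<mu> < m \<and> is_eigenvalue a T (complex_of_real \<mu>)} \<and>
     (\<forall>\<mu><m. is_eigenvalue a T (complex_of_real \<mu>) \<longrightarrow>
        fock_finite_dim a (eigenspace a T (complex_of_real \<mu>)))"

text \<open>
  Adjoint of a bounded operator \<open>T\<close> from the Hilbert space with carrier \<open>X\<close> and inner product \<open>ipX\<close>
  to one with inner product \<open>ipY\<close> (inner products are antilinear in the second argument). The value
  is determined only up to almost everywhere equality; an arbitrary representative is chosen.
\<close>

definition hilbert_adjoint ::
    "'x set \<Rightarrow> ('x \<Rightarrow> 'x \<Rightarrow> complex) \<Rightarrow> ('y \<Rightarrow> 'y \<Rightarrow> complex) \<Rightarrow> ('x \<Rightarrow> 'y) \<Rightarrow> 'y \<Rightarrow> 'x" where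
  "hilbert_adjoint X ipX ipY T y = (SOME x. x \<in> X \<and> (\<forall>u\<in>X. ipY (T u) y = ipX u x))"

definition H00 :: "real \<Rightarrow> complex \<Rightarrow> complex" where
  "H00 w0 f0 = complex_of_real w0 * f0"

definition H01 :: "real \<Rightarrow> (real^'n \<Rightarrow> complex) \<Rightarrow> (real^'n \<Rightarrow> complex) \<Rightarrow> complex" where
  "H01 a v0 f1 = (\<integral>s. v0 s * f1 s \<partial>lebesgue_on (cube a))"

definition H01_adj :: "real \<Rightarrow> (real^'n \<Rightarrow> complex) \<Rightarrow> complex \<Rightarrow> (real^'n \<Rightarrow> complex)" where
  "H01_adj a v0 =
     hilbert_adjoint (L2_cube a) (L2_inner (lebesgue_on (cube a))) (\<lambda>z w. z * cnj w) (H01 a v0)"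

definition H11 :: "(real^'n \<Rightarrow> real) \<Rightarrow> (real^'n \<Rightarrow> complex) \<Rightarrow> (real^'n \<Rightarrow> complex)" where
  "H11 w1 f1 = (\<lambda>x. complex_of_real (w1 x) * f1 x)"

definition H12 :: "real \<Rightarrow> ((real^'n) \<times> (real^'n) \<Rightarrow> complex) \<Rightarrow>
    ((real^'n) \<times> (real^'n) \<Rightarrow> complex) \<Rightarrow> (real^'n \<Rightarrow> complex)" where
  "H12 a v1 f2 = (\<lambda>x. \<integral>s. v1 (x, s) * f2 (x, s) \<partial>lebesgue_on (cube a))"

definition H12_adj :: "real \<Rightarrow> ((real^'n) \<times> (real^'n) \<Rightarrow> complex) \<Rightarrow>
    (real^'n \<Rightarrow> complex) \<Rightarrow> ((real^'n) \<times> (real^'n) \<Rightarrow> complex)" where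
  "H12_adj a v1 = hilbert_adjoint (L2_sym a) (L2_inner (lebesgue_on (cube a \<times> cube a)))
     (L2_inner (lebesgue_on (cube a))) (H12 a v1)"

definition H22 :: "((real^'n) \<times> (real^'n) \<Rightarrow> real) \<Rightarrow>
    ((real^'n) \<times> (real^'n) \<Rightarrow> complex) \<Rightarrow> ((real^'n) \<times> (real^'n) \<Rightarrow> complex)" where
  "H22 w2 f2 = (\<lambda>z. complex_of_real (w2 z) * f2 z)"

definition fock_op :: "real \<Rightarrow> real \<Rightarrow> (real^'n \<Rightarrow> complex) \<Rightarrow> (real^'n \<Rightarrow> real) \<Rightarrow>
    ((real^'n) \<times> (real^'n) \<Rightarrow> complex) \<Rightarrow> ((real^'n) \<times> (real^'n) \<Rightarrow> real) \<Rightarrow> 'n::finite fock \<Rightarrow> 'n fock" where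
  "fock_op a w0 v0 w1 v1 w2 = (\<lambda>(f0, f1, f2).
     (H00 w0 f0 + H01 a v0 f1,
      H01_adj a v0 f0 + H11 w1 f1 + H12 a v1 f2,
      H12_adj a v1 f1 + H22 w2 f2))"

text \<open>
  \<open>Phi\<close> is the two-argument weight and \<open>Phi0\<close> its variant with one argument equal to zero. They
  enter only through almost everywhere inequalities, so the values given by \<^const>\<open>powr\<close> at the
  base \<open>0\<close> are irrelevant.
\<close>

definition Phi :: "real \<Rightarrow> real \<Rightarrow> real^'n \<Rightarrow> real^'n \<Rightarrow> real" where
  "Phi \<delta> s u v = (if u \<in> ball 0 \<delta> \<and> v \<in> ball 0 \<delta> then norm u powr s + norm v powr s else 1)"

definition Phi0 :: "real \<Rightarrow> real \<Rightarrow> real^'n \<Rightarrow> real" where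
  "Phi0 \<delta> s u = (if u \<in> ball 0 \<delta> then norm u powr s else 1)"

text \<open>In the following, \<open>m\<close> stands for the minimum of the essential spectrum.\<close>

definition bounds_B :: "real \<Rightarrow> ((real^'n) \<times> (real^'n) \<Rightarrow> complex) \<Rightarrow> ((real^'n) \<times> (real^'n) \<Rightarrow> real) \<Rightarrow>
    real \<Rightarrow> real \<Rightarrow> real^'n \<Rightarrow> real \<Rightarrow> real \<Rightarrow> real \<Rightarrow> real \<Rightarrow> bool" where
  "bounds_B a v1 w2 m \<delta> t0 \<alpha> \<beta> C1 C2 \<longleftrightarrow>
     (AE z in lebesgue_on (cube a \<times> cube a).
        w2 z - m \<ge> C1 * Phi \<delta> \<alpha> (fst z - t0) (snd z - t0)) \<and>
     (AE z in lebesgue_on (cube a \<times> cube a).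
        indicator (ball t0 \<delta>) (snd z) * norm (v1 z) \<le> C2 * Phi0 \<delta> \<beta> (snd z - t0))"

text \<open>
  Uniqueness of \<open>t0\<close> is required only when \<open>m\<close> lies in the closure of the range of \<open>w2\<close>, where
  \<open>(t0, t0)\<close> is the zero of \<open>w2 - m\<close>. Otherwise \<open>\<alpha> = 0\<close> is admissible and, for instance when
  \<open>v1\<close> is bounded, every point of the cube would do; that case is to be included.
\<close>

definition assumption_B :: "real \<Rightarrow> ((real^'n) \<times> (real^'n) \<Rightarrow> complex) \<Rightarrow>
    ((real^'n) \<times> (real^'n) \<Rightarrow> real) \<Rightarrow> real \<Rightarrow> real \<Rightarrow> real^'n \<Rightarrow> bool" where
  "assumption_B a v1 w2 m \<delta> t0 \<longleftrightarrow> 0 < \<delta> \<and> \<delta> < a \<and> t0 \<in> cube a \<and>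
     (\<exists>\<alpha> \<beta> C1 C2. \<alpha> \<ge> 0 \<and> C1 > 0 \<and> C2 > 0 \<and> bounds_B a v1 w2 m \<delta> t0 \<alpha> \<beta> C1 C2 \<and>
        (m \<in> closure (w2 ` (cube a \<times> cube a)) \<longrightarrow>
           (\<forall>t\<in>cube a. bounds_B a v1 w2 m \<delta> t \<alpha> \<beta> C1 C2 \<longrightarrow> t = t0)))"

text \<open>
  The optimal exponents are extended reals: \<open>beta_star\<close> is infinite if, for example, \<open>v1 (x, y)\<close>
  vanishes for \<open>y\<close> near \<open>t0\<close>.
\<close>

definition alpha_star :: "real \<Rightarrow> ((real^'n) \<times> (real^'n) \<Rightarrow> complex) \<Rightarrow>
    ((real^'n) \<times> (real^'n) \<Rightarrow> real) \<Rightarrow> real \<Rightarrow> real \<Rightarrow> real^'n \<Rightarrow> ereal" where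
  "alpha_star a v1 w2 m \<delta> t0 = Inf {ereal \<alpha> | \<alpha> \<beta> C1 C2.
     \<alpha> \<ge> 0 \<and> C1 > 0 \<and> C2 > 0 \<and> bounds_B a v1 w2 m \<delta> t0 \<alpha> \<beta> C1 C2}"

definition beta_star :: "real \<Rightarrow> ((real^'n) \<times> (real^'n) \<Rightarrow> complex) \<Rightarrow>
    ((real^'n) \<times> (real^'n) \<Rightarrow> real) \<Rightarrow> real \<Rightarrow> real \<Rightarrow> real^'n \<Rightarrow> ereal" where
  "beta_star a v1 w2 m \<delta> t0 = Sup {ereal \<beta> | \<alpha> \<beta> C1 C2.
     \<alpha> \<ge> 0 \<and> C1 > 0 \<and> C2 > 0 \<and> bounds_B a v1 w2 m \<delta> t0 \<alpha> \<beta> C1 C2}"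

definition Delta :: "real \<Rightarrow> (real^'n \<Rightarrow> real) \<Rightarrow> ((real^'n) \<times> (real^'n) \<Rightarrow> complex) \<Rightarrow>
    ((real^'n) \<times> (real^'n) \<Rightarrow> real) \<Rightarrow> real \<Rightarrow> real^'n \<Rightarrow> real" where
  "Delta a w1 v1 w2 m x = w1 x - m
     - 1 / 2 * (\<integral>y. (norm (v1 (x, y)))\<^sup>2 / (w2 (x, y) - m) \<partial>lebesgue_on (cube a))"

definition bound_C :: "real \<Rightarrow> (real^'n \<Rightarrow> real) \<Rightarrow> ((real^'n) \<times> (real^'n) \<Rightarrow> complex) \<Rightarrow>
    ((real^'n) \<times> (real^'n) \<Rightarrow> real) \<Rightarrow> real \<Rightarrow> real \<Rightarrow> real^'n \<Rightarrow> real \<Rightarrow> real \<Rightarrow> bool" where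
  "bound_C a w1 v1 w2 m \<delta> t0 \<gamma> C3 \<longleftrightarrow>
     (alpha_star a v1 w2 m \<delta> t0 < 2 * beta_star a v1 w2 m \<delta> t0 + ereal (real CARD('n)) \<longrightarrow>
        (AE x in lebesgue_on (cube a). Delta a w1 v1 w2 m x \<ge> C3 * Phi0 \<delta> \<gamma> (x - t0)))"

definition assumption_C :: "real \<Rightarrow> (real^'n \<Rightarrow> real) \<Rightarrow> ((real^'n) \<times> (real^'n) \<Rightarrow> complex) \<Rightarrow>
    ((real^'n) \<times> (real^'n) \<Rightarrow> real) \<Rightarrow> real \<Rightarrow> real \<Rightarrow> real^'n \<Rightarrow> bool" where
  "assumption_C a w1 v1 w2 m \<delta> t0 \<longleftrightarrow>
     (\<exists>\<gamma> C3. \<gamma> \<ge> 0 \<and> C3 > 0 \<and> bound_C a w1 v1 w2 m \<delta> t0 \<gamma> C3)"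

definition gamma_star :: "real \<Rightarrow> (real^'n \<Rightarrow> real) \<Rightarrow> ((real^'n) \<times> (real^'n) \<Rightarrow> complex) \<Rightarrow>
    ((real^'n) \<times> (real^'n) \<Rightarrow> real) \<Rightarrow> real \<Rightarrow> real \<Rightarrow> real^'n \<Rightarrow> ereal" where
  "gamma_star a w1 v1 w2 m \<delta> t0 = Inf {ereal \<gamma> | \<gamma> C3.
     \<gamma> \<ge> 0 \<and> C3 > 0 \<and> bound_C a w1 v1 w2 m \<delta> t0 \<gamma> C3}"

end

theory Submission
  imports Defs
begin

text \<open>
  Write \<open>W = w2 - m\<close> and consider the quadratic form of \<open>H - m\<close> at a vector \<open>f\<close> with \<open>f\<^sub>0 = 0\<close>, so
  that \<open>v0\<close> does not enter. Completing the square in the two-particle component \<open>f\<^sub>2\<close> bounds the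
  form from below by that of the Schur complement of the two-particle block,
  \<open>\<integral> D(x) |f\<^sub>1(x)|\<^sup>2 dx - Re \<integral>\<integral> T(x, y) f\<^sub>1(x) cnj (f\<^sub>1(y)) dx dy\<close>, where \<open>D\<close> is the function
  \<^const>\<open>Delta\<close> and the exchange kernel \<open>T(x, y) = cnj (v1 (x, y)) v1 (y, x) / (2 W(x, y))\<close> comes from
  the symmetry of \<open>f\<^sub>2\<close> (lemma \<open>form_ge_Schur_complement\<close>).

  In terms of \<open>g = sqrt D f\<^sub>1\<close> the exchange term has the kernel \<open>k(x, y) = T(x, y) / sqrt (D(x) D(y))\<close>.
  Near \<open>(t0, t0)\<close> its square is bounded by a multiple of \<open>\<rho>(x) \<rho>(y)\<close> with
  \<open>\<rho>(y) = |y - t0| powr (2 \<beta> - \<alpha> - \<gamma>)\<close>, which is integrable because \<open>\<alpha> + \<gamma> < 2 \<beta> + d\<close>; away from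
  that point the integrability assumptions on \<open>v1\<close> suffice. So \<open>k\<close> is square integrable.

  Let \<open>S\<close> be a subspace on which the form is negative. If \<open>g\<^sub>1, \<dots>, g\<^sub>n\<close> come from vectors of \<open>S\<close> with
  \<open>f\<^sub>0 = 0\<close> and are orthonormal in \<open>L\<^sup>2\<close>, then each coefficient of \<open>k\<close> with respect to the
  orthonormal functions \<open>cnj (g\<^sub>i(x)) g\<^sub>i(y)\<close> has real part at least \<open>1\<close>, and Bessel's inequality
  gives \<open>n \<le> \<parallel>k\<parallel>\<^sup>2\<close> (lemma \<open>card_le_of_exchange_ge_1\<close>). A largest such family spans the part of
  \<open>S\<close> with \<open>f\<^sub>0 = 0\<close>, and \<open>f\<^sub>0\<close> adds at most one dimension: \<open>S\<close> is finite dimensional (lemma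
  \<open>negative_subspace_finite_dim\<close>). This applies to the eigenspaces below \<open>m\<close> and, since
  eigenvectors of distinct eigenvalues are orthogonal, to the span of one eigenvector for each
  eigenvalue below \<open>m\<close>.
\<close>

section \<open>Fubini and Tonelli on squares of Lebesgue sets\<close>

text \<open>
  Componentwise reduction to real-valued functions.
\<close>

lemma completion_ex_borel_measurable_euclidean:
  fixes f :: "'a \<Rightarrow> 'b::euclidean_space"
  assumes f: "f \<in> borel_measurable (completion N)"
  shows "\<exists>g\<in>borel_measurable N. AE x in N. f x = g x"
proof -
  have "\<exists>g. g \<in> borel_measurable N \<and> (AE x in N. f x \<bullet> b = g x)" for b
    using completion_ex_borel_measurable_real[of "\<lambda>x. f x \<bullet> b" N] f by auto
  then obtain g where g: "\<And>b. g b \<in> borel_measurable N" "\<And>b. AE x in N. f x \<bullet> b = g b x"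
    by metis
  show ?thesis
  proof (rule bexI)
    have "AE x in N. \<forall>b\<in>Basis. f x \<bullet> b = g b x"
      by (rule AE_finite_allI) (use g in auto)
    then show "AE x in N. f x = (\<Sum>b\<in>Basis. g b x *\<^sub>R b)"
      by eventually_elim (metis (mono_tags, lifting) euclidean_representation sum.cong)
    show "(\<lambda>x. \<Sum>b\<in>Basis. g b x *\<^sub>R b) \<in> borel_measurable N"
      using g by measurable
  qed
qed

lemma null_sets_lborel_Times_UNIV:
  fixes A :: "'a::euclidean_space set"
  assumes A: "A \<in> null_sets lborel"
  shows "A \<times> (UNIV :: 'b::euclidean_space set) \<in> null_sets lborel"
    and "(UNIV :: 'b::euclidean_space set) \<times> A \<in> null_sets lborel"
proof -
  have "A \<times> (UNIV :: 'b set) \<in> null_sets (lborel \<Otimes>\<^sub>M lborel)"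
    by (rule lborel.times_in_null_sets1) (use A in auto)
  then show "A \<times> (UNIV :: 'b set) \<in> null_sets lborel"
    by (simp add: lborel_prod)
  have "(UNIV :: 'b set) \<times> A \<in> null_sets (lborel \<Otimes>\<^sub>M lborel)"
    by (rule lborel.times_in_null_sets2) (use A in auto)
  then show "(UNIV :: 'b set) \<times> A \<in> null_sets lborel"
    by (simp add: lborel_prod)
qed

lemma measurable_lebesgue_fst:
  "(fst :: 'a::euclidean_space \<times> 'b::euclidean_space \<Rightarrow> 'a) \<in> lebesgue \<rightarrow>\<^sub>M lebesgue"
  and measurable_lebesgue_snd:
  "(snd :: 'a::euclidean_space \<times> 'b::euclidean_space \<Rightarrow> 'b) \<in> lebesgue \<rightarrow>\<^sub>M lebesgue"
proof -
  have 1: "(fst :: 'a \<times> 'b \<Rightarrow> 'a) \<in> lebesgue \<rightarrow>\<^sub>M lborel"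
    and 2: "(snd :: 'a \<times> 'b \<Rightarrow> 'b) \<in> lebesgue \<rightarrow>\<^sub>M lborel"
    by (auto intro!: measurable_completion simp: borel_prod[symmetric])
  have fst_vimage: "fst -` A = A \<times> (UNIV :: 'b set)" for A :: "'a set" by auto
  have "null_sets lborel \<subseteq> null_sets (distr lebesgue lborel (fst :: 'a \<times> 'b \<Rightarrow> 'a))"
  proof
    fix A :: "'a set" assume A: "A \<in> null_sets lborel"
    then have "A \<times> (UNIV :: 'b set) \<in> null_sets lebesgue"
      using null_sets_lborel_Times_UNIV(1) null_sets_completionI by blast
    then show "A \<in> null_sets (distr lebesgue lborel (fst :: 'a \<times> 'b \<Rightarrow> 'a))"
      using A unfolding null_sets_def by (simp add: emeasure_distr[OF 1] fst_vimage del: emeasure_completion)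
  qed
  then show "(fst :: 'a \<times> 'b \<Rightarrow> 'a) \<in> lebesgue \<rightarrow>\<^sub>M lebesgue"
    by (rule completion.measurable_completion2[OF 1])
  have snd_vimage: "snd -` A = (UNIV :: 'a set) \<times> A" for A :: "'b set" by auto
  have "null_sets lborel \<subseteq> null_sets (distr lebesgue lborel (snd :: 'a \<times> 'b \<Rightarrow> 'b))"
  proof
    fix A :: "'b set" assume A: "A \<in> null_sets lborel"
    then have "(UNIV :: 'a set) \<times> A \<in> null_sets lebesgue"
      using null_sets_lborel_Times_UNIV(2) null_sets_completionI by blast
    then show "A \<in> null_sets (distr lebesgue lborel (snd :: 'a \<times> 'b \<Rightarrow> 'b))"
      using A unfolding null_sets_def by (simp add: emeasure_distr[OF 2] snd_vimage del: emeasure_completion)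
  qed
  then show "(snd :: 'a \<times> 'b \<Rightarrow> 'b) \<in> lebesgue \<rightarrow>\<^sub>M lebesgue"
    by (rule completion.measurable_completion2[OF 2])
qed

lemma emeasure_lebesgue_Times:
  fixes S :: "'a::euclidean_space set" and T :: "'b::euclidean_space set"
  assumes S: "S \<in> sets lebesgue" and T: "T \<in> sets lebesgue"
  shows "S \<times> T \<in> sets lebesgue" "emeasure lebesgue (S \<times> T) = emeasure lebesgue S * emeasure lebesgue T"
proof -
  have "S \<times> T = (fst -` S \<inter> space lebesgue) \<inter> (snd -` T \<inter> space lebesgue)" by auto
  also have "\<dots> \<in> sets lebesgue"
    by (intro sets.Int measurable_sets[OF measurable_lebesgue_fst S] measurable_sets[OF measurable_lebesgue_snd T])
  finally show meas: "S \<times> T \<in> sets lebesgue" .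
  let ?S = "main_part lborel S" and ?T = "main_part lborel T"
  obtain N1 where N1: "N1 \<in> null_sets lborel" "null_part lborel S \<subseteq> N1" using null_part[OF S] by auto
  obtain N2 where N2: "N2 \<in> null_sets lborel" "null_part lborel T \<subseteq> N2" using null_part[OF T] by auto
  have N: "N1 \<times> (UNIV::'b set) \<in> null_sets lebesgue" "(UNIV::'a set) \<times> N2 \<in> null_sets lebesgue"
    using null_sets_lborel_Times_UNIV(1)[OF N1(1)] null_sets_lborel_Times_UNIV(2)[OF N2(1)]
    by (auto intro: null_sets_completionI)
  have sub: "S = ?S \<union> null_part lborel S" "T = ?T \<union> null_part lborel T"
    using main_part_null_part_Un[OF S] main_part_null_part_Un[OF T] by auto
  have "AE z in lebesgue. z \<in> S \<times> T \<longleftrightarrow> z \<in> ?S \<times> ?T"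
    using AE_not_in[OF N(1)] AE_not_in[OF N(2)]
  proof eventually_elim
    case (elim z)
    then show ?case using sub N1 N2 by (cases z) auto
  qed
  moreover have ST: "?S \<times> ?T \<in> sets (lborel \<Otimes>\<^sub>M lborel)"
    using S T by (intro pair_measureI main_part_sets)
  then have ST': "?S \<times> ?T \<in> sets lborel" by (simp only: lborel_prod)
  ultimately have "emeasure lebesgue (S \<times> T) = emeasure lebesgue (?S \<times> ?T)"
    by (intro emeasure_eq_AE meas) auto
  also have "\<dots> = emeasure lborel (?S \<times> ?T)" using ST' by simp
  also have "\<dots> = emeasure lborel ?S * emeasure lborel ?T"
    unfolding lborel_prod[symmetric] using S T
    by (intro lborel.emeasure_pair_measure_Times main_part_sets)
  finally show "emeasure lebesgue (S \<times> T) = emeasure lebesgue S * emeasure lebesgue T"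
    using S T by simp
qed

lemma complete_measure_lebesgue_on:
  assumes "S \<in> sets lebesgue"
  shows "complete_measure (lebesgue_on S)"
proof
  fix A B assume "B \<subseteq> A" "A \<in> null_sets (lebesgue_on S)"
  then have "A \<in> null_sets lebesgue" "A \<subseteq> S" using assms by (auto simp: null_sets_restrict_space)
  then have "B \<in> null_sets lebesgue" "B \<subseteq> S"
    using completion.complete2[of B A] \<open>B \<subseteq> A\<close> by auto
  then show "B \<in> sets (lebesgue_on S)"
    using assms by (auto simp: sets_restrict_space_iff)
qed

text \<open>
  Rectangles with Lebesgue-measurable sides have the product measure, and a Lebesgue null set lies in
  a Borel null set, which belongs to the product \<open>\<sigma>\<close>-algebra. By this equation Fubini and Tonelli
  hold for Lebesgue-measurable functions: apply them to a representative that is measurable for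
  the product \<open>\<sigma>\<close>-algebra.
\<close>

lemma lebesgue_on_Times:
  fixes A :: "'a::euclidean_space set" and B :: "'b::euclidean_space set"
  assumes A': "A \<in> lmeasurable" and B': "B \<in> lmeasurable"
  shows "lebesgue_on (A \<times> B) = completion (lebesgue_on A \<Otimes>\<^sub>M lebesgue_on B)"
proof -
  let ?L = "lebesgue_on (A \<times> B)" and ?N = "lebesgue_on A \<Otimes>\<^sub>M lebesgue_on B"
  have A: "A \<in> sets lebesgue" and B: "B \<in> sets lebesgue" using A' B' by auto
  note AB = emeasure_lebesgue_Times(1)[OF A B]
  interpret L: complete_measure ?L by (rule complete_measure_lebesgue_on[OF AB])
  have sf: "sigma_finite_measure (lebesgue_on A)" "sigma_finite_measure (lebesgue_on B)"
    using finite_measure_lebesgue_on[OF A'] finite_measure_lebesgue_on[OF B']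
    by (simp_all add: finite_measure_def)
  have "fst \<in> ?L \<rightarrow>\<^sub>M lebesgue_on A" "snd \<in> ?L \<rightarrow>\<^sub>M lebesgue_on B"
    by (rule measurable_restrict_space3, rule measurable_lebesgue_fst measurable_lebesgue_snd, force)+
  then have id: "(\<lambda>z. z) \<in> ?L \<rightarrow>\<^sub>M ?N"
    by (simp add: measurable_pair_iff comp_def)
  have N: "?N = distr ?L ?N (\<lambda>z. z)"
  proof (rule pair_measure_eqI)
    fix S T assume "S \<in> sets (lebesgue_on A)" "T \<in> sets (lebesgue_on B)"
    then have ST: "S \<in> sets lebesgue" "S \<subseteq> A" "T \<in> sets lebesgue" "T \<subseteq> B"
      and ST': "S \<times> T \<in> sets ?N"
      using A B by (auto simp: sets_restrict_space_iff)
    then show "emeasure (lebesgue_on A) S * emeasure (lebesgue_on B) T = emeasure (distr ?L ?N (\<lambda>z. z)) (S \<times> T)"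
      using id A B AB measurable_sets[OF id ST'] sets.sets_into_space[OF ST']
      by (subst emeasure_distr)
         (auto simp: emeasure_restrict_space emeasure_lebesgue_Times space_pair_measure Int_absorb2
            simp del: emeasure_completion)
  qed (simp_all add: sf A B)
  have subN: "X \<inter> (A \<times> B) \<in> sets ?N" if "X \<in> sets lborel" for X
  proof -
    have "fst \<in> ?N \<rightarrow>\<^sub>M borel" "snd \<in> ?N \<rightarrow>\<^sub>M borel"
      using measurable_compose[OF measurable_fst id_borel_measurable_lebesgue_on[of A]]
        measurable_compose[OF measurable_snd id_borel_measurable_lebesgue_on[of B]]
      by (simp_all add: comp_def id_def)
    then have "(\<lambda>z. z) \<in> ?N \<rightarrow>\<^sub>M borel \<Otimes>\<^sub>M borel"
      by (simp add: measurable_pair_iff comp_def)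
    then have "(\<lambda>z. z) \<in> ?N \<rightarrow>\<^sub>M borel" by (simp add: borel_prod)
    from measurable_sets[OF this, of X] that show ?thesis
      by (simp add: space_pair_measure)
  qed
  have eq: "emeasure ?N X = emeasure ?L X" if "X \<in> sets ?N" for X
  proof -
    have "X \<inter> (A \<times> B) = X" using sets.sets_into_space[OF that] by (simp add: space_pair_measure Int_absorb2)
    then show ?thesis by (subst N) (simp add: emeasure_distr[OF id that])
  qed
  have "sets ?L = sets (completion ?N)"
  proof (intro set_eqI iffI)
    fix X assume "X \<in> sets ?L"
    then have X: "X \<in> sets lebesgue" "X \<subseteq> A \<times> B" using AB by (auto simp: sets_restrict_space_iff)
    let ?X = "main_part lborel X"
    obtain Y where Y: "Y \<in> null_sets lborel" "null_part lborel X \<subseteq> Y" using null_part[OF X(1)] by auto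
    have un: "?X \<union> null_part lborel X = X" using main_part_null_part_Un[OF X(1)] .
    have "Y \<in> null_sets lebesgue" using null_sets_completionI[OF Y(1)] .
    then have "Y \<inter> (A \<times> B) \<in> null_sets lebesgue"
      using AB by (rule null_set_Int2)
    then have "emeasure ?L (Y \<inter> (A \<times> B)) = 0"
      using AB by (simp add: emeasure_restrict_space null_setsD1 del: emeasure_completion)
    then have "Y \<inter> (A \<times> B) \<in> null_sets ?N"
      using subN[of Y] Y eq[of "Y \<inter> (A \<times> B)"] by (auto simp: null_sets_def)
    moreover have "?X \<in> sets ?N"
      using subN[OF main_part_sets[OF X(1)]] un X(2) by (metis Int_absorb2 Un_upper1 order_trans)
    moreover have "null_part lborel X \<subseteq> Y \<inter> (A \<times> B)"
      using Y(2) un X(2) by blast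
    ultimately show "X \<in> sets (completion ?N)"
      using un by (intro sets_completionI[of _ ?X "null_part lborel X"]) auto
  next
    fix X assume "X \<in> sets (completion ?N)"
    then obtain S Y N' where X: "X = S \<union> Y" "Y \<subseteq> N'" "N' \<in> null_sets ?N" "S \<in> sets ?N"
      by (rule sets_completionE)
    have L: "Z \<in> sets ?L" if "Z \<in> sets ?N" for Z
      using measurable_sets[OF id that] sets.sets_into_space[OF that] by (simp add: space_pair_measure Int_absorb2)
    have "N' \<in> null_sets ?L" using X(3) L eq by (auto simp: null_sets_def)
    then have "Y \<in> sets ?L" using L.complete X by auto
    then show "X \<in> sets ?L" using X L by auto
  qed
  then have "?L = distr ?L (completion ?N) (\<lambda>z. z)"
    by (simp add: distr_id2)
  also have "\<dots> = completion (distr ?L ?N (\<lambda>z. z))"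
    by (rule L.completion_distr_eq[symmetric, OF id]) (simp flip: N)
  also have "\<dots> = completion ?N" by (simp flip: N)
  finally show ?thesis .
qed

text \<open>
  Completeness of the factor \<open>M\<close> makes every function measurable that agrees almost everywhere with a
  measurable one; this is what sections and partial integrals of \<open>P\<close>-measurable functions require.
\<close>

locale complete_finite_measure = finite_measure M + complete_measure M for M :: "'a measure"
begin

sublocale pair: pair_sigma_finite M M ..

abbreviation P :: "('a \<times> 'a) measure" where "P \<equiv> completion (M \<Otimes>\<^sub>M M)"

lemma AE_P_iff: "(AE z in P. Q z) \<longleftrightarrow> (AE z in M \<Otimes>\<^sub>M M. Q z)"
  by (rule AE_completion_iff)

lemma AE_P_sections:
  assumes "AE z in P. Q z"
  shows "AE x in M. AE y in M. Q (x, y)"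
  using assms unfolding AE_P_iff by (rule pair.AE_pair)

lemma measurable_P_fst: "f \<in> M \<rightarrow>\<^sub>M N \<Longrightarrow> (\<lambda>z. f (fst z)) \<in> P \<rightarrow>\<^sub>M N"
  by (rule measurable_completion) simp

lemma measurable_P_snd: "f \<in> M \<rightarrow>\<^sub>M N \<Longrightarrow> (\<lambda>z. f (snd z)) \<in> P \<rightarrow>\<^sub>M N"
  by (rule measurable_completion) simp

lemma AE_P_fst:
  assumes "AE x in M. Q x"
  shows "AE z in P. Q (fst z)"
proof -
  have "AE z in M \<Otimes>\<^sub>M M. Q (fst z)"
  proof (rule pair.AE_pair_measure)
    have "{z \<in> space (M \<Otimes>\<^sub>M M). Q (fst z)} = {x \<in> space M. Q x} \<times> space M"
      by (auto simp: space_pair_measure)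
    moreover have "{x \<in> space M. Q x} \<in> sets M"
      using in_sets_AE[of "space M" "{x \<in> space M. Q x}"] assms by auto
    ultimately show "{z \<in> space (M \<Otimes>\<^sub>M M). Q (fst z)} \<in> sets (M \<Otimes>\<^sub>M M)" by auto
  qed (use assms in auto)
  then show ?thesis unfolding AE_P_iff .
qed

lemma borel_measurable_cong_AE:
  assumes f: "f \<in> borel_measurable M" and "AE x in M. f x = g x"
  shows "g \<in> borel_measurable M"
proof (rule measurableI)
  fix S :: "'b :: topological_space set" assume S: "S \<in> sets borel"
  show "g -` S \<inter> space M \<in> sets M"
  proof (rule in_sets_AE)
    show "f -` S \<inter> space M \<in> sets M" using f S by (rule measurable_sets)
    show "AE x in M. x \<in> f -` S \<inter> space M \<longleftrightarrow> x \<in> g -` S \<inter> space M"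
      using assms(2) by eventually_elim auto
  qed auto
qed auto

lemma nn_integral_P:
  assumes f: "f \<in> borel_measurable P"
  shows "(\<integral>\<^sup>+ z. f z \<partial>P) = (\<integral>\<^sup>+ x. \<integral>\<^sup>+ y. f (x, y) \<partial>M \<partial>M)"
proof -
  obtain g where g: "g \<in> borel_measurable (M \<Otimes>\<^sub>M M)" "AE z in M \<Otimes>\<^sub>M M. f z = g z"
    using completion_ex_borel_measurable[OF f] by auto
  have "(\<integral>\<^sup>+ z. f z \<partial>P) = (\<integral>\<^sup>+ z. f z \<partial>(M \<Otimes>\<^sub>M M))"
    by (rule nn_integral_completion)
  also have "\<dots> = (\<integral>\<^sup>+ z. g z \<partial>(M \<Otimes>\<^sub>M M))"
    by (rule nn_integral_cong_AE) (rule g)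
  also have "\<dots> = (\<integral>\<^sup>+ x. \<integral>\<^sup>+ y. g (x, y) \<partial>M \<partial>M)"
    by (rule nn_integral_fst[symmetric]) (rule g)
  also have "\<dots> = (\<integral>\<^sup>+ x. \<integral>\<^sup>+ y. f (x, y) \<partial>M \<partial>M)"
  proof (rule nn_integral_cong_AE)
    show "AE x in M. (\<integral>\<^sup>+ y. g (x, y) \<partial>M) = (\<integral>\<^sup>+ y. f (x, y) \<partial>M)"
      using pair.AE_pair[OF g(2)]
      by eventually_elim (rule nn_integral_cong_AE, auto)
  qed
  finally show ?thesis .
qed

lemma measurable_swap: "(\<lambda>z. (snd z, fst z)) \<in> P \<rightarrow>\<^sub>M P"
  and distr_swap: "distr P P (\<lambda>z. (snd z, fst z)) = P"
proof -
  let ?s = "\<lambda>z :: 'a \<times> 'a. (snd z, fst z)"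
  have s: "?s \<in> P \<rightarrow>\<^sub>M M \<Otimes>\<^sub>M M" by (rule measurable_completion) simp
  have "distr P (M \<Otimes>\<^sub>M M) ?s = distr (M \<Otimes>\<^sub>M M) (M \<Otimes>\<^sub>M M) ?s"
    by (rule distr_completion) simp
  also have "\<dots> = M \<Otimes>\<^sub>M M"
    using pair.distr_pair_swap by (simp add: case_prod_unfold)
  finally have eq: "distr P (M \<Otimes>\<^sub>M M) ?s = M \<Otimes>\<^sub>M M" .
  show "?s \<in> P \<rightarrow>\<^sub>M P"
    by (rule completion.measurable_completion2[OF s]) (simp add: eq)
  show "distr P P ?s = P"
    using completion.completion_distr_eq[OF s] by (simp add: eq)
qed

lemma borel_measurable_swap: "f \<in> P \<rightarrow>\<^sub>M N \<Longrightarrow> (\<lambda>z. f (snd z, fst z)) \<in> P \<rightarrow>\<^sub>M N"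
  by (rule measurable_compose[OF measurable_swap])

lemma nn_integral_swap:
  assumes "f \<in> borel_measurable P"
  shows "(\<integral>\<^sup>+ z. f (snd z, fst z) \<partial>P) = (\<integral>\<^sup>+ z. f z \<partial>P)"
  using nn_integral_distr[OF measurable_swap, of f] assms by (simp add: distr_swap)

lemma AE_swap:
  assumes "AE z in P. Q z"
  shows "AE z in P. Q (snd z, fst z)"
proof -
  have "{z \<in> space P. Q z} \<in> sets P"
    by (rule completion.in_sets_AE[of "space P"]) (use assms in auto)
  then show ?thesis
    using AE_distr_iff[OF measurable_swap, of Q] assms unfolding distr_swap by simp
qed

lemma AE_P_snd:
  assumes "AE x in M. Q x"
  shows "AE z in P. Q (snd z)"
  using AE_swap[OF AE_P_fst[OF assms]] by simp

lemma integrable_swap: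
  fixes f :: "'a \<times> 'a \<Rightarrow> 'b::{banach, second_countable_topology}"
  assumes "integrable P f"
  shows "integrable P (\<lambda>z. f (snd z, fst z))"
    and "(\<integral>z. f (snd z, fst z) \<partial>P) = (\<integral>z. f z \<partial>P)"
  using assms integrable_distr_eq[OF measurable_swap, of f] integral_distr[OF measurable_swap, of f]
  by (auto simp: distr_swap)

lemma
  fixes f :: "'a \<times> 'a \<Rightarrow> 'b::euclidean_space"
  assumes f: "f \<in> borel_measurable P"
  shows measurable_sections: "AE x in M. (\<lambda>y. f (x, y)) \<in> borel_measurable M"
    and measurable_integral_sections: "(\<lambda>x. \<integral>y. f (x, y) \<partial>M) \<in> borel_measurable M"
proof -
  obtain g where g[measurable]: "g \<in> borel_measurable (M \<Otimes>\<^sub>M M)" and "AE z in M \<Otimes>\<^sub>M M. f z = g z"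
    using completion_ex_borel_measurable_euclidean[OF f] by auto
  from pair.AE_pair[OF this(2)] have eq: "AE x in M. AE y in M. g (x, y) = f (x, y)"
    by (simp add: eq_commute)
  then show sec: "AE x in M. (\<lambda>y. f (x, y)) \<in> borel_measurable M"
    using AE_space
  proof eventually_elim
    case (elim x)
    have "(\<lambda>y. g (x, y)) \<in> borel_measurable M" using elim(2) by measurable
    then show ?case by (rule borel_measurable_cong_AE[OF _ elim(1)])
  qed
  show "(\<lambda>x. \<integral>y. f (x, y) \<partial>M) \<in> borel_measurable M"
  proof (rule borel_measurable_cong_AE)
    show "(\<lambda>x. \<integral>y. g (x, y) \<partial>M) \<in> borel_measurable M" by measurable
    show "AE x in M. (\<integral>y. g (x, y) \<partial>M) = (\<integral>y. f (x, y) \<partial>M)"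
      using eq sec AE_space
    proof eventually_elim
      case (elim x)
      have "(\<lambda>y. g (x, y)) \<in> borel_measurable M" using elim(3) by measurable
      then show ?case using elim by (intro integral_cong_AE) auto
    qed
  qed
qed

lemma
  fixes f :: "'a \<times> 'a \<Rightarrow> 'b::euclidean_space"
  assumes f: "integrable P f"
  shows integrable_integral_sections: "integrable M (\<lambda>x. \<integral>y. f (x, y) \<partial>M)"
    and integral_P: "(\<integral>z. f z \<partial>P) = (\<integral>x. \<integral>y. f (x, y) \<partial>M \<partial>M)"
proof -
  have fP: "f \<in> borel_measurable P" using f by auto
  obtain g where g[measurable]: "g \<in> borel_measurable (M \<Otimes>\<^sub>M M)" and fg: "AE z in M \<Otimes>\<^sub>M M. f z = g z"
    using completion_ex_borel_measurable_euclidean[OF fP] by auto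
  have gP: "g \<in> borel_measurable P" by (rule measurable_completion) fact
  have fg': "AE z in P. f z = g z" using fg unfolding AE_P_iff .
  have "integrable P g" using f fg' fP gP by (subst integrable_cong_AE[symmetric]) auto
  then have gi: "integrable (M \<Otimes>\<^sub>M M) g" by (simp add: integrable_completion)
  from pair.AE_pair[OF fg] measurable_sections[OF fP] AE_space
  have eq: "AE x in M. (AE y in M. f (x, y) = g (x, y)) \<and>
     (\<lambda>y. f (x, y)) \<in> borel_measurable M \<and> (\<lambda>y. g (x, y)) \<in> borel_measurable M"
  proof eventually_elim
    case (elim x)
    have "(\<lambda>y. g (x, y)) \<in> borel_measurable M" using elim(3) by measurable
    with elim show ?case by simp
  qed
  have eq': "AE x in M. (\<integral>y. f (x, y) \<partial>M) = (\<integral>y. g (x, y) \<partial>M)"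
    using eq by eventually_elim (auto intro!: integral_cong_AE)
  have mg: "(\<lambda>x. \<integral>y. g (x, y) \<partial>M) \<in> borel_measurable M" by measurable
  show "integrable M (\<lambda>x. \<integral>y. f (x, y) \<partial>M)"
    using pair.integrable_fst'[OF gi] eq' mg measurable_integral_sections[OF fP]
    by (subst integrable_cong_AE) auto
  have "(\<integral>z. f z \<partial>P) = (\<integral>z. g z \<partial>P)" using fg' fP gP by (intro integral_cong_AE) auto
  also have "\<dots> = (\<integral>z. g z \<partial>(M \<Otimes>\<^sub>M M))" by (rule integral_completion) fact
  also have "\<dots> = (\<integral>x. \<integral>y. g (x, y) \<partial>M \<partial>M)" by (rule pair.integral_fst'[OF gi, symmetric])
  also have "\<dots> = (\<integral>x. \<integral>y. f (x, y) \<partial>M \<partial>M)"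
    using eq' mg measurable_integral_sections[OF fP] by (intro integral_cong_AE) auto
  finally show "(\<integral>z. f z \<partial>P) = (\<integral>x. \<integral>y. f (x, y) \<partial>M \<partial>M)" .
qed

end

section \<open>Square-integrable functions\<close>

lemma Lp_space_2_iff:
  "f \<in> Lp_space M 2 \<longleftrightarrow> f \<in> borel_measurable M \<and> integrable M (\<lambda>x. (norm (f x))\<^sup>2)"
  by (simp add: Lp_space_def)

lemma mult_le_sum_squares: "a * b \<le> a\<^sup>2 + (b :: real)\<^sup>2"
proof -
  have "0 \<le> (a - b)\<^sup>2 + (a\<^sup>2 + b\<^sup>2)" by simp
  then show ?thesis by (simp add: power2_eq_square algebra_simps)
qed

lemma borel_measurable_cnj [measurable]:
  "f \<in> borel_measurable M \<Longrightarrow> (\<lambda>x. cnj (f x)) \<in> borel_measurable M"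
  by (rule borel_measurable_continuous_on[OF continuous_on_cnj[OF continuous_on_id]])

lemma integrable_mult_of_squares:
  fixes f g :: "'a \<Rightarrow> complex"
  assumes "f \<in> borel_measurable M" "g \<in> borel_measurable M"
    and "integrable M (\<lambda>x. (norm (f x))\<^sup>2)" "integrable M (\<lambda>x. (norm (g x))\<^sup>2)"
  shows "integrable M (\<lambda>x. f x * g x)"
proof (rule Bochner_Integration.integrable_bound)
  show "integrable M (\<lambda>x. (norm (f x))\<^sup>2 + (norm (g x))\<^sup>2)" using assms by auto
  show "AE x in M. norm (f x * g x) \<le> norm ((norm (f x))\<^sup>2 + (norm (g x))\<^sup>2)"
  proof (rule AE_I2)
    fix x
    have "norm (f x) * norm (g x) \<le> (norm (f x))\<^sup>2 + (norm (g x))\<^sup>2"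
      by (rule mult_le_sum_squares)
    then show "norm (f x * g x) \<le> norm ((norm (f x))\<^sup>2 + (norm (g x))\<^sup>2)"
      by (simp add: norm_mult)
  qed
qed (use assms in measurable)

lemma L2_scale: "f \<in> Lp_space M 2 \<Longrightarrow> (\<lambda>x. c * f x) \<in> Lp_space M 2"
  by (simp add: Lp_space_2_iff norm_mult power_mult_distrib borel_measurable_times)

lemma L2_cnj: "f \<in> Lp_space M 2 \<Longrightarrow> (\<lambda>x. cnj (f x)) \<in> Lp_space M 2"
  by (simp add: Lp_space_2_iff borel_measurable_cnj)

lemma L2_add:
  assumes "f \<in> Lp_space M 2" "g \<in> Lp_space M 2"
  shows "(\<lambda>x. f x + g x) \<in> Lp_space M 2"
proof -
  have f: "f \<in> borel_measurable M" "integrable M (\<lambda>x. (norm (f x))\<^sup>2)"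
    and g: "g \<in> borel_measurable M" "integrable M (\<lambda>x. (norm (g x))\<^sup>2)"
    using assms by (auto simp: Lp_space_2_iff)
  have "integrable M (\<lambda>x. (norm (f x + g x))\<^sup>2)"
  proof (rule Bochner_Integration.integrable_bound)
    show "integrable M (\<lambda>x. 2 * (norm (f x))\<^sup>2 + 2 * (norm (g x))\<^sup>2)" using f g by simp
    show "AE x in M. norm ((norm (f x + g x))\<^sup>2) \<le> norm (2 * (norm (f x))\<^sup>2 + 2 * (norm (g x))\<^sup>2)"
    proof (rule AE_I2)
      fix x
      have "(norm (f x + g x))\<^sup>2 + (norm (f x - g x))\<^sup>2 = 2 * (norm (f x))\<^sup>2 + 2 * (norm (g x))\<^sup>2"
        by (simp only: cmod_power2) (simp add: power2_eq_square algebra_simps)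
      then have "(norm (f x + g x))\<^sup>2 \<le> 2 * (norm (f x))\<^sup>2 + 2 * (norm (g x))\<^sup>2"
        using zero_le_power2[of "norm (f x - g x)"] by linarith
      then show "norm ((norm (f x + g x))\<^sup>2) \<le> norm (2 * (norm (f x))\<^sup>2 + 2 * (norm (g x))\<^sup>2)"
        by simp
    qed
  qed (use f g in measurable)
  then show ?thesis using f g by (simp add: Lp_space_2_iff)
qed

lemma L2_integrable_mult_cnj:
  assumes "f \<in> Lp_space M 2" "g \<in> Lp_space M 2"
  shows "integrable M (\<lambda>x. f x * cnj (g x))"
  using assms by (intro integrable_mult_of_squares) (auto simp: Lp_space_2_iff intro: borel_measurable_cnj)

lemma L2_integrable_bounded_mult:
  assumes r: "r \<in> borel_measurable M" and b: "AE x in M. \<bar>r x\<bar> \<le> (C :: real)"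
    and "f \<in> Lp_space M 2" "g \<in> Lp_space M 2"
  shows "integrable M (\<lambda>x. complex_of_real (r x) * f x * cnj (g x))"
proof (rule Bochner_Integration.integrable_bound)
  have "integrable M (\<lambda>x. C * norm (f x * cnj (g x)))"
    using L2_integrable_mult_cnj[OF assms(3,4)] by (intro integrable_mult_right integrable_norm)
  then show "integrable M (\<lambda>x. C * (norm (f x) * norm (g x)))" by (simp add: norm_mult)
  show "AE x in M. norm (complex_of_real (r x) * f x * cnj (g x)) \<le> norm (C * (norm (f x) * norm (g x)))"
    using b
  proof eventually_elim
    case (elim x)
    then have "\<bar>r x\<bar> \<le> \<bar>C\<bar>" by linarith
    then show ?case by (simp add: norm_mult mult.assoc abs_mult mult_right_mono)
  qed
qed (use assms in \<open>auto simp: Lp_space_2_iff intro!: borel_measurable_times borel_measurable_of_real borel_measurable_cnj\<close>)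

context complete_finite_measure
begin

lemma
  fixes f g :: "'a \<Rightarrow> complex"
  assumes f: "integrable M f" and g: "integrable M g"
  shows integrable_P_mult: "integrable P (\<lambda>z. f (fst z) * g (snd z))"
    and integral_P_mult: "(\<integral>z. f (fst z) * g (snd z) \<partial>P) = (\<integral>x. f x \<partial>M) * (\<integral>y. g y \<partial>M)"
proof -
  have mf: "f \<in> borel_measurable M" and mg: "g \<in> borel_measurable M" using f g by auto
  note m = measurable_P_fst[OF mf] measurable_P_snd[OF mg]
  have "(\<integral>\<^sup>+z. ennreal (norm (f (fst z) * g (snd z))) \<partial>P) =
      (\<integral>\<^sup>+x. \<integral>\<^sup>+y. ennreal (norm (f x)) * ennreal (norm (g y)) \<partial>M \<partial>M)"
    using m by (subst nn_integral_P) (auto simp: norm_mult ennreal_mult)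
  also have "\<dots> = (\<integral>\<^sup>+x. ennreal (norm (f x)) \<partial>M) * (\<integral>\<^sup>+y. ennreal (norm (g y)) \<partial>M)"
    using mf mg by (simp add: nn_integral_cmult nn_integral_multc)
  also have "\<dots> < \<infinity>"
    using f g by (simp add: integrable_iff_bounded ennreal_mult_less_top)
  finally show *: "integrable P (\<lambda>z. f (fst z) * g (snd z))"
    using m by (simp add: integrable_iff_bounded)
  show "(\<integral>z. f (fst z) * g (snd z) \<partial>P) = (\<integral>x. f x \<partial>M) * (\<integral>y. g y \<partial>M)"
    by (simp add: integral_P[OF *])
qed

lemma L2_swap: "F \<in> Lp_space P 2 \<Longrightarrow> (\<lambda>z. F (snd z, fst z)) \<in> Lp_space P 2"
  using integrable_swap(1)[of "\<lambda>z. (norm (F z))\<^sup>2"] by (simp add: Lp_space_2_iff borel_measurable_swap)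

text \<open>
  Against a symmetric function, only the symmetric part of \<open>p\<close> is seen.
\<close>

lemma
  assumes p: "p \<in> Lp_space P 2" and F: "F \<in> Lp_space P 2" and sym: "AE z in P. F z = F (snd z, fst z)"
  shows integrable_swap_mult_symmetric: "integrable P (\<lambda>z. p (snd z, fst z) * F z)"
    and integral_swap_mult_symmetric: "(\<integral>z. p (snd z, fst z) * F z \<partial>P) = (\<integral>z. p z * F z \<partial>P)"
proof -
  let ?s = "\<lambda>z :: 'a \<times> 'a. (snd z, fst z)"
  have pF: "integrable P (\<lambda>z. p z * F z)"
    using p F by (intro integrable_mult_of_squares) (auto simp: Lp_space_2_iff)
  have m: "(\<lambda>z. p (?s z) * F z) \<in> borel_measurable P" "(\<lambda>z. p (?s z) * F (?s z)) \<in> borel_measurable P"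
    using L2_swap[OF p] L2_swap[OF F] F by (auto simp: Lp_space_2_iff)
  have eq: "AE z in P. p (?s z) * F z = p (?s z) * F (?s z)"
    using sym by eventually_elim simp
  show "integrable P (\<lambda>z. p (?s z) * F z)"
    using integrable_swap(1)[OF pF] by (subst integrable_cong_AE[OF m eq])
  show "(\<integral>z. p (?s z) * F z \<partial>P) = (\<integral>z. p z * F z \<partial>P)"
    using integrable_swap(2)[OF pF] by (subst integral_cong_AE[OF m eq])
qed

text \<open>
  By Tonelli. With \<open>r = |v|\<^sup>2\<close> and \<open>r = |v|\<^sup>2 / W\<close> this gives a meaning to all terms that arise in
  completing the square.
\<close>

lemma
  fixes r :: "'a \<times> 'a \<Rightarrow> real" and h :: "'a \<Rightarrow> real"
  assumes r: "r \<in> borel_measurable P" "AE z in P. 0 \<le> r z"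
    and sections: "AE x in M. (\<integral>\<^sup>+y. ennreal (r (x, y)) \<partial>M) \<le> ennreal C"
    and h: "integrable M h" "\<And>x. 0 \<le> h x"
  shows integrable_P_sections: "integrable P (\<lambda>z. r z * h (fst z))"
    and integral_P_sections: "(\<integral>z. r z * h (fst z) \<partial>P) = (\<integral>x. (\<integral>y. r (x, y) \<partial>M) * h x \<partial>M)"
proof -
  have mh: "h \<in> borel_measurable M" using h by auto
  note m = measurable_P_fst[OF mh]
  have "(\<integral>\<^sup>+z. ennreal (norm (r z * h (fst z))) \<partial>P) = (\<integral>\<^sup>+z. ennreal (h (fst z)) * ennreal (r z) \<partial>P)"
    using r(2) h(2) by (intro nn_integral_cong_AE) (auto simp: ennreal_mult mult.commute elim!: AE_mp)
  also have "\<dots> = (\<integral>\<^sup>+x. \<integral>\<^sup>+y. ennreal (h x) * ennreal (r (x, y)) \<partial>M \<partial>M)"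
    using m r by (subst nn_integral_P) auto
  also have "\<dots> \<le> (\<integral>\<^sup>+x. ennreal C * ennreal (h x) \<partial>M)"
  proof (rule nn_integral_mono_AE)
    show "AE x in M. (\<integral>\<^sup>+y. ennreal (h x) * ennreal (r (x, y)) \<partial>M) \<le> ennreal C * ennreal (h x)"
      using sections measurable_sections[OF r(1)]
    proof eventually_elim
      case (elim x)
      have "(\<integral>\<^sup>+y. ennreal (h x) * ennreal (r (x, y)) \<partial>M) = ennreal (h x) * (\<integral>\<^sup>+y. ennreal (r (x, y)) \<partial>M)"
        using elim(2) by (intro nn_integral_cmult) measurable
      also have "\<dots> \<le> ennreal (h x) * ennreal C" using elim(1) by (intro mult_left_mono) auto
      finally show ?case by (simp add: mult.commute)
    qed
  qed
  also have "\<dots> < \<infinity>"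
    using h by (simp add: nn_integral_cmult nn_integral_eq_integral ennreal_mult_less_top)
  finally show *: "integrable P (\<lambda>z. r z * h (fst z))"
    using m r by (simp add: integrable_iff_bounded)
  show "(\<integral>z. r z * h (fst z) \<partial>P) = (\<integral>x. (\<integral>y. r (x, y) \<partial>M) * h x \<partial>M)"
    by (simp add: integral_P[OF *])
qed

end

section \<open>Kernels with bounded sections\<close>

locale section_bounded_kernel = complete_finite_measure M for M :: "'a measure" +
  fixes v :: "'a \<times> 'a \<Rightarrow> complex" and Cv :: real
  assumes v_measurable: "v \<in> borel_measurable P"
    and v_sections: "AE x in M. (\<integral>\<^sup>+y. ennreal ((norm (v (x, y)))\<^sup>2) \<partial>M) \<le> ennreal Cv"
begin

lemma kernel_mult_L2:
  assumes f: "f \<in> Lp_space M 2"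
  shows "(\<lambda>z. v z * cnj (f (fst z))) \<in> Lp_space P 2"
proof -
  have f_meas: "f \<in> borel_measurable M" and f2: "integrable M (\<lambda>x. (norm (f x))\<^sup>2)"
    using f by (auto simp: Lp_space_2_iff)
  have "(\<lambda>z. v z * cnj (f (fst z))) \<in> borel_measurable P"
    by (intro borel_measurable_times v_measurable borel_measurable_cnj measurable_P_fst f_meas)
  moreover have "integrable P (\<lambda>z. (norm (v z))\<^sup>2 * (norm (f (fst z)))\<^sup>2)"
    using v_measurable by (intro integrable_P_sections[OF _ _ v_sections f2]) auto
  ultimately show ?thesis
    by (simp add: Lp_space_2_iff norm_mult power_mult_distrib)
qed

definition pairing :: "('a \<times> 'a \<Rightarrow> complex) \<Rightarrow> ('a \<Rightarrow> complex) \<Rightarrow> complex" where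
  "pairing F f = (\<integral>z. v z * F z * cnj (f (fst z)) \<partial>P)"

lemma integrable_pairing:
  assumes "F \<in> Lp_space P 2" "f \<in> Lp_space M 2"
  shows "integrable P (\<lambda>z. v z * F z * cnj (f (fst z)))"
proof -
  have "integrable P (\<lambda>z. F z * (v z * cnj (f (fst z))))"
    using assms(1) kernel_mult_L2[OF assms(2)]
    by (intro integrable_mult_of_squares) (auto simp: Lp_space_2_iff)
  then show ?thesis by (simp add: mult_ac)
qed

text \<open>
  Cauchy-Schwarz in the second variable, for almost every value of the first.
\<close>

lemma kernel_integral_L2:
  assumes F: "F \<in> Lp_space P 2"
  shows "(\<lambda>x. \<integral>y. v (x, y) * F (x, y) \<partial>M) \<in> Lp_space M 2"
proof -
  let ?g = "\<lambda>x. \<integral>y. v (x, y) * F (x, y) \<partial>M"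
  have F_meas: "F \<in> borel_measurable P" and F2: "integrable P (\<lambda>z. (norm (F z))\<^sup>2)"
    using F by (auto simp: Lp_space_2_iff)
  have g_meas: "?g \<in> borel_measurable M"
    using measurable_integral_sections[of "\<lambda>z. v z * F z"] F_meas v_measurable by simp
  have "AE x in M. ennreal ((norm (?g x))\<^sup>2) \<le> ennreal Cv * (\<integral>\<^sup>+y. ennreal ((norm (F (x, y)))\<^sup>2) \<partial>M)"
    using v_sections measurable_sections[OF v_measurable] measurable_sections[OF F_meas]
  proof eventually_elim
    case (elim x)
    note [measurable] = elim(2,3)
    have "ennreal (norm (?g x)) \<le> (\<integral>\<^sup>+y. ennreal (norm (v (x, y) * F (x, y))) \<partial>M)"
    proof (cases "integrable M (\<lambda>y. v (x, y) * F (x, y))")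
      case True
      then show ?thesis by (rule integral_norm_bound_ennreal)
    qed (simp add: not_integrable_integral_eq)
    also have "\<dots> = (\<integral>\<^sup>+y. ennreal (norm (v (x, y))) * ennreal (norm (F (x, y))) \<partial>M)"
      by (simp add: norm_mult ennreal_mult)
    finally have "(ennreal (norm (?g x)))\<^sup>2 \<le> (\<integral>\<^sup>+y. ennreal (norm (v (x, y))) * ennreal (norm (F (x, y))) \<partial>M)\<^sup>2"
      by (intro power_mono) auto
    also have "\<dots> \<le> (\<integral>\<^sup>+y. (ennreal (norm (v (x, y))))\<^sup>2 \<partial>M) * (\<integral>\<^sup>+y. (ennreal (norm (F (x, y))))\<^sup>2 \<partial>M)"
      by (rule Cauchy_Schwarz_nn_integral) measurable
    also have "\<dots> \<le> ennreal Cv * (\<integral>\<^sup>+y. ennreal ((norm (F (x, y)))\<^sup>2) \<partial>M)"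
      using elim(1) by (simp add: ennreal_power mult_right_mono)
    finally show ?case by (simp add: ennreal_power)
  qed
  then have "(\<integral>\<^sup>+x. ennreal ((norm (?g x))\<^sup>2) \<partial>M) \<le>
      (\<integral>\<^sup>+x. ennreal Cv * (\<integral>\<^sup>+y. ennreal ((norm (F (x, y)))\<^sup>2) \<partial>M) \<partial>M)"
    by (rule nn_integral_mono_AE)
  also have "\<dots> = (\<integral>\<^sup>+x. \<integral>\<^sup>+y. ennreal Cv * ennreal ((norm (F (x, y)))\<^sup>2) \<partial>M \<partial>M)"
  proof (rule nn_integral_cong_AE)
    show "AE x in M. ennreal Cv * (\<integral>\<^sup>+y. ennreal ((norm (F (x, y)))\<^sup>2) \<partial>M) =
        (\<integral>\<^sup>+y. ennreal Cv * ennreal ((norm (F (x, y)))\<^sup>2) \<partial>M)"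
      using measurable_sections[OF F_meas]
      by eventually_elim (rule nn_integral_cmult[symmetric], measurable)
  qed
  also have "\<dots> = (\<integral>\<^sup>+z. ennreal Cv * ennreal ((norm (F z))\<^sup>2) \<partial>P)"
    using F_meas by (subst nn_integral_P) auto
  also have "\<dots> < \<infinity>"
    using F_meas F2 by (simp add: nn_integral_cmult nn_integral_eq_integral ennreal_mult_less_top)
  finally show ?thesis
    using g_meas by (simp add: Lp_space_2_iff integrable_iff_bounded)
qed

lemma pairing_eq_inner:
  assumes "F \<in> Lp_space P 2" "f \<in> Lp_space M 2"
  shows "L2_inner M (\<lambda>x. \<integral>y. v (x, y) * F (x, y) \<partial>M) f = pairing F f"
  unfolding L2_inner_def pairing_def
  by (simp add: integral_P[OF integrable_pairing[OF assms]])

text \<open>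
  The adjoint of \<open>F \<mapsto> \<integral> v (x, y) F (x, y) dy\<close> on all of \<open>L\<^sup>2\<close> maps \<open>f\<close> to \<open>cnj (v (x, y)) * f x\<close>;
  restricting the operator to symmetric \<open>F\<close> projects this onto the symmetric functions.
\<close>

definition symmetrized_adjoint :: "('a \<Rightarrow> complex) \<Rightarrow> 'a \<times> 'a \<Rightarrow> complex" where
  "symmetrized_adjoint f z = (cnj (v z) * f (fst z) + cnj (v (snd z, fst z)) * f (snd z)) / 2"

lemma symmetrized_adjoint_L2:
  assumes f: "f \<in> Lp_space M 2"
  shows "symmetrized_adjoint f \<in> Lp_space P 2"
    and "symmetrized_adjoint f z = symmetrized_adjoint f (snd z, fst z)"
    and "F \<in> Lp_space P 2 \<Longrightarrow> AE z in P. F z = F (snd z, fst z) \<Longrightarrow>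
           pairing F f = L2_inner P F (symmetrized_adjoint f)"
proof -
  let ?s = "\<lambda>z :: 'a \<times> 'a. (snd z, fst z)"
  define p where "p = (\<lambda>z. v z * cnj (f (fst z)))"
  have p: "p \<in> Lp_space P 2" unfolding p_def by (rule kernel_mult_L2[OF f])
  have eq: "symmetrized_adjoint f = (\<lambda>z. 1 / 2 * cnj (p z + p (?s z)))"
    by (auto simp: symmetrized_adjoint_def p_def fun_eq_iff)
  show "symmetrized_adjoint f \<in> Lp_space P 2"
    unfolding eq by (intro L2_scale L2_cnj L2_add p L2_swap)
  show "symmetrized_adjoint f z = symmetrized_adjoint f (snd z, fst z)"
    by (simp add: symmetrized_adjoint_def add.commute)
  assume F: "F \<in> Lp_space P 2" and sym: "AE z in P. F z = F (snd z, fst z)"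
  have pF: "integrable P (\<lambda>z. p z * F z)"
    using p F by (intro integrable_mult_of_squares) (auto simp: Lp_space_2_iff)
  have "L2_inner P F (symmetrized_adjoint f) = (\<integral>z. 1 / 2 * (p z * F z) + 1 / 2 * (p (?s z) * F z) \<partial>P)"
    by (simp add: L2_inner_def eq algebra_simps add_divide_distrib)
  also have "\<dots> = 1 / 2 * (\<integral>z. p z * F z \<partial>P) + 1 / 2 * (\<integral>z. p (?s z) * F z \<partial>P)"
    using pF integrable_swap_mult_symmetric[OF p F sym]
    by (subst Bochner_Integration.integral_add) auto
  also have "\<dots> = (\<integral>z. p z * F z \<partial>P)"
    using integral_swap_mult_symmetric[OF p F sym] by simp
  finally show "pairing F f = L2_inner P F (symmetrized_adjoint f)"
    by (simp add: pairing_def p_def mult_ac)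
qed

end

section \<open>Completing the square\<close>

text \<open>
  In the application, \<open>u = w1 - m\<close> and \<open>W = w2 - m\<close>.
\<close>

locale two_particle_form = section_bounded_kernel M v Cv for M :: "'a measure" and v :: "'a \<times> 'a \<Rightarrow> complex" and Cv :: real +
  fixes u :: "'a \<Rightarrow> real" and W :: "'a \<times> 'a \<Rightarrow> real"
    and Cu CW CK :: real
  assumes u_measurable: "u \<in> borel_measurable M" and u_bound: "AE x in M. \<bar>u x\<bar> \<le> Cu"
    and W_measurable: "W \<in> borel_measurable P"
    and W_pos: "AE z in P. 0 < W z" and W_bound: "AE z in P. \<bar>W z\<bar> \<le> CW"
    and W_sym: "AE z in P. W (snd z, fst z) = W z"
    and vW_sections: "AE x in M. (\<integral>\<^sup>+y. ennreal ((norm (v (x, y)))\<^sup>2 / W (x, y)) \<partial>M) \<le> ennreal CK"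
begin

text \<open>
  The Schur complement of the two-particle block is \<open>D - T\<close>: multiplication by \<open>D\<close> minus the integral
  operator whose form is \<open>exchange\<close>.
\<close>

definition D :: "'a \<Rightarrow> real" where
  "D x = u x - 1 / 2 * (\<integral>y. (norm (v (x, y)))\<^sup>2 / W (x, y) \<partial>M)"

text \<open>
  The integrand is the real part of \<open>T(x, y) f(x) cnj (f(y))\<close> for the kernel
  \<open>T(x, y) = cnj (v (x, y)) v (y, x) / (2 W(x, y))\<close>.
\<close>

definition exchange :: "('a \<Rightarrow> complex) \<Rightarrow> real" where
  "exchange f = (\<integral>z. Re (v z * cnj (v (snd z, fst z)) * cnj (f (fst z)) * f (snd z)) / (2 * W z) \<partial>P)"

lemma D_measurable: "D \<in> borel_measurable M"
  unfolding D_def using u_measurable v_measurable W_measurable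
  by (intro borel_measurable_diff borel_measurable_times borel_measurable_const measurable_integral_sections) auto

lemma D_bound: "AE x in M. \<bar>D x\<bar> \<le> Cu + \<bar>CK\<bar>"
proof -
  have mP: "(\<lambda>z. (norm (v z))\<^sup>2 / W z) \<in> borel_measurable P"
    using v_measurable W_measurable by auto
  show ?thesis
    using u_bound vW_sections measurable_sections[OF mP] AE_P_sections[OF W_pos]
  proof eventually_elim
    case (elim x)
    have nn: "AE y in M. 0 \<le> (norm (v (x, y)))\<^sup>2 / W (x, y)"
      using elim(4) by eventually_elim simp
    have "(\<integral>\<^sup>+y. ennreal ((norm (v (x, y)))\<^sup>2 / W (x, y)) \<partial>M) \<le> ennreal \<bar>CK\<bar>"
      using elim(2) by (rule order_trans) (simp add: ennreal_leI)
    then have "(\<integral>y. (norm (v (x, y)))\<^sup>2 / W (x, y) \<partial>M) \<le> \<bar>CK\<bar>"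
      using nn elim(3) by (subst integral_eq_nn_integral) (auto intro: enn2real_leI)
    moreover have "0 \<le> (\<integral>y. (norm (v (x, y)))\<^sup>2 / W (x, y) \<partial>M)"
      using nn by (rule integral_nonneg_AE)
    ultimately show ?case using elim(1) unfolding D_def by linarith
  qed
qed

text \<open>
  As \<open>F\<close> is symmetric, it is paired only with the symmetrisation of \<open>(x, y) \<mapsto> v (x, y) * cnj (f x)\<close>.
  Completing the square costs the squared modulus of this symmetrisation, divided by \<open>W\<close>: its two
  diagonal terms agree after exchanging the variables and combine with \<open>u\<close> to \<open>D\<close>, the mixed term
  is \<open>exchange f\<close>.
\<close>

lemma form_ge_Schur_complement:
  assumes f: "f \<in> Lp_space M 2" and F: "F \<in> Lp_space P 2"
    and sym: "AE z in P. F z = F (snd z, fst z)"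
  shows "(\<integral>x. D x * (norm (f x))\<^sup>2 \<partial>M) - exchange f
       \<le> (\<integral>x. u x * (norm (f x))\<^sup>2 \<partial>M) + 2 * Re (pairing F f)
          + (\<integral>z. W z * (norm (F z))\<^sup>2 \<partial>P)"
proof -
  let ?s = "\<lambda>z :: 'a \<times> 'a. (snd z, fst z)"
  note [measurable] = v_measurable W_measurable
  have f_meas[measurable]: "f \<in> borel_measurable M" and f2: "integrable M (\<lambda>x. (norm (f x))\<^sup>2)"
    and F_meas[measurable]: "F \<in> borel_measurable P" and F2: "integrable P (\<lambda>z. (norm (F z))\<^sup>2)"
    using f F by (auto simp: Lp_space_2_iff)
  define p where "p = (\<lambda>z. v z * cnj (f (fst z)))"
  define q where "q = (\<lambda>z. p (?s z))"
  have p_meas[measurable]: "p \<in> borel_measurable P"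
    unfolding p_def by (intro borel_measurable_times v_measurable borel_measurable_cnj measurable_P_fst f_meas)
  have q_meas[measurable]: "q \<in> borel_measurable P"
    unfolding q_def using p_meas by (rule borel_measurable_swap)
  have p2: "integrable P (\<lambda>z. (norm (p z))\<^sup>2)"
    using kernel_mult_L2[OF f] by (simp add: p_def Lp_space_2_iff)
  have pF: "integrable P (\<lambda>z. p z * F z)"
    by (rule integrable_mult_of_squares) (use p2 F2 in auto)
  have p_L2: "p \<in> Lp_space P 2" using p2 by (simp add: Lp_space_2_iff)
  have qF: "integrable P (\<lambda>z. q z * F z)" "(\<integral>z. q z * F z \<partial>P) = (\<integral>z. p z * F z \<partial>P)"
    unfolding q_def using integrable_swap_mult_symmetric[OF p_L2 F sym] integral_swap_mult_symmetric[OF p_L2 F sym]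
    by simp_all
  have vW_meas: "(\<lambda>z. (norm (v z))\<^sup>2 / W z) \<in> borel_measurable P"
    using v_measurable W_measurable by measurable
  have vW_nonneg: "AE z in P. 0 \<le> (norm (v z))\<^sup>2 / W z"
    using W_pos by eventually_elim simp
  have pW_eq: "(norm (p z))\<^sup>2 / W z = (norm (v z))\<^sup>2 / W z * (norm (f (fst z)))\<^sup>2" for z
    by (simp add: p_def norm_mult power_mult_distrib)
  have pW: "integrable P (\<lambda>z. (norm (p z))\<^sup>2 / W z)"
    and pW_int: "(\<integral>z. (norm (p z))\<^sup>2 / W z \<partial>P) =
        (\<integral>x. (\<integral>y. (norm (v (x, y)))\<^sup>2 / W (x, y) \<partial>M) * (norm (f x))\<^sup>2 \<partial>M)"
    unfolding pW_eq
    by (rule integrable_P_sections[OF vW_meas vW_nonneg vW_sections f2],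
        simp, rule integral_P_sections[OF vW_meas vW_nonneg vW_sections f2], simp)
  have qW: "integrable P (\<lambda>z. (norm (q z))\<^sup>2 / W z)"
    and qW_int: "(\<integral>z. (norm (q z))\<^sup>2 / W z \<partial>P) = (\<integral>z. (norm (p z))\<^sup>2 / W z \<partial>P)"
  proof -
    have eq: "AE z in P. (norm (q z))\<^sup>2 / W z = (norm (p (?s z)))\<^sup>2 / W (?s z)"
      using W_sym by eventually_elim (simp add: q_def)
    have m: "(\<lambda>z. (norm (p (?s z)))\<^sup>2 / W (?s z)) \<in> borel_measurable P"
      using borel_measurable_swap[of "\<lambda>z. (norm (p z))\<^sup>2 / W z" borel] by simp
    show "integrable P (\<lambda>z. (norm (q z))\<^sup>2 / W z)"
      using integrable_swap(1)[OF pW] eq m by (subst integrable_cong_AE[OF _ _ eq]) auto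
    have "(\<integral>z. (norm (q z))\<^sup>2 / W z \<partial>P) = (\<integral>z. (norm (p (?s z)))\<^sup>2 / W (?s z) \<partial>P)"
      using eq m by (intro integral_cong_AE) auto
    then show "(\<integral>z. (norm (q z))\<^sup>2 / W z \<partial>P) = (\<integral>z. (norm (p z))\<^sup>2 / W z \<partial>P)"
      using integrable_swap(2)[OF pW] by simp
  qed
  have WF: "integrable P (\<lambda>z. W z * (norm (F z))\<^sup>2)"
  proof (rule Bochner_Integration.integrable_bound)
    show "integrable P (\<lambda>z. CW * (norm (F z))\<^sup>2)" using F2 by simp
    show "AE z in P. norm (W z * (norm (F z))\<^sup>2) \<le> norm (CW * (norm (F z))\<^sup>2)"
      using W_bound by eventually_elim (auto simp: abs_mult intro!: mult_right_mono)
  qed measurable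
  have pq: "integrable P (\<lambda>z. Re (p z * cnj (q z)) / (2 * W z))"
  proof (rule Bochner_Integration.integrable_bound)
    show "integrable P (\<lambda>z. (norm (p z))\<^sup>2 / W z + (norm (q z))\<^sup>2 / W z)" using pW qW by simp
    show "AE z in P. norm (Re (p z * cnj (q z)) / (2 * W z)) \<le> norm ((norm (p z))\<^sup>2 / W z + (norm (q z))\<^sup>2 / W z)"
      using W_pos
    proof eventually_elim
      case (elim z)
      have "\<bar>Re (p z * cnj (q z))\<bar> \<le> norm (p z) * norm (q z)"
        using abs_Re_le_cmod[of "p z * cnj (q z)"] by (simp add: norm_mult)
      also have "\<dots> \<le> 2 * ((norm (p z))\<^sup>2 + (norm (q z))\<^sup>2)"
        using mult_le_sum_squares[of "norm (p z)" "norm (q z)"] by (rule order_trans) simp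
      finally have "\<bar>Re (p z * cnj (q z))\<bar> / (2 * W z) \<le> 2 * ((norm (p z))\<^sup>2 + (norm (q z))\<^sup>2) / (2 * W z)"
        using elim by (intro divide_right_mono) auto
      also have "\<dots> = (norm (p z))\<^sup>2 / W z + (norm (q z))\<^sup>2 / W z"
        by (simp add: add_divide_distrib)
      finally have "\<bar>Re (p z * cnj (q z))\<bar> / (2 * W z) \<le> (norm (p z))\<^sup>2 / W z + (norm (q z))\<^sup>2 / W z" .
      then show ?case using elim by (simp del: complex_cnj_mult times_complex.sel complex_cnj)
    qed
  qed measurable
  have exch: "exchange f = (\<integral>z. Re (p z * cnj (q z)) / (2 * W z) \<partial>P)"
    by (simp add: exchange_def p_def q_def mult_ac)
  have "(\<integral>z. - (((norm (p z))\<^sup>2 / W z + (norm (q z))\<^sup>2 / W z) / 4) - Re (p z * cnj (q z)) / (2 * W z) \<partial>P)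
      \<le> (\<integral>z. W z * (norm (F z))\<^sup>2 + Re (p z * F z) + Re (q z * F z) \<partial>P)"
  proof (rule integral_mono_AE)
    show "AE z in P. - (((norm (p z))\<^sup>2 / W z + (norm (q z))\<^sup>2 / W z) / 4) - Re (p z * cnj (q z)) / (2 * W z)
      \<le> W z * (norm (F z))\<^sup>2 + Re (p z * F z) + Re (q z * F z)"
      using W_pos
    proof eventually_elim
      case (elim z)
      let ?w = "W z" and ?g = "p z + q z"
      \<comment> \<open>the completed square, multiplied by \<open>4 * ?w\<close>\<close>
      have "0 \<le> (norm (of_real (2 * ?w) * F z + cnj ?g))\<^sup>2" by simp
      also have "\<dots> = 4 * ?w\<^sup>2 * (norm (F z))\<^sup>2 + 4 * ?w * (Re (p z * F z) + Re (q z * F z))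
         + ((norm (p z))\<^sup>2 + (norm (q z))\<^sup>2 + 2 * Re (p z * cnj (q z)))"
        by (simp only: cmod_power2) (simp add: power2_eq_square algebra_simps)
      finally have "0 \<le> (4 * ?w\<^sup>2 * (norm (F z))\<^sup>2 + 4 * ?w * (Re (p z * F z) + Re (q z * F z))
         + ((norm (p z))\<^sup>2 + (norm (q z))\<^sup>2 + 2 * Re (p z * cnj (q z)))) / (4 * ?w)"
        using elim by simp
      also have "\<dots> = ?w * (norm (F z))\<^sup>2 + Re (p z * F z) + Re (q z * F z)
         + (((norm (p z))\<^sup>2 / ?w + (norm (q z))\<^sup>2 / ?w) / 4 + Re (p z * cnj (q z)) / (2 * ?w))"
        using elim by (simp add: field_simps power2_eq_square)
      finally show ?case by linarith
    qed
    show "integrable P (\<lambda>z. - (((norm (p z))\<^sup>2 / W z + (norm (q z))\<^sup>2 / W z) / 4) - Re (p z * cnj (q z)) / (2 * W z))"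
      by (intro Bochner_Integration.integrable_diff Bochner_Integration.integrable_minus
          Bochner_Integration.integrable_divide Bochner_Integration.integrable_add pW qW pq)
    show "integrable P (\<lambda>z. W z * (norm (F z))\<^sup>2 + Re (p z * F z) + Re (q z * F z))"
      by (intro Bochner_Integration.integrable_add integrable_Re WF pF qF(1))
  qed
  also have "\<dots> = (\<integral>z. W z * (norm (F z))\<^sup>2 \<partial>P) + 2 * Re (\<integral>z. p z * F z \<partial>P)"
    using WF integrable_Re[OF pF] integrable_Re[OF qF(1)]
    by (simp add: integral_Re[OF pF] integral_Re[OF qF(1)] qF(2) del: times_complex.sel)
  also have "(\<integral>z. - (((norm (p z))\<^sup>2 / W z + (norm (q z))\<^sup>2 / W z) / 4) - Re (p z * cnj (q z)) / (2 * W z) \<partial>P)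
     = - (1 / 2 * (\<integral>z. (norm (p z))\<^sup>2 / W z \<partial>P)) - exchange f"
    using pW qW pq by (simp add: qW_int exch del: times_complex.sel complex_cnj)
  finally have ineq: "- (1 / 2 * (\<integral>z. (norm (p z))\<^sup>2 / W z \<partial>P)) - exchange f
     \<le> (\<integral>z. W z * (norm (F z))\<^sup>2 \<partial>P) + 2 * Re (\<integral>z. p z * F z \<partial>P)" .
  have uf: "integrable M (\<lambda>x. u x * (norm (f x))\<^sup>2)"
  proof (rule Bochner_Integration.integrable_bound)
    show "integrable M (\<lambda>x. Cu * (norm (f x))\<^sup>2)" using f2 by simp
    show "AE x in M. norm (u x * (norm (f x))\<^sup>2) \<le> norm (Cu * (norm (f x))\<^sup>2)"
      using u_bound by eventually_elim (auto simp: abs_mult intro!: mult_right_mono)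
  qed (use u_measurable in measurable)
  have Kf: "integrable M (\<lambda>x. (\<integral>y. (norm (v (x, y)))\<^sup>2 / W (x, y) \<partial>M) * (norm (f x))\<^sup>2)"
    using integrable_integral_sections[OF pW] by (simp only: pW_eq fst_conv integral_mult_left_zero)
  have "(\<integral>x. D x * (norm (f x))\<^sup>2 \<partial>M) = (\<integral>x. u x * (norm (f x))\<^sup>2 -
      1 / 2 * ((\<integral>y. (norm (v (x, y)))\<^sup>2 / W (x, y) \<partial>M) * (norm (f x))\<^sup>2) \<partial>M)"
    by (simp add: D_def algebra_simps)
  also have "\<dots> = (\<integral>x. u x * (norm (f x))\<^sup>2 \<partial>M) - 1 / 2 * (\<integral>z. (norm (p z))\<^sup>2 / W z \<partial>P)"
    using uf Kf by (simp add: pW_int)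
  finally show "(\<integral>x. D x * (norm (f x))\<^sup>2 \<partial>M) - exchange f
       \<le> (\<integral>x. u x * (norm (f x))\<^sup>2 \<partial>M) + 2 * Re (pairing F f)
          + (\<integral>z. W z * (norm (F z))\<^sup>2 \<partial>P)"
    using ineq by (simp add: p_def pairing_def mult_ac)
qed

section \<open>A Birman-Schwinger bound\<close>

text \<open>
  With \<open>g i = sqrt D * e i\<close>, the functions \<open>(x, y) \<mapsto> g i x * cnj (g i y)\<close> are orthonormal, and
  \<open>exchange (e i)\<close> is the real part of the coefficient of the kernel
  \<open>k(x, y) = v (x, y) cnj (v (y, x)) / (2 W(x, y) sqrt (D x) sqrt (D y))\<close> with respect to them. Let
  \<open>\<theta>\<close> be their sum. Then \<open>0 \<le> \<parallel>k - \<theta>\<parallel>\<^sup>2 = \<parallel>k\<parallel>\<^sup>2 - 2 \<Sum>i\<in>I. exchange (e i) + card I\<close>.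
\<close>

lemma card_le_of_exchange_ge_1:
  fixes C :: real
  assumes I: "finite I"
    and e: "\<And>i. i \<in> I \<Longrightarrow> e i \<in> Lp_space M 2"
    and D_pos: "AE x in M. 0 < D x"
    and orthonormal: "\<And>i j. i \<in> I \<Longrightarrow> j \<in> I \<Longrightarrow>
        (\<integral>x. complex_of_real (D x) * e i x * cnj (e j x) \<partial>M) = (if i = j then 1 else 0)"
    and ge_1: "\<And>i. i \<in> I \<Longrightarrow> 1 \<le> exchange (e i)"
    and HS: "(\<integral>\<^sup>+z. ennreal ((norm (v z) * norm (v (snd z, fst z)))\<^sup>2 /
               (4 * (W z)\<^sup>2 * D (fst z) * D (snd z))) \<partial>P) \<le> ennreal C"
    and "0 \<le> C"
  shows "card I \<le> C"
proof -
  note Dm[measurable] = D_measurable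
  note [measurable] = v_measurable W_measurable borel_measurable_swap[OF v_measurable]
    measurable_P_fst[OF Dm] measurable_P_snd[OF Dm]
  have em[measurable]: "e i \<in> borel_measurable M" if "i \<in> I" for i
    using e[OF that] by (simp add: Lp_space_2_iff)
  define k where "k = (\<lambda>z. v z * cnj (v (snd z, fst z)) /
      of_real (2 * W z * sqrt (D (fst z)) * sqrt (D (snd z))))"
  define g where "g = (\<lambda>i x. of_real (sqrt (D x)) * e i x)"
  define \<theta> where "\<theta> = (\<lambda>z. \<Sum>i\<in>I. g i (fst z) * cnj (g i (snd z)))"
  have gm[measurable]: "g i \<in> borel_measurable M" if "i \<in> I" for i
    unfolding g_def using em[OF that] by measurable
  have km[measurable]: "k \<in> borel_measurable P"
    unfolding k_def by (intro borel_measurable_divide borel_measurable_times borel_measurable_cnj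
      borel_measurable_of_real borel_measurable_const borel_measurable_sqrt) measurable
  have g_mult: "AE x in M. g i x * cnj (g j x) = complex_of_real (D x) * e i x * cnj (e j x)" for i j
    using D_pos
  proof eventually_elim
    case (elim x)
    have "complex_of_real (sqrt (D x)) * complex_of_real (sqrt (D x)) = complex_of_real (D x)"
      using elim by (simp flip: of_real_mult)
    moreover have "g i x * cnj (g j x) =
        complex_of_real (sqrt (D x)) * complex_of_real (sqrt (D x)) * e i x * cnj (e j x)"
      by (simp add: g_def mult_ac)
    ultimately show ?case by simp
  qed
  have g_int: "integrable M (\<lambda>x. g i x * cnj (g j x))"
    and g_orth: "(\<integral>x. g i x * cnj (g j x) \<partial>M) = (if i = j then 1 else 0)"
    if i: "i \<in> I" and j: "j \<in> I" for i j
  proof -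
    have m: "(\<lambda>x. g i x * cnj (g j x)) \<in> borel_measurable M"
      "(\<lambda>x. complex_of_real (D x) * e i x * cnj (e j x)) \<in> borel_measurable M"
      using gm[OF i] gm[OF j] em[OF i] em[OF j] by measurable
    show "integrable M (\<lambda>x. g i x * cnj (g j x))"
      using L2_integrable_bounded_mult[OF Dm D_bound e[OF i] e[OF j]]
      by (subst integrable_cong_AE[OF m g_mult])
    show "(\<integral>x. g i x * cnj (g j x) \<partial>M) = (if i = j then 1 else 0)"
      by (subst integral_cong_AE[OF m g_mult]) (rule orthonormal[OF i j])
  qed
  have \<theta>m[measurable]: "\<theta> \<in> borel_measurable P"
    unfolding \<theta>_def using gm
    by (intro borel_measurable_sum borel_measurable_times borel_measurable_cnj measurable_P_fst measurable_P_snd)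
  define G where "G = (\<lambda>i j z. (g i (fst z) * cnj (g j (fst z))) * (g j (snd z) * cnj (g i (snd z))))"
  have G_int: "integrable P (G i j)" and G_val: "(\<integral>z. G i j z \<partial>P) = (if i = j then 1 else 0)"
    if "i \<in> I" "j \<in> I" for i j
    using integrable_P_mult[OF g_int[OF that] g_int[OF that(2,1)]]
      integral_P_mult[OF g_int[OF that] g_int[OF that(2,1)]] g_orth that
    by (simp_all add: G_def)
  have \<theta>2: "complex_of_real ((norm (\<theta> z))\<^sup>2) = (\<Sum>i\<in>I. \<Sum>j\<in>I. G i j z)" for z
    unfolding complex_norm_square \<theta>_def G_def
    by (simp add: sum_product mult_ac)
  have \<theta>2_int: "integrable P (\<lambda>z. complex_of_real ((norm (\<theta> z))\<^sup>2))"
    unfolding \<theta>2 using G_int by (intro Bochner_Integration.integrable_sum)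
  then have \<theta>2_int': "integrable P (\<lambda>z. (norm (\<theta> z))\<^sup>2)"
    using integrable_Re by fastforce
  have "complex_of_real (\<integral>z. (norm (\<theta> z))\<^sup>2 \<partial>P) = (\<Sum>i\<in>I. \<Sum>j\<in>I. \<integral>z. G i j z \<partial>P)"
    unfolding integral_complex_of_real[symmetric] \<theta>2
    using G_int by (simp add: Bochner_Integration.integral_sum)
  also have "\<dots> = of_nat (card I)"
    using I by (simp add: G_val cong: sum.cong)
  finally have \<theta>2_val: "(\<integral>z. (norm (\<theta> z))\<^sup>2 \<partial>P) = card I"
    by (metis of_real_eq_iff of_real_of_nat_eq)
  have D_pos_P: "AE z in P. 0 < D (fst z) \<and> 0 < D (snd z)"
    using AE_P_fst[OF D_pos] AE_P_snd[OF D_pos] by eventually_elim simp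
  have k2: "AE z in P. (norm (k z))\<^sup>2 =
      (norm (v z) * norm (v (snd z, fst z)))\<^sup>2 / (4 * (W z)\<^sup>2 * D (fst z) * D (snd z))"
    using D_pos_P
    by eventually_elim (simp add: k_def norm_mult norm_divide power_mult_distrib power_divide)
  have k2_nn: "(\<integral>\<^sup>+z. ennreal ((norm (k z))\<^sup>2) \<partial>P) \<le> ennreal C"
  proof -
    have "(\<integral>\<^sup>+z. ennreal ((norm (k z))\<^sup>2) \<partial>P) = (\<integral>\<^sup>+z. ennreal ((norm (v z) * norm (v (snd z, fst z)))\<^sup>2 /
               (4 * (W z)\<^sup>2 * D (fst z) * D (snd z))) \<partial>P)"
      using k2 by (intro nn_integral_cong_AE) (auto elim: AE_mp)
    then show ?thesis using HS by simp
  qed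
  then have "(\<integral>\<^sup>+z. ennreal ((norm (k z))\<^sup>2) \<partial>P) < \<infinity>" by (rule le_less_trans) simp
  then have k2_int: "integrable P (\<lambda>z. (norm (k z))\<^sup>2)"
    by (simp add: integrable_iff_bounded)
  have k2_val: "(\<integral>z. (norm (k z))\<^sup>2 \<partial>P) \<le> C"
    using k2_nn \<open>0 \<le> C\<close> by (subst integral_eq_nn_integral) (auto intro: enn2real_leI)
  have e_int: "integrable P (\<lambda>z. k z * cnj (g i (fst z) * cnj (g i (snd z))))" if "i \<in> I" for i
  proof (rule integrable_mult_of_squares[OF km])
    have "complex_of_real ((norm (cnj (g i (fst z) * cnj (g i (snd z)))))\<^sup>2) = G i i z" for z
      unfolding complex_norm_square G_def by (simp add: mult_ac)
    then have "integrable P (\<lambda>z. complex_of_real ((norm (cnj (g i (fst z) * cnj (g i (snd z)))))\<^sup>2))"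
      using G_int[OF that that] by simp
    then show "integrable P (\<lambda>z. (norm (cnj (g i (fst z) * cnj (g i (snd z)))))\<^sup>2)"
      using integrable_Re by fastforce
    show "(\<lambda>z. cnj (g i (fst z) * cnj (g i (snd z)))) \<in> borel_measurable P"
      using gm[OF that] by (intro borel_measurable_times borel_measurable_cnj measurable_P_fst measurable_P_snd)
  qed (rule k2_int)
  have e_val: "(\<integral>z. Re (k z * cnj (g i (fst z) * cnj (g i (snd z)))) \<partial>P) = exchange (e i)" if "i \<in> I" for i
    unfolding exchange_def
  proof (rule integral_cong_AE)
    show "AE z in P. Re (k z * cnj (g i (fst z) * cnj (g i (snd z)))) =
        Re (v z * cnj (v (snd z, fst z)) * cnj (e i (fst z)) * e i (snd z)) / (2 * W z)"
      using D_pos_P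
    proof eventually_elim
      case (elim z)
      let ?a = "complex_of_real (sqrt (D (fst z)))" and ?b = "complex_of_real (sqrt (D (snd z)))"
      have "?a \<noteq> 0" "?b \<noteq> 0" using elim by auto
      then have "k z * cnj (g i (fst z) * cnj (g i (snd z))) =
         (v z * cnj (v (snd z, fst z)) * cnj (e i (fst z)) * e i (snd z)) / of_real (2 * W z)"
        by (simp add: k_def g_def)
      then show ?case by (simp only: Re_divide_of_real)
    qed
    show "(\<lambda>z. Re (k z * cnj (g i (fst z) * cnj (g i (snd z))))) \<in> borel_measurable P"
      using e_int[OF that] by (intro borel_measurable_integrable integrable_Re)
    have "(\<lambda>z. v z * cnj (v (snd z, fst z)) * cnj (e i (fst z)) * e i (snd z)) \<in> borel_measurable P"
      by (intro borel_measurable_times borel_measurable_cnj v_measurable borel_measurable_swap[OF v_measurable]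
          measurable_P_fst measurable_P_snd em[OF that])
    then show "(\<lambda>z. Re (v z * cnj (v (snd z, fst z)) * cnj (e i (fst z)) * e i (snd z)) / (2 * W z)) \<in> borel_measurable P"
      using W_measurable by measurable
  qed
  have cross: "integrable P (\<lambda>z. Re (k z * cnj (\<theta> z)))"
    "(\<integral>z. Re (k z * cnj (\<theta> z)) \<partial>P) = (\<Sum>i\<in>I. exchange (e i))"
  proof -
    have eq: "Re (k z * cnj (\<theta> z)) = (\<Sum>i\<in>I. Re (k z * cnj (g i (fst z) * cnj (g i (snd z)))))" for z
      by (simp only: \<theta>_def cnj_sum sum_distrib_left Re_sum)
    show "integrable P (\<lambda>z. Re (k z * cnj (\<theta> z)))"
      unfolding eq using e_int by (intro Bochner_Integration.integrable_sum integrable_Re)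
    have "(\<integral>z. Re (k z * cnj (\<theta> z)) \<partial>P) = (\<Sum>i\<in>I. \<integral>z. Re (k z * cnj (g i (fst z) * cnj (g i (snd z)))) \<partial>P)"
      unfolding eq using e_int by (intro Bochner_Integration.integral_sum integrable_Re)
    then show "(\<integral>z. Re (k z * cnj (\<theta> z)) \<partial>P) = (\<Sum>i\<in>I. exchange (e i))"
      using e_val by simp
  qed
  have "0 \<le> (\<integral>z. (norm (k z - \<theta> z))\<^sup>2 \<partial>P)" by simp
  also have "\<dots> = (\<integral>z. (norm (k z))\<^sup>2 + (norm (\<theta> z))\<^sup>2 - 2 * Re (k z * cnj (\<theta> z)) \<partial>P)"
  proof (rule Bochner_Integration.integral_cong[OF refl])
    fix z show "(norm (k z - \<theta> z))\<^sup>2 = (norm (k z))\<^sup>2 + (norm (\<theta> z))\<^sup>2 - 2 * Re (k z * cnj (\<theta> z))"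
      by (simp only: cmod_power2) (simp add: power2_eq_square algebra_simps)
  qed
  also have "\<dots> = (\<integral>z. (norm (k z))\<^sup>2 \<partial>P) + card I - 2 * (\<Sum>i\<in>I. exchange (e i))"
    using k2_int \<theta>2_int' cross by (simp add: \<theta>2_val del: times_complex.sel complex_cnj)
  also have "\<dots> \<le> C + real (card I) - 2 * real (card I)"
  proof -
    have "(\<Sum>i\<in>I. 1) \<le> (\<Sum>i\<in>I. exchange (e i))" by (rule sum_mono) (rule ge_1)
    then show ?thesis using k2_val by simp
  qed
  finally show ?thesis by simp
qed

end

section \<open>Integrability of the exchange kernel\<close>

lemma Lp_norm_le_imp_nn_integral_le:
  assumes "finite_measure M" and f: "f \<in> Lp_space M p" and C: "Lp_norm M p f \<le> C" and s: "0 \<le> s" "s \<le> p" "0 < p"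
  shows "(\<integral>\<^sup>+x. ennreal (norm (f x) powr s) \<partial>M) \<le> ennreal (measure M (space M) + \<bar>C\<bar> powr p)"
proof -
  interpret finite_measure M by fact
  have f_meas: "f \<in> borel_measurable M" and f_int: "integrable M (\<lambda>x. norm (f x) powr p)"
    using f by (auto simp: Lp_space_def)
  let ?I = "\<integral>x. norm (f x) powr p \<partial>M"
  have "0 \<le> ?I" by simp
  then have "?I = (?I powr (1 / p)) powr p" using s by (simp add: powr_powr)
  also have "\<dots> \<le> \<bar>C\<bar> powr p"
    using C s by (intro powr_mono2) (auto simp: Lp_norm_def)
  finally have I: "?I \<le> \<bar>C\<bar> powr p" .
  have "norm (f x) powr s \<le> 1 + norm (f x) powr p" for x
  proof (cases "norm (f x) \<le> 1")
    case True
    then have "norm (f x) powr s \<le> 1" using s by (intro powr_le1) auto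
    then show ?thesis using powr_ge_zero[of "norm (f x)" p] by linarith
  next
    case False
    then have "norm (f x) powr s \<le> norm (f x) powr p" using s by (intro powr_mono) auto
    then show ?thesis by simp
  qed
  then have "(\<integral>\<^sup>+x. ennreal (norm (f x) powr s) \<partial>M) \<le> (\<integral>\<^sup>+x. ennreal (1 + norm (f x) powr p) \<partial>M)"
    by (intro nn_integral_mono ennreal_leI)
  also have "\<dots> = ennreal (\<integral>x. 1 + norm (f x) powr p \<partial>M)"
    using f_int by (intro nn_integral_eq_integral) auto
  also have "(\<integral>x. 1 + norm (f x) powr p \<partial>M) = measure M (space M) + ?I"
    using f_int by simp
  also have "ennreal \<dots> \<le> ennreal (measure M (space M) + \<bar>C\<bar> powr p)"
    using I by (intro ennreal_leI) simp
  finally show ?thesis .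
qed

context complete_finite_measure
begin

text \<open>
  One of the exponents \<open>2 + \<epsilon>\<close> and \<open>2 + 4 / \<epsilon>\<close> is at least \<open>4\<close>, and the measure is finite.
\<close>

lemma integrable_fourth_power:
  assumes v: "v \<in> borel_measurable P" and "0 < \<epsilon>"
    and 1: "AE x in M. (\<lambda>y. v (x, y)) \<in> Lp_space M (2 + \<epsilon>) \<and> Lp_norm M (2 + \<epsilon>) (\<lambda>y. v (x, y)) \<le> C"
    and 2: "AE y in M. (\<lambda>x. v (x, y)) \<in> Lp_space M (2 + 4 / \<epsilon>) \<and> Lp_norm M (2 + 4 / \<epsilon>) (\<lambda>x. v (x, y)) \<le> C'"
  shows "integrable P (\<lambda>z. norm (v z) ^ 4)"
proof -
  have powr4: "norm (w :: complex) ^ 4 = norm w powr 4" for w by simp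
  have fin: "(\<integral>\<^sup>+x. \<integral>\<^sup>+y. ennreal (norm (w (x, y)) ^ 4) \<partial>M \<partial>M) < \<infinity>"
    if "4 \<le> p" and *: "AE x in M. (\<lambda>y. w (x, y)) \<in> Lp_space M p \<and> Lp_norm M p (\<lambda>y. w (x, y)) \<le> K"
    for w :: "'a \<times> 'a \<Rightarrow> complex" and p K
  proof -
    let ?K = "measure M (space M) + \<bar>K\<bar> powr p"
    have "(\<integral>\<^sup>+x. \<integral>\<^sup>+y. ennreal (norm (w (x, y)) ^ 4) \<partial>M \<partial>M) \<le> (\<integral>\<^sup>+x. ennreal ?K \<partial>M)"
    proof (rule nn_integral_mono_AE)
      show "AE x in M. (\<integral>\<^sup>+y. ennreal (norm (w (x, y)) ^ 4) \<partial>M) \<le> ennreal ?K"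
        using * unfolding powr4 by eventually_elim
          (rule Lp_norm_le_imp_nn_integral_le[OF finite_measure_axioms], use \<open>4 \<le> p\<close> in auto)
    qed
    also have "\<dots> < \<infinity>" using emeasure_finite[of "space M"] by (simp add: ennreal_mult_less_top less_top[symmetric] ennreal_mult_eq_top_iff del: ennreal_plus)
    finally show ?thesis .
  qed
  note m = borel_measurable_swap[OF v]
  have "(\<integral>\<^sup>+z. ennreal (norm (v z) ^ 4) \<partial>P) < \<infinity>"
  proof (cases "2 \<le> \<epsilon>")
    case True
    then show ?thesis using v fin[of "2 + \<epsilon>", OF _ 1] by (subst nn_integral_P) auto
  next
    case False
    then have "4 \<le> 2 + 4 / \<epsilon>" using \<open>0 < \<epsilon>\<close> by (simp add: field_simps)
    then have "(\<integral>\<^sup>+x. \<integral>\<^sup>+y. ennreal (norm (v (y, x)) ^ 4) \<partial>M \<partial>M) < \<infinity>"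
      using fin[of "2 + 4 / \<epsilon>" "\<lambda>z. v (snd z, fst z)" C'] 2 by simp
    moreover have "(\<integral>\<^sup>+z. ennreal (norm (v (snd z, fst z)) ^ 4) \<partial>P) =
        (\<integral>\<^sup>+x. \<integral>\<^sup>+y. ennreal (norm (v (y, x)) ^ 4) \<partial>M \<partial>M)"
      using m by (subst nn_integral_P) auto
    moreover have "(\<integral>\<^sup>+z. ennreal (norm (v (snd z, fst z)) ^ 4) \<partial>P) = (\<integral>\<^sup>+z. ennreal (norm (v z) ^ 4) \<partial>P)"
      using v by (intro nn_integral_swap[of "\<lambda>z. ennreal (norm (v z) ^ 4)"]) auto
    ultimately show ?thesis by simp
  qed
  then show ?thesis using v by (simp add: integrable_iff_bounded)
qed

end

context section_bounded_kernel
begin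

context
  fixes \<omega> h :: "'a \<Rightarrow> real"
  assumes \<omega>: "\<omega> \<in> borel_measurable M" "AE x in M. 0 < \<omega> x"
    and h: "integrable M h" "\<And>x. 0 \<le> h x"
    and bound: "AE z in P. (norm (v z))\<^sup>2 / \<omega> (snd z) \<le> h (snd z) + (norm (v z))\<^sup>2"
begin

text \<open>
  In the application \<open>\<omega>\<close> is the weight by which \<open>W\<close> and \<open>D\<close> may degenerate at \<open>t0\<close>, and \<open>h\<close> is the
  integrable singularity that remains of \<open>|v|\<^sup>2 / \<omega>\<close> near \<open>t0\<close>.
\<close>

lemma weighted_sections_bounded:
  "AE x in M. (\<integral>\<^sup>+y. ennreal ((norm (v (x, y)))\<^sup>2 / \<omega> y) \<partial>M) \<le> ennreal ((\<integral>y. h y \<partial>M) + \<bar>Cv\<bar>)"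
  using AE_P_sections[OF bound] v_sections measurable_sections[OF v_measurable]
proof eventually_elim
  case (elim x)
  note [measurable] = elim(3)
  have hm[measurable]: "h \<in> borel_measurable M" using h by auto
  have "(\<integral>\<^sup>+y. ennreal ((norm (v (x, y)))\<^sup>2 / \<omega> y) \<partial>M) \<le> (\<integral>\<^sup>+y. ennreal (h y) + ennreal ((norm (v (x, y)))\<^sup>2) \<partial>M)"
    using elim(1) h(2) by (intro nn_integral_mono_AE) (auto simp flip: ennreal_plus intro!: ennreal_leI elim!: AE_mp)
  also have "\<dots> = ennreal (\<integral>y. h y \<partial>M) + (\<integral>\<^sup>+y. ennreal ((norm (v (x, y)))\<^sup>2) \<partial>M)"
    using h by (simp add: nn_integral_add nn_integral_eq_integral)
  also have "\<dots> \<le> ennreal (\<integral>y. h y \<partial>M) + ennreal \<bar>Cv\<bar>"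
    using elim(2) by (intro add_left_mono) (metis abs_ge_self ennreal_leI order_trans)
  also have "\<dots> = ennreal ((\<integral>y. h y \<partial>M) + \<bar>Cv\<bar>)"
    using h by (simp add: integral_nonneg)
  finally show ?case .
qed

text \<open>
  The integrand is the product of \<open>|v (x, y)|\<^sup>2 / \<omega> y\<close> and \<open>|v (y, x)|\<^sup>2 / \<omega> x\<close>. Bounding each factor by
  \<open>bound\<close> and multiplying out leaves \<open>h y * h x\<close>, two terms with one factor \<open>h\<close>, which are
  integrable since \<open>v\<close> has bounded sections, and \<open>|v (x, y)|\<^sup>2 |v (y, x)|\<^sup>2 \<le> |v (x, y)|\<^sup>4 + |v (y, x)|\<^sup>4\<close>.
\<close>

lemma integrable_weighted_exchange:
  assumes v4: "integrable P (\<lambda>z. norm (v z) ^ 4)"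
  shows "integrable P (\<lambda>z. (norm (v z) * norm (v (snd z, fst z)))\<^sup>2 / (\<omega> (fst z) * \<omega> (snd z)))"
proof (rule Bochner_Integration.integrable_bound)
  let ?s = "\<lambda>z :: 'a \<times> 'a. (snd z, fst z)"
  have hm: "h \<in> borel_measurable M" using h by auto
  have "integrable P (\<lambda>z. h (snd z) * h (fst z))"
    using h measurable_P_snd[OF hm]
    by (intro integrable_P_sections[where C = "\<integral>y. h y \<partial>M"]) (auto simp: nn_integral_eq_integral)
  moreover have vh: "integrable P (\<lambda>z. (norm (v z))\<^sup>2 * h (fst z))"
    using v_measurable by (intro integrable_P_sections[OF _ _ v_sections h]) auto
  ultimately show "integrable P (\<lambda>z. h (snd z) * h (fst z) + (norm (v z))\<^sup>2 * h (fst z)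
      + (norm (v (?s z)))\<^sup>2 * h (snd z) + (norm (v z) ^ 4 + norm (v (?s z)) ^ 4))"
    using integrable_swap(1)[OF vh] integrable_swap(1)[OF v4] v4 by simp
  show "AE z in P. norm ((norm (v z) * norm (v (?s z)))\<^sup>2 / (\<omega> (fst z) * \<omega> (snd z))) \<le>
      norm (h (snd z) * h (fst z) + (norm (v z))\<^sup>2 * h (fst z)
      + (norm (v (?s z)))\<^sup>2 * h (snd z) + (norm (v z) ^ 4 + norm (v (?s z)) ^ 4))"
    using bound AE_swap[OF bound] AE_P_fst[OF \<omega>(2)] AE_P_snd[OF \<omega>(2)]
  proof eventually_elim
    case (elim z)
    let ?a = "(norm (v z))\<^sup>2" and ?b = "(norm (v (?s z)))\<^sup>2"
    have "norm ((norm (v z) * norm (v (?s z)))\<^sup>2 / (\<omega> (fst z) * \<omega> (snd z))) = (?a / \<omega> (snd z)) * (?b / \<omega> (fst z))"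
      using elim by (simp add: power_mult_distrib abs_mult)
    also have "\<dots> \<le> (h (snd z) + ?a) * (h (fst z) + ?b)"
      using elim h(2) by (intro mult_mono) auto
    also have "\<dots> = h (snd z) * h (fst z) + ?a * h (fst z) + ?b * h (snd z) + ?a * ?b"
      by (simp add: algebra_simps)
    also have "\<dots> \<le> h (snd z) * h (fst z) + ?a * h (fst z) + ?b * h (snd z) + (norm (v z) ^ 4 + norm (v (?s z)) ^ 4)"
      using mult_le_sum_squares[of ?a ?b] by simp
    also have "\<dots> \<le> norm \<dots>" by simp
    finally show ?case .
  qed
  show "(\<lambda>z. (norm (v z) * norm (v (?s z)))\<^sup>2 / (\<omega> (fst z) * \<omega> (snd z))) \<in> borel_measurable P"
  proof (intro borel_measurable_divide borel_measurable_power borel_measurable_times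
      measurable_P_fst[OF \<omega>(1)] measurable_P_snd[OF \<omega>(1)])
    show "(\<lambda>z. norm (v z)) \<in> borel_measurable P" "(\<lambda>z. norm (v (?s z))) \<in> borel_measurable P"
      using v_measurable borel_measurable_swap[OF v_measurable] by simp_all
  qed
qed

end

end

lemma ennreal_le_suminf: "f j \<le> (\<Sum>k. f k)" for f :: "nat \<Rightarrow> ennreal"
  using sum_le_suminf[of f "{j}"] by simp

text \<open>
  For negative \<open>s\<close>, the shells between the radii \<open>\<delta> * 2 powr - (k + 1)\<close> and \<open>\<delta> * 2 powr - k\<close> contribute at
  most the terms of a geometric series with ratio \<open>2 powr - (DIM('a) + s)\<close>.
\<close>

lemma nn_integral_norm_powr_ball_finite:
  fixes c :: "'a::euclidean_space"
  assumes s: "- real DIM('a) < s" and "0 < \<delta>"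
  shows "(\<integral>\<^sup>+x. indicator (ball c \<delta>) x * ennreal (norm (x - c) powr s) \<partial>lborel) < \<infinity>"
proof (cases "0 \<le> s")
  case True
  have "(\<integral>\<^sup>+x. indicator (ball c \<delta>) x * ennreal (norm (x - c) powr s) \<partial>lborel) \<le>
      (\<integral>\<^sup>+x. ennreal (\<delta> powr s) * indicator (ball c \<delta>) x \<partial>lborel)"
    using True by (intro nn_integral_mono)
      (auto simp: indicator_def dist_norm norm_minus_commute intro!: ennreal_leI powr_mono2)
  also have "\<dots> < \<infinity>"
    using \<open>0 < \<delta>\<close> by (simp add: nn_integral_cmult_indicator emeasure_ball ennreal_mult_less_top)
  finally show ?thesis .
next
  case False
  define r where "r = (\<lambda>k :: nat. \<delta> * 2 powr (- real k))"
  define q where "q = 2 powr (- (real DIM('a) + s))"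
  define K where "K = unit_ball_vol DIM('a) * \<delta> ^ DIM('a) * \<delta> powr s * 2 powr (- s)"
  have r_pos: "0 < r k" for k using \<open>0 < \<delta>\<close> by (simp add: r_def)
  have term_eq: "unit_ball_vol DIM('a) * r k ^ DIM('a) * r (Suc k) powr s = K * q ^ k" for k
  proof -
    have pow: "(2 powr x) ^ n = 2 powr (x * real n)" for x :: real and n
      by (simp add: powr_power mult.commute)
    have "r k ^ DIM('a) = \<delta> ^ DIM('a) * 2 powr (- real k * real DIM('a))"
      unfolding r_def power_mult_distrib pow ..
    moreover have "r (Suc k) powr s = \<delta> powr s * (2 powr (- s) * 2 powr (- real k * s))"
    proof -
      have "r (Suc k) powr s = \<delta> powr s * 2 powr (- real (Suc k) * s)"
        using \<open>0 < \<delta>\<close> by (simp add: r_def powr_mult powr_powr del: of_nat_Suc)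
      also have "- real (Suc k) * s = - s + - real k * s" by (simp add: algebra_simps)
      finally show ?thesis by (simp only: powr_add)
    qed
    moreover have "q ^ k = 2 powr (- real k * real DIM('a)) * 2 powr (- real k * s)"
    proof -
      have "- (real DIM('a) + s) * real k = - real k * real DIM('a) + - real k * s"
        by (simp add: algebra_simps)
      then show ?thesis unfolding q_def pow by (simp only: powr_add)
    qed
    ultimately show ?thesis by (simp add: K_def mult_ac)
  qed
  have "(\<integral>\<^sup>+x. indicator (ball c \<delta>) x * ennreal (norm (x - c) powr s) \<partial>lborel) \<le>
      (\<integral>\<^sup>+x. (\<Sum>k. ennreal (r (Suc k) powr s) * indicator (ball c (r k)) x) \<partial>lborel)"
  proof (rule nn_integral_mono)
    fix x
    show "indicator (ball c \<delta>) x * ennreal (norm (x - c) powr s) \<le>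
      (\<Sum>k. ennreal (r (Suc k) powr s) * indicator (ball c (r k)) x)"
    proof (cases "x \<in> ball c \<delta> \<and> x \<noteq> c")
      case True
      let ?t = "norm (x - c)"
      have t: "0 < ?t" "?t < \<delta>" using True by (auto simp: dist_norm norm_minus_commute)
      have "\<exists>k. r k \<le> ?t"
      proof -
        have "(\<lambda>k. \<delta> * (1 / 2) ^ k) \<longlonglongrightarrow> \<delta> * 0" by (intro tendsto_intros LIMSEQ_power_zero) auto
        then have "eventually (\<lambda>k. \<delta> * (1 / 2) ^ k < ?t) sequentially"
          by (rule order_tendstoD(2)) (use t in simp)
        then obtain k where "\<delta> * (1 / 2) ^ k < ?t" by (auto simp: eventually_sequentially)
        then have "r k \<le> ?t" by (simp add: r_def powr_minus powr_realpow power_divide field_simps)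
        then show ?thesis ..
      qed
      define k where "k = (LEAST k. r k \<le> ?t)"
      have k: "r k \<le> ?t" unfolding k_def using \<open>\<exists>k. r k \<le> ?t\<close> by (rule LeastI_ex)
      have "k \<noteq> 0"
      proof
        assume "k = 0"
        with k have "\<delta> \<le> ?t" by (simp add: r_def)
        with t show False by simp
      qed
      then obtain j where j: "k = Suc j" by (cases k) auto
      have "?t < r j" using not_less_Least[of j "\<lambda>k. r k \<le> ?t"] j by (simp add: k_def)
      then have "x \<in> ball c (r j)" by (simp add: dist_norm norm_minus_commute)
      moreover have "?t powr s \<le> r (Suc j) powr s"
        using k j r_pos[of k] False by (intro powr_mono2') auto
      ultimately have "indicator (ball c \<delta>) x * ennreal (?t powr s) \<le> ennreal (r (Suc j) powr s) * indicator (ball c (r j)) x"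
        using True by (simp add: ennreal_leI)
      also have "\<dots> \<le> (\<Sum>k. ennreal (r (Suc k) powr s) * indicator (ball c (r k)) x)"
        by (rule ennreal_le_suminf)
      finally show ?thesis .
    qed auto
  qed
  also have "\<dots> = (\<Sum>k. \<integral>\<^sup>+x. ennreal (r (Suc k) powr s) * indicator (ball c (r k)) x \<partial>lborel)"
    by (rule nn_integral_suminf)
      (intro borel_measurable_times_ennreal borel_measurable_const borel_measurable_indicator, simp)
  also have "\<dots> = (\<Sum>k. ennreal (K * q ^ k))"
  proof (rule suminf_cong)
    fix k
    have "(\<integral>\<^sup>+x. ennreal (r (Suc k) powr s) * indicator (ball c (r k)) x \<partial>lborel) =
      ennreal (r (Suc k) powr s) * ennreal (unit_ball_vol DIM('a) * r k ^ DIM('a))"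
      using r_pos[of k] by (simp add: nn_integral_cmult_indicator emeasure_ball)
    also have "\<dots> = ennreal (K * q ^ k)"
      unfolding term_eq[symmetric] using r_pos[of k]
      by (subst ennreal_mult[symmetric]) (auto intro!: arg_cong[of _ _ ennreal])
    finally show "(\<integral>\<^sup>+x. ennreal (r (Suc k) powr s) * indicator (ball c (r k)) x \<partial>lborel) = ennreal (K * q ^ k)" .
  qed
  also have "\<dots> < \<infinity>"
  proof -
    have "q < 1" "0 \<le> q" using s by (auto simp: q_def powr_less_one)
    then have "summable (\<lambda>k. K * q ^ k)" by (intro summable_mult summable_geometric) auto
    moreover have "0 \<le> K" using \<open>0 < \<delta>\<close> by (simp add: K_def)
    ultimately have "(\<Sum>k. ennreal (K * q ^ k)) \<noteq> top"
      using \<open>0 \<le> q\<close> by (intro ennreal_suminf_neq_top) auto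
    then show ?thesis by (simp add: less_top)
  qed
  finally show ?thesis .
qed

section \<open>Positive semidefinite Hermitian forms\<close>

locale hermitian_form = vector_space scale
  for scale :: "complex \<Rightarrow> 'b::ab_group_add \<Rightarrow> 'b" (infixr \<open>*\<^sub>s\<close> 75) +
  fixes S :: "'b set" and B :: "'b \<Rightarrow> 'b \<Rightarrow> complex"
  assumes S: "subspace S"
    and B_add: "\<lbrakk>f \<in> S; g \<in> S; h \<in> S\<rbrakk> \<Longrightarrow> B (f + g) h = B f h + B g h"
    and B_scale: "\<lbrakk>f \<in> S; h \<in> S\<rbrakk> \<Longrightarrow> B (c *\<^sub>s f) h = c * B f h"
    and B_cnj: "\<lbrakk>f \<in> S; h \<in> S\<rbrakk> \<Longrightarrow> B h f = cnj (B f h)"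
begin

lemma B_zero: "h \<in> S \<Longrightarrow> B 0 h = 0"
  using B_scale[of 0 h 0] subspace_0[OF S] by simp

lemma B_sum:
  assumes "finite I" "\<And>i. i \<in> I \<Longrightarrow> f i \<in> S" "h \<in> S"
  shows "B (\<Sum>i\<in>I. c i *\<^sub>s f i) h = (\<Sum>i\<in>I. c i * B (f i) h)"
  using assms
proof (induction I)
  case (insert i I)
  have "(\<Sum>i\<in>I. c i *\<^sub>s f i) \<in> S" "c i *\<^sub>s f i \<in> S"
    using insert.prems S by (auto intro!: subspace_sum subspace_scale)
  then show ?case using insert by (simp add: B_add B_scale)
qed (simp add: B_zero)

lemma B_diff: "\<lbrakk>f \<in> S; g \<in> S; h \<in> S\<rbrakk> \<Longrightarrow> B (f - g) h = B f h - B g h"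
  using B_add[of "f - g" g h] subspace_diff[OF S] by simp

lemma B_real: "f \<in> S \<Longrightarrow> B f f = of_real (Re (B f f))"
  using B_cnj[of f f] by (simp add: complex_eq_iff)

lemma B_sum_orthogonal:
  assumes "finite I" "\<And>i. i \<in> I \<Longrightarrow> f i \<in> S"
    and "\<And>i j. i \<in> I \<Longrightarrow> j \<in> I \<Longrightarrow> i \<noteq> j \<Longrightarrow> B (f i) (f j) = 0"
  shows "B (\<Sum>i\<in>I. c i *\<^sub>s f i) (\<Sum>i\<in>I. c i *\<^sub>s f i) = (\<Sum>i\<in>I. of_real ((norm (c i))\<^sup>2) * B (f i) (f i))"
proof -
  let ?s = "\<Sum>i\<in>I. c i *\<^sub>s f i"
  have s: "?s \<in> S" using assms S by (auto intro!: subspace_sum subspace_scale)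
  have "B (f i) ?s = cnj (c i) * B (f i) (f i)" if "i \<in> I" for i
  proof -
    have "B (f i) ?s = cnj (B ?s (f i))" using that assms s by (intro B_cnj) auto
    also have "B ?s (f i) = (\<Sum>j\<in>I. c j * B (f j) (f i))" using assms that by (intro B_sum) auto
    also have "\<dots> = (\<Sum>j\<in>I. if j = i then c i * B (f i) (f i) else 0)"
      using assms(3) that by (intro sum.cong) auto
    also have "\<dots> = c i * B (f i) (f i)" using assms that by simp
    also have "cnj \<dots> = cnj (c i) * B (f i) (f i)"
      using B_cnj[of "f i" "f i"] assms that by simp
    finally show ?thesis .
  qed
  moreover have "B ?s ?s = (\<Sum>i\<in>I. c i * B (f i) ?s)" using assms s by (intro B_sum) auto
  ultimately show ?thesis
    by (simp add: complex_norm_square mult_ac del: of_real_power cong: sum.cong)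
qed

lemma orthogonal_independent:
  assumes E: "E \<subseteq> S" and nonzero: "\<And>e. e \<in> E \<Longrightarrow> B e e \<noteq> 0"
    and orth: "\<And>e e'. e \<in> E \<Longrightarrow> e' \<in> E \<Longrightarrow> e \<noteq> e' \<Longrightarrow> B e e' = 0"
  shows "independent E"
  unfolding independent_explicit_module
proof (intro allI impI)
  fix t c v assume t: "finite t" "t \<subseteq> E" "(\<Sum>v\<in>t. c v *\<^sub>s v) = 0" "v \<in> t"
  have "0 = B (\<Sum>v\<in>t. c v *\<^sub>s v) v" using t E by (simp add: B_zero subset_iff)
  also have "\<dots> = (\<Sum>w\<in>t. c w * B w v)" using t E by (intro B_sum) auto
  also have "\<dots> = (\<Sum>w\<in>t. if w = v then c v * B v v else 0)"
    using orth t by (intro sum.cong) auto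
  also have "\<dots> = c v * B v v" using t by simp
  finally show "c v = 0" using nonzero[of v] t by auto
qed

definition orthonormal :: "'b set \<Rightarrow> bool" where
  "orthonormal E \<longleftrightarrow> finite E \<and> E \<subseteq> S \<and> (\<forall>e\<in>E. \<forall>e'\<in>E. B e e' = (if e = e' then 1 else 0))"

text \<open>
  Gram-Schmidt: if a largest orthonormal family did not span \<open>S\<close> up to vectors of length zero, the
  remainder of some vector could be normalised and added to it. Vectors of length zero are kept
  apart from \<open>0\<close> because the form is meant for representatives of \<open>L\<^sup>2\<close> classes.
\<close>

lemma exists_spanning_orthonormal:
  assumes nonneg: "\<And>f. f \<in> S \<Longrightarrow> 0 \<le> Re (B f f)"
    and bounded: "\<And>E. orthonormal E \<Longrightarrow> card E \<le> N"
  shows "\<exists>E. orthonormal E \<and> (\<forall>f\<in>S. \<exists>g\<in>span E. B (f - g) (f - g) = 0)"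
proof -
  have "orthonormal {}" by (simp add: orthonormal_def)
  then obtain E where E: "orthonormal E" and max: "\<And>E'. orthonormal E' \<Longrightarrow> card E' \<le> card E"
    using ex_has_greatest_nat[of orthonormal "{}" card "Suc N"] bounded by (auto simp: less_Suc_eq_le)
  have "\<exists>g\<in>span E. B (f - g) (f - g) = 0" if f: "f \<in> S" for f
  proof -
    define g where "g = (\<Sum>e\<in>E. B f e *\<^sub>s e)"
    define r where "r = f - g"
    have ES: "finite E" "E \<subseteq> S" using E by (auto simp: orthonormal_def)
    have g: "g \<in> span E"
      unfolding g_def by (intro span_sum span_scale span_base)
    then have g: "g \<in> span E" "g \<in> S"
      using span_minimal[OF ES(2) S] by auto
    have r: "r \<in> S" using f g S by (simp add: r_def subspace_diff)
    have re: "B r e = 0" if "e \<in> E" for e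
    proof -
      have "B g e = (\<Sum>e'\<in>E. B f e' * B e' e)"
        unfolding g_def using ES that by (intro B_sum) auto
      also have "\<dots> = (\<Sum>e'\<in>E. if e' = e then B f e else 0)"
        using E that by (intro sum.cong) (auto simp: orthonormal_def)
      also have "\<dots> = B f e" using ES that by simp
      finally show ?thesis using B_diff[of f g e] f g ES that by (auto simp: r_def)
    qed
    have "B r r = 0"
    proof (rule ccontr)
      assume "B r r \<noteq> 0"
      then have pos: "0 < Re (B r r)" using nonneg[OF r] B_real[OF r] by (metis less_eq_real_def of_real_0)
      define t where "t = complex_of_real (1 / sqrt (Re (B r r)))"
      have tr: "t *\<^sub>s r \<in> S" using r S by (simp add: subspace_scale)
      have tre: "B (t *\<^sub>s r) e = 0" if "e \<in> E" for e
        using re[OF that] B_scale[of r e t] r ES that by auto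
      have ter: "B e (t *\<^sub>s r) = 0" if "e \<in> E" for e
        using tre[OF that] B_cnj[of "t *\<^sub>s r" e] tr ES that by auto
      have "B (t *\<^sub>s r) (t *\<^sub>s r) = t * cnj (B (t *\<^sub>s r) r)"
        using B_scale[OF r tr, of t] B_cnj[OF tr r] by simp
      also have "\<dots> = t * cnj t * cnj (B r r)" using B_scale[OF r r, of t] by simp
      also have "\<dots> = t * cnj t * of_real (Re (B r r))" using B_real[OF r] by (metis complex_cnj_complex_of_real)
      also have "\<dots> = of_real (1 / sqrt (Re (B r r)) * (1 / sqrt (Re (B r r))) * Re (B r r))"
        by (simp only: t_def complex_cnj_complex_of_real of_real_mult)
      also have "1 / sqrt (Re (B r r)) * (1 / sqrt (Re (B r r))) * Re (B r r) = 1"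
        using pos by simp
      finally have trr: "B (t *\<^sub>s r) (t *\<^sub>s r) = 1" by simp
      then have notin: "t *\<^sub>s r \<notin> E" using tre by auto
      have "orthonormal (insert (t *\<^sub>s r) E)"
        using E trr tre ter tr notin unfolding orthonormal_def by auto
      from max[OF this] show False using notin ES by simp
    qed
    then show ?thesis using g by (auto simp: r_def)
  qed
  with E show ?thesis by auto
qed

end

section \<open>The operator as a form on the Fock space\<close>

lemma lmeasurable_cube: "(cube a :: (real^'n) set) \<in> lmeasurable"
proof -
  have "(cube a :: (real^'n) set) = box (\<chi> i. - a) (\<chi> i. a)"
    by (auto simp: cube_def mem_box_cart)
  then show ?thesis by simp
qed

lemma complete_finite_measure_cube: "complete_finite_measure (lebesgue_on (cube a))"
  unfolding complete_finite_measure_def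
  using finite_measure_lebesgue_on[OF lmeasurable_cube] complete_measure_lebesgue_on[of "cube a"] lmeasurable_cube
  by auto

lemma lebesgue_on_cube_Times:
  "lebesgue_on (cube a \<times> cube a) = completion (lebesgue_on (cube a) \<Otimes>\<^sub>M lebesgue_on (cube a))"
  by (rule lebesgue_on_Times) (rule lmeasurable_cube)+

text \<open>
  Weight \<open>1\<close> gives the inner product of \<open>L\<^sup>2\<close>, the weights \<open>w1\<close> and \<open>w2\<close> the forms of the diagonal
  blocks, and the weight \<open>D\<close> the inner product in which orthonormal families are counted.
\<close>

definition weighted_inner :: "'b measure \<Rightarrow> ('b \<Rightarrow> real) \<Rightarrow> ('b \<Rightarrow> complex) \<Rightarrow> ('b \<Rightarrow> complex) \<Rightarrow> complex" where
  "weighted_inner N r f g = (\<integral>x. of_real (r x) * f x * cnj (g x) \<partial>N)"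

definition bounded_weight :: "'b measure \<Rightarrow> ('b \<Rightarrow> real) \<Rightarrow> bool" where
  "bounded_weight N r \<longleftrightarrow> r \<in> borel_measurable N \<and> (\<exists>C. AE x in N. \<bar>r x\<bar> \<le> C)"

lemma bounded_weight_1: "bounded_weight N (\<lambda>_. 1)"
  by (auto simp: bounded_weight_def intro: exI[of _ 1])

lemma bounded_weight_mult_L2:
  assumes r: "bounded_weight N r" and f: "f \<in> Lp_space N 2"
  shows "(\<lambda>x. of_real (r x) * f x) \<in> Lp_space N 2"
proof -
  obtain C where C: "AE x in N. \<bar>r x\<bar> \<le> C" using r by (auto simp: bounded_weight_def)
  have r_meas[measurable]: "r \<in> borel_measurable N" using r by (auto simp: bounded_weight_def)
  have f_meas[measurable]: "f \<in> borel_measurable N" and f2: "integrable N (\<lambda>x. (norm (f x))\<^sup>2)"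
    using f by (auto simp: Lp_space_2_iff)
  have "integrable N (\<lambda>x. (norm (of_real (r x) * f x))\<^sup>2)"
  proof (rule Bochner_Integration.integrable_bound)
    show "integrable N (\<lambda>x. C\<^sup>2 * (norm (f x))\<^sup>2)" using f2 by simp
    show "AE x in N. norm ((norm (of_real (r x) * f x))\<^sup>2) \<le> norm (C\<^sup>2 * (norm (f x))\<^sup>2)"
      using C
    proof eventually_elim
      case (elim x)
      then have "(r x)\<^sup>2 \<le> C\<^sup>2" by (metis abs_ge_zero power2_abs power_mono)
      then show ?case by (simp add: norm_mult power_mult_distrib mult_right_mono)
    qed
  qed measurable
  then show ?thesis by (simp add: Lp_space_2_iff borel_measurable_times)
qed

lemma weighted_inner_integrable:
  assumes "bounded_weight N r" "f \<in> Lp_space N 2" "g \<in> Lp_space N 2"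
  shows "integrable N (\<lambda>x. of_real (r x) * f x * cnj (g x))"
  using L2_integrable_mult_cnj[OF bounded_weight_mult_L2[OF assms(1,2)] assms(3)] .

lemma weighted_inner_add:
  assumes "bounded_weight N r" "f \<in> Lp_space N 2" "g \<in> Lp_space N 2" "h \<in> Lp_space N 2"
  shows "weighted_inner N r (\<lambda>x. f x + g x) h = weighted_inner N r f h + weighted_inner N r g h"
  using weighted_inner_integrable[OF assms(1,2,4)] weighted_inner_integrable[OF assms(1,3,4)]
  by (simp add: weighted_inner_def algebra_simps)

lemma weighted_inner_cong_AE:
  assumes "bounded_weight N r" "f \<in> Lp_space N 2" "f' \<in> Lp_space N 2" "g \<in> Lp_space N 2"
    and "AE x in N. f x = f' x"
  shows "weighted_inner N r f g = weighted_inner N r f' g"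
  unfolding weighted_inner_def
proof (rule integral_cong_AE)
  show "AE x in N. of_real (r x) * f x * cnj (g x) = of_real (r x) * f' x * cnj (g x)"
    using assms(5) by eventually_elim simp
qed (use weighted_inner_integrable[OF assms(1,2,4)] weighted_inner_integrable[OF assms(1,3,4)] in auto)

lemma weighted_inner_scale: "weighted_inner N r (\<lambda>x. c * f x) h = c * weighted_inner N r f h"
  unfolding weighted_inner_def by (simp add: mult_ac flip: integral_mult_right_zero)

lemma weighted_inner_cnj: "weighted_inner N r h f = cnj (weighted_inner N r f h)"
proof -
  have "weighted_inner N r h f = (\<integral>x. cnj (of_real (r x) * f x * cnj (h x)) \<partial>N)"
    by (simp add: weighted_inner_def mult_ac)
  also have "\<dots> = cnj (weighted_inner N r f h)"
    unfolding weighted_inner_def by (rule Bochner_Integration.integral_cnj)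
  finally show ?thesis .
qed

lemma weighted_inner_same: "weighted_inner N r f f = of_real (\<integral>x. r x * (norm (f x))\<^sup>2 \<partial>N)"
proof -
  have "of_real (r x) * f x * cnj (f x) = complex_of_real (r x * (norm (f x))\<^sup>2)" for x
    by (simp only: of_real_mult complex_norm_square mult.assoc)
  then show ?thesis unfolding weighted_inner_def by (simp only: integral_complex_of_real)
qed

lemma L2_inner_eq_weighted_inner: "L2_inner N f g = weighted_inner N (\<lambda>_. 1) f g"
  by (simp add: L2_inner_def weighted_inner_def)

lemma L2_norm_eq_0:
  assumes "f \<in> Lp_space N 2" "(\<integral>x. (norm (f x))\<^sup>2 \<partial>N) = 0"
  shows "AE x in N. f x = 0"
  using assms integral_nonneg_eq_0_iff_AE[of N "\<lambda>x. (norm (f x))\<^sup>2"] by (simp add: Lp_space_2_iff)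

locale fock_model =
  fixes a w0 :: real and v0 :: "real^'n \<Rightarrow> complex" and w1 :: "real^'n \<Rightarrow> real"
    and v1 :: "(real^'n) \<times> (real^'n) \<Rightarrow> complex" and w2 :: "(real^'n) \<times> (real^'n) \<Rightarrow> real" and Cv :: real
  assumes v0: "v0 \<in> L2_cube a"
    and w1: "bounded_weight (lebesgue_on (cube a)) w1"
    and w2: "bounded_weight (lebesgue_on (cube a \<times> cube a)) w2"
    and w2_sym: "AE z in lebesgue_on (cube a \<times> cube a). w2 (snd z, fst z) = w2 z"
    and v1: "v1 \<in> borel_measurable (lebesgue_on (cube a \<times> cube a))"
      "AE x in lebesgue_on (cube a). (\<integral>\<^sup>+y. ennreal ((norm (v1 (x, y)))\<^sup>2) \<partial>lebesgue_on (cube a)) \<le> ennreal Cv"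
begin

abbreviation M :: "(real^'n) measure" where "M \<equiv> lebesgue_on (cube a)"

sublocale section_bounded_kernel M v1 Cv
proof -
  interpret complete_finite_measure M by (rule complete_finite_measure_cube)
  show "section_bounded_kernel M v1 Cv"
    by unfold_locales (use v1 in \<open>simp_all add: lebesgue_on_cube_Times\<close>)
qed

lemma P_eq: "lebesgue_on (cube a \<times> cube a) = P"
  by (rule lebesgue_on_cube_Times)

lemma w2_P: "bounded_weight P w2" using w2 by (simp add: P_eq)

lemma fock_space_iff: "f \<in> fock_space a \<longleftrightarrow>
    fst (snd f) \<in> Lp_space M 2 \<and> snd (snd f) \<in> Lp_space P 2 \<and>
    (AE z in P. snd (snd f) z = snd (snd f) (snd z, fst z))"
  unfolding fock_space_def L2_cube_def L2_sym_def P_eq by (cases f) simp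

lemma subspace_fock_space: "fock.subspace (fock_space a :: 'n fock set)"
proof (rule fock.subspaceI)
  show "0 \<in> (fock_space a :: 'n fock set)"
    by (simp add: fock_space_iff Lp_space_2_iff zero_fun_def)
next
  fix f g :: "'n fock" assume f: "f \<in> fock_space a" and g: "g \<in> fock_space a"
  have "AE z in P. snd (snd f) z + snd (snd g) z = snd (snd f) (snd z, fst z) + snd (snd g) (snd z, fst z)"
    using f[unfolded fock_space_iff, THEN conjunct2, THEN conjunct2]
      g[unfolded fock_space_iff, THEN conjunct2, THEN conjunct2]
    by eventually_elim (rule arg_cong2[of _ _ _ _ plus])
  then show "f + g \<in> fock_space a"
    using f g by (auto simp: fock_space_iff plus_fun_def intro: L2_add)
next
  fix c and f :: "'n fock" assume f: "f \<in> fock_space a"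
  have "AE z in P. c * snd (snd f) z = c * snd (snd f) (snd z, fst z)"
    using f[unfolded fock_space_iff, THEN conjunct2, THEN conjunct2]
    by eventually_elim (rule arg_cong)
  then show "fock_scale c f \<in> fock_space a"
    using f by (auto simp: fock_space_iff fock_scale_def intro: L2_scale)
qed

definition ip :: "'n fock \<Rightarrow> 'n fock \<Rightarrow> complex" where
  "ip f g = fst f * cnj (fst g) + weighted_inner M (\<lambda>_. 1) (fst (snd f)) (fst (snd g))
     + weighted_inner P (\<lambda>_. 1) (snd (snd f)) (snd (snd g))"

text \<open>The sesquilinear form \<open>\<langle>H f, g\<rangle>\<close>, with the adjoints moved to the other argument.\<close>

definition q :: "'n fock \<Rightarrow> 'n fock \<Rightarrow> complex" where
  "q f g = of_real w0 * fst f * cnj (fst g)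
     + (H01 a v0 (fst (snd f)) * cnj (fst g) + cnj (H01 a v0 (fst (snd g))) * fst f)
     + weighted_inner M w1 (fst (snd f)) (fst (snd g))
     + (pairing (snd (snd f)) (fst (snd g)) + cnj (pairing (snd (snd g)) (fst (snd f))))
     + weighted_inner P w2 (snd (snd f)) (snd (snd g))"

lemma H01_integrable: "f \<in> Lp_space M 2 \<Longrightarrow> integrable M (\<lambda>s. v0 s * f s)"
  using v0 by (intro integrable_mult_of_squares) (auto simp: Lp_space_2_iff L2_cube_def)

lemma H01_add: "f \<in> Lp_space M 2 \<Longrightarrow> g \<in> Lp_space M 2 \<Longrightarrow> H01 a v0 (\<lambda>x. f x + g x) = H01 a v0 f + H01 a v0 g"
  by (simp add: H01_def distrib_left H01_integrable)

lemma H01_scale: "H01 a v0 (\<lambda>x. c * f x) = c * H01 a v0 f"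
  unfolding H01_def by (simp add: mult_ac flip: integral_mult_right_zero)

lemma pairing_add:
  "\<lbrakk>F \<in> Lp_space P 2; G \<in> Lp_space P 2; f \<in> Lp_space M 2\<rbrakk> \<Longrightarrow> pairing (\<lambda>z. F z + G z) f = pairing F f + pairing G f"
  using integrable_pairing[of F f] integrable_pairing[of G f]
  by (simp add: pairing_def algebra_simps)

lemma pairing_add_right:
  "\<lbrakk>F \<in> Lp_space P 2; f \<in> Lp_space M 2; g \<in> Lp_space M 2\<rbrakk> \<Longrightarrow> pairing F (\<lambda>x. f x + g x) = pairing F f + pairing F g"
  using integrable_pairing[of F f] integrable_pairing[of F g]
  by (simp add: pairing_def algebra_simps)

lemma pairing_scale: "pairing (\<lambda>z. c * F z) f = c * pairing F f"
  unfolding pairing_def by (simp add: mult_ac flip: integral_mult_right_zero)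

lemma pairing_scale_right: "pairing F (\<lambda>x. c * f x) = cnj c * pairing F f"
  unfolding pairing_def by (simp add: mult_ac flip: integral_mult_right_zero)

sublocale ip: hermitian_form fock_scale "fock_space a" ip
  by unfold_locales
    (auto simp: subspace_fock_space ip_def fock_scale_def plus_fun_def fock_space_iff bounded_weight_1
      weighted_inner_add weighted_inner_scale algebra_simps simp flip: weighted_inner_cnj)

sublocale q: hermitian_form fock_scale "fock_space a" q
  by unfold_locales
    (auto simp: subspace_fock_space q_def fock_scale_def plus_fun_def fock_space_iff w1 w2_P
      weighted_inner_add weighted_inner_scale H01_add H01_scale pairing_add pairing_scale
      pairing_add_right pairing_scale_right algebra_simps simp flip: weighted_inner_cnj)

text \<open>
  The adjoint is an arbitrary choice among its representatives. Exhibiting one representative shows that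
  the choice has the defining property.
\<close>

lemma H01_adj_L2: "H01_adj a v0 c \<in> Lp_space M 2"
  and H01_adj: "f \<in> Lp_space M 2 \<Longrightarrow> L2_inner M (H01_adj a v0 c) f = cnj (H01 a v0 f) * c"
proof -
  let ?Q = "\<lambda>x. x \<in> L2_cube a \<and> (\<forall>u\<in>L2_cube a. H01 a v0 u * cnj c = L2_inner M u x)"
  have "(\<lambda>x. c * cnj (v0 x)) \<in> Lp_space M 2"
    using v0 by (intro L2_scale L2_cnj) (simp add: L2_cube_def)
  moreover have "H01 a v0 u * cnj c = L2_inner M u (\<lambda>x. c * cnj (v0 x))" for u
    by (simp add: H01_def L2_inner_def mult_ac flip: integral_mult_right_zero)
  ultimately have "?Q (\<lambda>x. c * cnj (v0 x))" by (simp add: L2_cube_def)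
  then have *: "?Q (H01_adj a v0 c)"
    unfolding H01_adj_def hilbert_adjoint_def by (rule someI[of ?Q])
  then show "H01_adj a v0 c \<in> Lp_space M 2" by (simp add: L2_cube_def)
  assume f: "f \<in> Lp_space M 2"
  have "L2_inner M (H01_adj a v0 c) f = cnj (L2_inner M f (H01_adj a v0 c))"
    unfolding L2_inner_eq_weighted_inner by (rule weighted_inner_cnj)
  also have "L2_inner M f (H01_adj a v0 c) = H01 a v0 f * cnj c"
    using * f by (simp add: L2_cube_def)
  finally show "L2_inner M (H01_adj a v0 c) f = cnj (H01 a v0 f) * c" by simp
qed

lemma L2_sym_iff: "F \<in> L2_sym a \<longleftrightarrow> F \<in> Lp_space P 2 \<and> (AE z in P. F z = F (snd z, fst z))"
  unfolding L2_sym_def P_eq by simp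

lemma H12_adj_L2_sym: "f \<in> Lp_space M 2 \<Longrightarrow> H12_adj a v1 f \<in> L2_sym a"
  and H12_adj: "f \<in> Lp_space M 2 \<Longrightarrow> F \<in> L2_sym a \<Longrightarrow> L2_inner P (H12_adj a v1 f) F = cnj (pairing F f)"
proof -
  assume f: "f \<in> Lp_space M 2"
  let ?Q = "\<lambda>x. x \<in> L2_sym a \<and> (\<forall>u\<in>L2_sym a. L2_inner M (H12 a v1 u) f = L2_inner P u x)"
  have H12: "L2_inner M (H12 a v1 u) f = pairing u f" if "u \<in> L2_sym a" for u
    unfolding H12_def using that f by (intro pairing_eq_inner) (auto simp: L2_sym_iff)
  have "?Q (symmetrized_adjoint f)"
    using symmetrized_adjoint_L2(1,3)[OF f] symmetrized_adjoint_L2(2)[OF f] H12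
    by (auto simp: L2_sym_iff)
  then have *: "?Q (H12_adj a v1 f)"
    unfolding H12_adj_def hilbert_adjoint_def P_eq by (rule someI[of ?Q])
  then show "H12_adj a v1 f \<in> L2_sym a" by simp
  assume F: "F \<in> L2_sym a"
  have "L2_inner P (H12_adj a v1 f) F = cnj (L2_inner P F (H12_adj a v1 f))"
    unfolding L2_inner_eq_weighted_inner by (rule weighted_inner_cnj)
  also have "L2_inner P F (H12_adj a v1 f) = pairing F f"
    using * F H12 by simp
  finally show "L2_inner P (H12_adj a v1 f) F = cnj (pairing F f)" .
qed

abbreviation H :: "'n fock \<Rightarrow> 'n fock" where "H \<equiv> fock_op a w0 v0 w1 v1 w2"

lemma H_fock_space:
  assumes f: "f \<in> fock_space a"
  shows "H f \<in> fock_space a"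
proof -
  obtain f0 f1 f2 where ff: "f = (f0, f1, f2)" by (cases f)
  have f1: "f1 \<in> Lp_space M 2" and f2: "f2 \<in> Lp_space P 2" and sym: "AE z in P. f2 z = f2 (snd z, fst z)"
    using f by (auto simp: ff fock_space_iff)
  have "(\<lambda>x. H01_adj a v0 f0 x + H11 w1 f1 x + H12 a v1 f2 x) \<in> Lp_space M 2"
    unfolding H11_def H12_def
    by (intro L2_add H01_adj_L2 bounded_weight_mult_L2 w1 f1 kernel_integral_L2 f2)
  moreover have adj: "H12_adj a v1 f1 \<in> Lp_space P 2" "AE z in P. H12_adj a v1 f1 z = H12_adj a v1 f1 (snd z, fst z)"
    using H12_adj_L2_sym[OF f1] by (auto simp: L2_sym_iff)
  then have "(\<lambda>z. H12_adj a v1 f1 z + H22 w2 f2 z) \<in> Lp_space P 2"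
    unfolding H22_def by (intro L2_add bounded_weight_mult_L2 w2_P f2)
  moreover have "AE z in P. H12_adj a v1 f1 z + H22 w2 f2 z =
      H12_adj a v1 f1 (snd z, fst z) + H22 w2 f2 (snd z, fst z)"
    using adj(2) sym w2_sym[unfolded P_eq] by eventually_elim (simp add: H22_def)
  ultimately show ?thesis
    by (simp add: ff fock_op_def fock_space_iff plus_fun_def)
qed

lemma ip_H:
  assumes f: "f \<in> fock_space a" and g: "g \<in> fock_space a"
  shows "ip (H f) g = q f g"
proof -
  obtain f0 f1 f2 where ff: "f = (f0, f1, f2)" by (cases f)
  obtain g0 g1 g2 where gg: "g = (g0, g1, g2)" by (cases g)
  have f1: "f1 \<in> Lp_space M 2" and f2: "f2 \<in> Lp_space P 2" "f2 \<in> L2_sym a"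
    and g1: "g1 \<in> Lp_space M 2" and g2: "g2 \<in> Lp_space P 2" "g2 \<in> L2_sym a"
    using f g by (auto simp: ff gg fock_space_iff L2_sym_iff)
  have w1f: "H11 w1 f1 \<in> Lp_space M 2" and w2f: "H22 w2 f2 \<in> Lp_space P 2"
    unfolding H11_def H22_def using w1 w2_P f1 f2 by (auto intro: bounded_weight_mult_L2)
  have H12f: "H12 a v1 f2 \<in> Lp_space M 2"
    unfolding H12_def by (rule kernel_integral_L2) fact
  have H12a: "H12_adj a v1 f1 \<in> Lp_space P 2"
    using H12_adj_L2_sym[OF f1] by (simp add: L2_sym_iff)
  note add = weighted_inner_add[OF bounded_weight_1, folded L2_inner_eq_weighted_inner]
  have "L2_inner M (\<lambda>x. (H01_adj a v0 f0 x + H11 w1 f1 x) + H12 a v1 f2 x) g1 =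
      cnj (H01 a v0 g1) * f0 + weighted_inner M w1 f1 g1 + pairing f2 g1"
    unfolding add[OF L2_add[OF H01_adj_L2 w1f] H12f g1] add[OF H01_adj_L2 w1f g1] H01_adj[OF g1]
      pairing_eq_inner[OF f2(1) g1, symmetric]
    by (simp add: H12_def H11_def L2_inner_def weighted_inner_def)
  moreover have "L2_inner P (\<lambda>z. H12_adj a v1 f1 z + H22 w2 f2 z) g2 =
      cnj (pairing g2 f1) + weighted_inner P w2 f2 g2"
    unfolding add[OF H12a w2f g2(1)] H12_adj[OF f1 g2(2)]
    by (simp add: H22_def L2_inner_def weighted_inner_def)
  ultimately show ?thesis
    by (simp add: ff gg ip_def q_def fock_op_def plus_fun_def H00_def algebra_simps
        flip: L2_inner_eq_weighted_inner)
qed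

lemma ip_cong:
  assumes "fock_eq a f f'" "f \<in> fock_space a" "f' \<in> fock_space a" "g \<in> fock_space a"
  shows "ip f g = ip f' g"
  using assms unfolding ip_def fock_eq_def P_eq fock_space_iff
  by (auto intro!: arg_cong2[of _ _ _ _ plus] weighted_inner_cong_AE bounded_weight_1)

lemma ip_same: "ip f f = of_real ((norm (fst f))\<^sup>2 + (\<integral>x. (norm (fst (snd f) x))\<^sup>2 \<partial>M) + (\<integral>z. (norm (snd (snd f) z))\<^sup>2 \<partial>P))"
  unfolding ip_def weighted_inner_same by (simp add: complex_norm_square del: of_real_power)

lemma ip_same_nonneg: "0 \<le> Re (ip f f)"
  by (simp add: ip_same)

lemma ip_eq_0_iff:
  assumes f: "f \<in> fock_space a"
  shows "ip f f = 0 \<longleftrightarrow> fock_eq a f 0"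
proof
  assume "ip f f = 0"
  then have "(norm (fst f))\<^sup>2 + (\<integral>x. (norm (fst (snd f) x))\<^sup>2 \<partial>M) + (\<integral>z. (norm (snd (snd f) z))\<^sup>2 \<partial>P) = 0"
    unfolding ip_same by (simp only: of_real_eq_0_iff)
  moreover have "0 \<le> (\<integral>x. (norm (fst (snd f) x))\<^sup>2 \<partial>M)" "0 \<le> (\<integral>z. (norm (snd (snd f) z))\<^sup>2 \<partial>P)"
    "0 \<le> (norm (fst f))\<^sup>2" by simp_all
  ultimately have "(norm (fst f))\<^sup>2 = 0" "(\<integral>x. (norm (fst (snd f) x))\<^sup>2 \<partial>M) = 0" "(\<integral>z. (norm (snd (snd f) z))\<^sup>2 \<partial>P) = 0"
    by linarith+
  then show "fock_eq a f 0"
    using L2_norm_eq_0[of "fst (snd f)" M] L2_norm_eq_0[of "snd (snd f)" P] f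
    unfolding fock_eq_def P_eq fock_space_iff by simp
next
  assume "fock_eq a f 0"
  then have "fst f = 0" and 1: "AE x in M. fst (snd f) x = 0" and 2: "AE z in P. snd (snd f) z = 0"
    unfolding fock_eq_def P_eq by simp_all
  moreover have "(\<integral>x. (norm (fst (snd f) x))\<^sup>2 \<partial>M) = 0"
    by (rule integral_eq_zero_AE) (use 1 in eventually_elim, simp)
  moreover have "(\<integral>z. (norm (snd (snd f) z))\<^sup>2 \<partial>P) = 0"
    by (rule integral_eq_zero_AE) (use 2 in eventually_elim, simp)
  ultimately show "ip f f = 0" unfolding ip_same by simp
qed

end

section \<open>Eigenvalues and negative subspaces\<close>

context fock_model
begin

lemma fock_eq_diff: "fock_eq a (f - g) 0 \<Longrightarrow> fock_eq a f g"
  by (simp add: fock_eq_def fun_diff_def)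

lemma ip_cong_right:
  assumes "fock_eq a g g'" "f \<in> fock_space a" "g \<in> fock_space a" "g' \<in> fock_space a"
  shows "ip f g = ip f g'"
  using ip_cong[OF assms(1,3,4,2)] ip.B_cnj[OF assms(3,2)] ip.B_cnj[OF assms(4,2)] by simp

text \<open>The weak form of the eigenvalue equation is linear in \<open>f\<close>, while \<^const>\<open>fock_op\<close> involves chosen
  representatives and is linear only almost everywhere.\<close>

lemma eigenspace_iff:
  "f \<in> eigenspace a H \<mu> \<longleftrightarrow> f \<in> fock_space a \<and> (\<forall>g\<in>fock_space a. q f g = \<mu> * ip f g)"
proof safe
  assume "f \<in> eigenspace a H \<mu>"
  then have f: "f \<in> fock_space a" and eq: "fock_eq a (H f) (fock_scale \<mu> f)"
    by (auto simp: eigenspace_def)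
  show "f \<in> fock_space a" by fact
  have sf: "fock_scale \<mu> f \<in> fock_space a"
    by (rule fock.subspace_scale[OF subspace_fock_space f])
  fix g :: "'n fock" assume g: "g \<in> fock_space a"
  have "q f g = ip (H f) g" by (rule ip_H[OF f g, symmetric])
  also have "\<dots> = ip (fock_scale \<mu> f) g" by (rule ip_cong[OF eq H_fock_space[OF f] sf g])
  also have "\<dots> = \<mu> * ip f g" by (rule ip.B_scale[OF f g])
  finally show "q f g = \<mu> * ip f g" .
next
  assume f: "f \<in> fock_space a" and eq: "\<forall>g\<in>fock_space a. q f g = \<mu> * ip f g"
  have sf: "fock_scale \<mu> f \<in> fock_space a"
    by (rule fock.subspace_scale[OF subspace_fock_space f])
  let ?r = "H f - fock_scale \<mu> f"
  have r: "?r \<in> fock_space a"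
    by (rule fock.subspace_diff[OF subspace_fock_space H_fock_space[OF f] sf])
  have "ip ?r ?r = q f ?r - \<mu> * ip f ?r"
    by (simp only: ip.B_diff[OF H_fock_space[OF f] sf r] ip_H[OF f r] ip.B_scale[OF f r])
  then have "ip ?r ?r = 0" using eq r by simp
  then have "fock_eq a ?r 0" using ip_eq_0_iff[OF r] by simp
  then show "f \<in> eigenspace a H \<mu>" using f fock_eq_diff[of "H f"] by (simp add: eigenspace_def)
qed

lemma subspace_eigenspace: "fock.subspace (eigenspace a H \<mu>)"
proof (rule fock.subspaceI)
  show "0 \<in> eigenspace a H \<mu>"
    using fock.subspace_0[OF subspace_fock_space] by (simp add: eigenspace_iff q.B_zero ip.B_zero)
next
  fix f g assume "f \<in> eigenspace a H \<mu>" "g \<in> eigenspace a H \<mu>"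
  then show "f + g \<in> eigenspace a H \<mu>"
    using fock.subspace_add[OF subspace_fock_space, of f g]
    by (simp add: eigenspace_iff q.B_add ip.B_add distrib_left)
next
  fix c f assume "f \<in> eigenspace a H \<mu>"
  then show "fock_scale c f \<in> eigenspace a H \<mu>"
    using fock.subspace_scale[OF subspace_fock_space, of f c]
    by (simp add: eigenspace_iff q.B_scale ip.B_scale)
qed

lemma eigenvectors_orthogonal:
  assumes f: "f \<in> eigenspace a H (of_real \<mu>)" and g: "g \<in> eigenspace a H (of_real \<nu>)" and "\<mu> \<noteq> \<nu>"
  shows "ip f g = 0"
proof -
  have fs: "f \<in> fock_space a" "g \<in> fock_space a" using f g by (simp_all add: eigenspace_iff)
  have "of_real \<mu> * ip f g = q f g" using f fs by (simp add: eigenspace_iff)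
  also have "\<dots> = cnj (q g f)" by (rule q.B_cnj[OF fs(2,1)])
  also have "\<dots> = cnj (of_real \<nu> * ip g f)" using g fs by (simp add: eigenspace_iff)
  also have "\<dots> = of_real \<nu> * ip f g" using ip.B_cnj[OF fs] by simp
  finally show ?thesis using \<open>\<mu> \<noteq> \<nu>\<close> by simp
qed

lemma ip_pos:
  assumes "f \<in> fock_space a" "\<not> fock_eq a f 0"
  shows "0 < Re (ip f f)"
  using assms ip_eq_0_iff[OF assms(1)] ip_same_nonneg[of f] ip.B_real[OF assms(1)]
  by (metis less_eq_real_def of_real_0)

text \<open>
  The form of \<open>H - m\<close> is negative on every eigenspace below \<open>m\<close>. It is also negative on the span of
  vectors \<open>F \<mu>\<close>, one for each eigenvalue \<open>\<mu> < m\<close>, because these are orthogonal both for the inner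
  product and for the form. Representatives of the \<open>F \<mu>\<close> in a finite-dimensional space remain
  orthogonal, hence independent, so there are finitely many.
\<close>

lemma finitely_many_eigenvalues_below_if:
  assumes fin: "\<And>S. fock.subspace S \<Longrightarrow> S \<subseteq> fock_space a \<Longrightarrow>
      (\<And>f. f \<in> S \<Longrightarrow> \<not> fock_eq a f 0 \<Longrightarrow> Re (q f f) < m * Re (ip f f)) \<Longrightarrow> fock_finite_dim a S"
  shows "finitely_many_eigenvalues_below a H m"
proof -
  have q_eigen: "Re (q f f) = \<mu> * Re (ip f f)" if "f \<in> eigenspace a H (of_real \<mu>)" for f \<mu>
    using that by (simp add: eigenspace_iff)
  let ?E = "{\<mu>. \<mu> < m \<and> is_eigenvalue a H (complex_of_real \<mu>)}"
  have "fock_finite_dim a (eigenspace a H (of_real \<mu>))" if "\<mu> < m" for \<mu>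
  proof (rule fin[OF subspace_eigenspace])
    fix f assume f: "f \<in> eigenspace a H (of_real \<mu>)" "\<not> fock_eq a f 0"
    then have "0 < Re (ip f f)" by (intro ip_pos) (auto simp: eigenspace_iff)
    then show "Re (q f f) < m * Re (ip f f)" using q_eigen[OF f(1)] that by simp
  qed (auto simp: eigenspace_iff)
  moreover have "finite ?E"
  proof -
    have "\<forall>\<mu>\<in>?E. \<exists>f. f \<in> eigenspace a H (of_real \<mu>) \<and> \<not> fock_eq a f 0"
      by (auto simp: is_eigenvalue_def)
    from bchoice[OF this] obtain F where
      "\<forall>\<mu>\<in>?E. F \<mu> \<in> eigenspace a H (of_real \<mu>) \<and> \<not> fock_eq a (F \<mu>) 0" ..
    then have F: "\<And>\<mu>. \<mu> \<in> ?E \<Longrightarrow> F \<mu> \<in> eigenspace a H (of_real \<mu>)"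
      and F0: "\<And>\<mu>. \<mu> \<in> ?E \<Longrightarrow> \<not> fock_eq a (F \<mu>) 0" by blast+
    have F_fock: "F \<mu> \<in> fock_space a" if "\<mu> \<in> ?E" for \<mu>
      using F[OF that] by (simp add: eigenspace_iff)
    have ip_F: "ip (F \<mu>) (F \<nu>) = 0" if "\<mu> \<in> ?E" "\<nu> \<in> ?E" "\<mu> \<noteq> \<nu>" for \<mu> \<nu>
      by (rule eigenvectors_orthogonal[OF F[OF that(1)] F[OF that(2)] that(3)])
    have pos: "0 < Re (ip (F \<mu>) (F \<mu>))" if "\<mu> \<in> ?E" for \<mu>
      by (rule ip_pos[OF F_fock[OF that] F0[OF that]])
    have inj: "inj_on F ?E"
    proof (rule inj_onI, rule ccontr)
      fix \<mu> \<nu> assume "\<mu> \<in> ?E" "\<nu> \<in> ?E" "F \<mu> = F \<nu>" "\<mu> \<noteq> \<nu>"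
      then show False using ip_F[of \<mu> \<nu>] pos[of \<mu>] by simp
    qed
    have "fock_finite_dim a (fock.span (F ` ?E))"
    proof (rule fin[OF fock.subspace_span])
      show "fock.span (F ` ?E) \<subseteq> fock_space a"
        using F_fock by (intro fock.span_minimal subspace_fock_space) auto
      fix f assume "f \<in> fock.span (F ` ?E)" and f0: "\<not> fock_eq a f 0"
      then obtain t r where t: "finite t" "t \<subseteq> F ` ?E" and f: "f = (\<Sum>v\<in>t. fock_scale (r v) v)"
        unfolding fock.span_explicit by auto
      from t obtain T where T: "T \<subseteq> ?E" "t = F ` T" by (auto simp: subset_image_iff)
      have injT: "inj_on F T" using inj T(1) by (rule inj_on_subset)
      then have finT: "finite T" using t T by (simp add: finite_image_iff)
      define c where "c = (\<lambda>\<mu>. r (F \<mu>))"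
      have fT: "f = (\<Sum>\<mu>\<in>T. fock_scale (c \<mu>) (F \<mu>))"
        unfolding f T c_def by (simp add: sum.reindex[OF injT])
      have ipf: "ip f f = (\<Sum>\<mu>\<in>T. of_real ((norm (c \<mu>))\<^sup>2) * ip (F \<mu>) (F \<mu>))"
        unfolding fT using T finT F_fock ip_F by (intro ip.B_sum_orthogonal) blast+
      have qf: "q f f = (\<Sum>\<mu>\<in>T. of_real ((norm (c \<mu>))\<^sup>2) * q (F \<mu>) (F \<mu>))"
        unfolding fT
      proof (rule q.B_sum_orthogonal[OF finT])
        fix \<mu> \<nu> assume "\<mu> \<in> T" "\<nu> \<in> T" "\<mu> \<noteq> \<nu>"
        then show "q (F \<mu>) (F \<nu>) = 0"
          using T F[of \<mu>] F_fock[of \<nu>] ip_F[of \<mu> \<nu>] by (auto simp: eigenspace_iff subset_iff)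
      qed (use T F_fock in blast)
      have "Re (q f f) - m * Re (ip f f) =
          (\<Sum>\<mu>\<in>T. (norm (c \<mu>))\<^sup>2 * ((\<mu> - m) * Re (ip (F \<mu>) (F \<mu>))))"
      proof -
        have "Re (q (F \<mu>) (F \<mu>)) = \<mu> * Re (ip (F \<mu>) (F \<mu>))" if "\<mu> \<in> T" for \<mu>
          using q_eigen F that T by blast
        then have "Re (q f f) = (\<Sum>\<mu>\<in>T. (norm (c \<mu>))\<^sup>2 * (\<mu> * Re (ip (F \<mu>) (F \<mu>))))"
          unfolding qf Re_sum by (intro sum.cong) (auto simp del: of_real_power)
        moreover have "Re (ip f f) = (\<Sum>\<mu>\<in>T. (norm (c \<mu>))\<^sup>2 * Re (ip (F \<mu>) (F \<mu>)))"
          unfolding ipf Re_sum by (intro sum.cong) (auto simp del: of_real_power)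
        ultimately show ?thesis
          by (simp add: sum_distrib_left sum_subtractf[symmetric] algebra_simps)
      qed
      also have "\<dots> < 0"
      proof -
        have "\<exists>\<mu>\<in>T. c \<mu> \<noteq> 0"
        proof (rule ccontr)
          assume "\<not> ?thesis"
          then have "f = 0" unfolding fT by simp
          then show False using f0 by (simp add: fock_eq_def)
        qed
        then obtain \<nu> where \<nu>: "\<nu> \<in> T" "c \<nu> \<noteq> 0" by auto
        have neg: "(\<mu> - m) * Re (ip (F \<mu>) (F \<mu>)) < 0" if "\<mu> \<in> T" for \<mu>
          using pos[of \<mu>] that T by (intro mult_neg_pos) auto
        have "(\<Sum>\<mu>\<in>T. (norm (c \<mu>))\<^sup>2 * ((\<mu> - m) * Re (ip (F \<mu>) (F \<mu>)))) < (\<Sum>\<mu>\<in>T. 0)"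
        proof (rule sum_strict_mono_ex1[OF finT])
          show "\<forall>\<mu>\<in>T. (norm (c \<mu>))\<^sup>2 * ((\<mu> - m) * Re (ip (F \<mu>) (F \<mu>))) \<le> 0"
            by (intro ballI mult_nonneg_nonpos[OF zero_le_power2 less_imp_le[OF neg]])
          show "\<exists>\<mu>\<in>T. (norm (c \<mu>))\<^sup>2 * ((\<mu> - m) * Re (ip (F \<mu>) (F \<mu>))) < 0"
            using \<nu> by (intro bexI[of _ \<nu>] mult_pos_neg[OF _ neg]) auto
        qed
        then show ?thesis by simp
      qed
      finally show "Re (q f f) < m * Re (ip f f)" by simp
    qed
    then obtain B where B: "finite B" "B \<subseteq> fock.span (F ` ?E)"
      and approx: "\<forall>f\<in>fock.span (F ` ?E). \<exists>g\<in>fock.span B. fock_eq a f g"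
      by (auto simp: fock_finite_dim_def)
    have "fock.span (F ` ?E) \<subseteq> fock_space a"
      using F_fock by (intro fock.span_minimal subspace_fock_space) auto
    then have spanB: "fock.span B \<subseteq> fock_space a"
      using B by (intro fock.span_minimal subspace_fock_space) auto
    have "\<forall>\<mu>\<in>?E. \<exists>g. g \<in> fock.span B \<and> fock_eq a (F \<mu>) g"
      using approx fock.span_base[of "F _" "F ` ?E"] by blast
    from bchoice[OF this] obtain G where
      "\<forall>\<mu>\<in>?E. G \<mu> \<in> fock.span B \<and> fock_eq a (F \<mu>) (G \<mu>)" ..
    then have G: "\<And>\<mu>. \<mu> \<in> ?E \<Longrightarrow> G \<mu> \<in> fock.span B" "\<And>\<mu>. \<mu> \<in> ?E \<Longrightarrow> fock_eq a (F \<mu>) (G \<mu>)"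
      by blast+
    have G_fock: "G \<mu> \<in> fock_space a" if "\<mu> \<in> ?E" for \<mu> using G(1)[OF that] spanB by auto
    have ip_G: "ip (G \<mu>) (G \<nu>) = ip (F \<mu>) (F \<nu>)" if "\<mu> \<in> ?E" "\<nu> \<in> ?E" for \<mu> \<nu>
      using ip_cong[OF G(2)[OF that(1)] F_fock[OF that(1)] G_fock[OF that(1)] G_fock[OF that(2)]]
        ip_cong_right[OF G(2)[OF that(2)] F_fock[OF that(1)] F_fock[OF that(2)] G_fock[OF that(2)]] by simp
    have "fock.independent (G ` ?E)"
    proof (rule ip.orthogonal_independent)
      show "G ` ?E \<subseteq> fock_space a" using G_fock by auto
      show "ip e e \<noteq> 0" if "e \<in> G ` ?E" for e
        using that pos ip_G by fastforce
      show "ip e e' = 0" if "e \<in> G ` ?E" "e' \<in> G ` ?E" "e \<noteq> e'" for e e'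
        using that ip_F ip_G by (smt (verit, best) imageE)
    qed
    then have "finite (G ` ?E)"
      using fock.independent_span_bound[OF B(1)] G(1) by (meson image_subsetI)
    moreover have "inj_on G ?E"
    proof (rule inj_onI, rule ccontr)
      fix \<mu> \<nu> assume "\<mu> \<in> ?E" "\<nu> \<in> ?E" "G \<mu> = G \<nu>" "\<mu> \<noteq> \<nu>"
      then show False using ip_F[of \<mu> \<nu>] pos[of \<mu>] ip_G[of \<mu> \<mu>] ip_G[of \<mu> \<nu>] by simp
    qed
    ultimately show ?thesis by (rule finite_imageD)
  qed
  ultimately show ?thesis by (simp add: finitely_many_eigenvalues_below_def)
qed

end

locale fock_model_below = fock_model a w0 v0 w1 v1 w2 Cv +
  two_particle_form "lebesgue_on (cube a)" v1 Cv "\<lambda>x. w1 x - m" "\<lambda>z. w2 z - m" Cu CW CK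
  for a w0 :: real and v0 :: "real^'n \<Rightarrow> complex" and w1 :: "real^'n \<Rightarrow> real"
    and v1 :: "(real^'n) \<times> (real^'n) \<Rightarrow> complex" and w2 :: "(real^'n) \<times> (real^'n) \<Rightarrow> real"
    and Cv Cu CW CK m :: real +
  fixes N :: real
  assumes D_pos: "AE x in M. 0 < D x"
    and HS: "(\<integral>\<^sup>+z. ennreal ((norm (v1 z) * norm (v1 (snd z, fst z)))\<^sup>2 /
               (4 * (w2 z - m)\<^sup>2 * D (fst z) * D (snd z))) \<partial>P) \<le> ennreal N"
    and N_nonneg: "0 \<le> N"
begin

text \<open>
  For \<open>fst f = 0\<close> the form of \<open>H - m\<close> contains neither \<open>w0\<close> nor \<open>v0\<close>.
\<close>

lemma form_ge:
  assumes f: "f \<in> fock_space a" and "fst f = 0"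
  shows "(\<integral>x. D x * (norm (fst (snd f) x))\<^sup>2 \<partial>M) - exchange (fst (snd f)) \<le> Re (q f f) - m * Re (ip f f)"
proof -
  have f1: "fst (snd f) \<in> Lp_space M 2" and f2: "snd (snd f) \<in> Lp_space P 2"
    and sym: "AE z in P. snd (snd f) z = snd (snd f) (snd z, fst z)"
    using f by (auto simp: fock_space_iff)
  have int: "integrable N (\<lambda>x. r x * (norm (h x))\<^sup>2)" if "bounded_weight N r" "h \<in> Lp_space N 2"
    for N :: "'b measure" and r h
  proof -
    have "Re (of_real (r x) * h x * cnj (h x)) = r x * (norm (h x))\<^sup>2" for x
      by (simp only: mult.assoc complex_norm_square[symmetric] Re_complex_of_real of_real_mult[symmetric])
    then show ?thesis using integrable_Re[OF weighted_inner_integrable[OF that that(2)]] by simp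
  qed
  have "(\<integral>x. (w1 x - m) * (norm (fst (snd f) x))\<^sup>2 \<partial>M) =
      (\<integral>x. w1 x * (norm (fst (snd f) x))\<^sup>2 \<partial>M) - m * (\<integral>x. (norm (fst (snd f) x))\<^sup>2 \<partial>M)"
    using int[OF w1 f1] int[OF bounded_weight_1 f1] by (simp add: algebra_simps)
  moreover have "(\<integral>z. (w2 z - m) * (norm (snd (snd f) z))\<^sup>2 \<partial>P) =
      (\<integral>z. w2 z * (norm (snd (snd f) z))\<^sup>2 \<partial>P) - m * (\<integral>z. (norm (snd (snd f) z))\<^sup>2 \<partial>P)"
    using int[OF w2_P f2] int[OF bounded_weight_1 f2] by (simp add: algebra_simps)
  ultimately show ?thesis
    using form_ge_Schur_complement[OF f1 f2 sym] \<open>fst f = 0\<close>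
    by (simp add: q_def ip_def weighted_inner_same algebra_simps)
qed

text \<open>
  On the part \<open>S0\<close> of \<open>S\<close> with vanishing vacuum component, families that are orthonormal for the weight \<open>D\<close>
  have at most \<open>N\<close> members, so a largest one spans \<open>S0\<close> up to vectors of \<open>D\<close>-length zero. Such vectors
  have no one-particle component; the form is nonnegative at them, so they vanish.
\<close>

lemma negative_subspace_finite_dim:
  assumes S: "fock.subspace S" and S_fock: "S \<subseteq> fock_space a"
    and neg: "\<And>f. f \<in> S \<Longrightarrow> \<not> fock_eq a f 0 \<Longrightarrow> Re (q f f) < m * Re (ip f f)"
  shows "fock_finite_dim a S"
proof -
  define S0 where "S0 = {f \<in> S. fst f = 0}"
  have S0: "fock.subspace S0"
    by (rule fock.subspaceI)
      (auto simp: S0_def fock_scale_def fock.subspace_0[OF S] fock.subspace_add[OF S]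
        dest: fock.subspace_scale[OF S, unfolded fock_scale_def])
  have S0_fock: "S0 \<subseteq> fock_space a" using S_fock by (auto simp: S0_def)
  have D_weight: "bounded_weight M D"
    unfolding bounded_weight_def using D_measurable D_bound by blast
  define d where "d = (\<lambda>(f :: 'n fock) (g :: 'n fock). weighted_inner M D (fst (snd f)) (fst (snd g)))"
  interpret d: hermitian_form fock_scale S0 d
  proof (unfold_locales)
    fix f g h :: "'n fock" assume "f \<in> S0" "g \<in> S0" "h \<in> S0"
    then have "f \<in> fock_space a" "g \<in> fock_space a" "h \<in> fock_space a" using S0_fock by auto
    then show "d (f + g) h = d f h + d g h"
      by (simp add: d_def plus_fun_def fock_space_iff weighted_inner_add[OF D_weight])
  next
    show "fock.subspace S0" by (rule S0)
  qed (simp_all add: d_def fock_scale_def weighted_inner_scale, rule weighted_inner_cnj)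
  have d_same: "d f f = of_real (\<integral>x. D x * (norm (fst (snd f) x))\<^sup>2 \<partial>M)" for f :: "'n fock"
    unfolding d_def by (rule weighted_inner_same)
  have d_zero: "\<not> fock_eq a f 0" if "d f f = 1" for f :: "'n fock"
  proof
    assume "fock_eq a f 0"
    then have "AE x in M. fst (snd f) x = 0" by (simp add: fock_eq_def)
    then have "AE x in M. D x * (norm (fst (snd f) x))\<^sup>2 = 0" by eventually_elim simp
    then have "(\<integral>x. D x * (norm (fst (snd f) x))\<^sup>2 \<partial>M) = 0"
      by (rule integral_eq_zero_AE)
    then show False using that by (simp add: d_same)
  qed
  have "\<exists>E. d.orthonormal E \<and> (\<forall>f\<in>S0. \<exists>g\<in>fock.span E. d (f - g) (f - g) = 0)"
  proof (rule d.exists_spanning_orthonormal[where N = "nat \<lceil>N\<rceil>"])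
    fix f :: "'n fock"
    have "AE x in M. 0 \<le> D x * (norm (fst (snd f) x))\<^sup>2"
      using D_pos by eventually_elim simp
    then show "0 \<le> Re (d f f)" unfolding d_same by (simp add: integral_nonneg_AE)
  next
    fix E :: "'n fock set" assume E: "d.orthonormal E"
    have "real (card E) \<le> N"
    proof (rule card_le_of_exchange_ge_1[where e = "\<lambda>f. fst (snd f)", OF _ _ D_pos _ _ HS N_nonneg])
      show "finite E" using E by (simp add: d.orthonormal_def)
      fix e assume e: "e \<in> E"
      then have e_S0: "e \<in> S0" using E by (auto simp: d.orthonormal_def)
      then have e_fock: "e \<in> fock_space a" using S0_fock by auto
      then show "fst (snd e) \<in> Lp_space M 2" by (simp add: fock_space_iff)
      \<comment> \<open>The form at \<open>e\<close> is negative but at least \<open>1 - exchange (fst (snd e))\<close>.\<close>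
      have dee: "d e e = 1" using E e by (auto simp: d.orthonormal_def)
      then have "(\<integral>x. D x * (norm (fst (snd e) x))\<^sup>2 \<partial>M) = 1"
        unfolding d_same by (simp only: of_real_eq_1_iff)
      moreover have "Re (q e e) < m * Re (ip e e)"
        using e_S0 d_zero[OF dee] by (intro neg) (auto simp: S0_def)
      ultimately show "1 \<le> exchange (fst (snd e))"
        using form_ge[OF e_fock] e_S0 by (simp add: S0_def)
      fix e' assume "e' \<in> E"
      then have "d e e' = (if e = e' then 1 else 0)"
        using E e by (simp add: d.orthonormal_def)
      then show "(\<integral>x. complex_of_real (D x) * fst (snd e) x * cnj (fst (snd e') x) \<partial>M) = (if e = e' then 1 else 0)"
        unfolding d_def weighted_inner_def .
    qed
    then show "card E \<le> nat \<lceil>N\<rceil>" by linarith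
  qed
  then obtain E where E: "d.orthonormal E" and span: "\<And>f. f \<in> S0 \<Longrightarrow> \<exists>g\<in>fock.span E. d (f - g) (f - g) = 0"
    by auto
  have E_fin: "finite E" and E_S0: "E \<subseteq> S0" using E by (auto simp: d.orthonormal_def)
  have S0_span: "\<exists>g\<in>fock.span E. fock_eq a f g" if f: "f \<in> S0" for f
  proof -
    obtain g where g: "g \<in> fock.span E" and d0: "d (f - g) (f - g) = 0" using span[OF f] by auto
    define r where "r = f - g"
    have "g \<in> S0" using g fock.span_minimal[OF E_S0 S0] by auto
    then have r: "r \<in> S0" unfolding r_def by (rule fock.subspace_diff[OF S0 f])
    then have r_fock: "r \<in> fock_space a" using S0_fock by auto
    then have r1: "fst (snd r) \<in> Lp_space M 2" by (simp add: fock_space_iff)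
    have int0: "(\<integral>x. D x * (norm (fst (snd r) x))\<^sup>2 \<partial>M) = 0"
      using d0 unfolding r_def[symmetric] d_same by (simp only: of_real_eq_0_iff)
    have "Re (of_real (D x) * h * cnj h) = D x * (norm h)\<^sup>2" for x h
      by (simp only: mult.assoc complex_norm_square[symmetric] Re_complex_of_real of_real_mult[symmetric])
    then have "integrable M (\<lambda>x. D x * (norm (fst (snd r) x))\<^sup>2)"
      using integrable_Re[OF weighted_inner_integrable[OF D_weight r1 r1]] by simp
    moreover have "AE x in M. 0 \<le> D x * (norm (fst (snd r) x))\<^sup>2"
      using D_pos by eventually_elim simp
    ultimately have "AE x in M. D x * (norm (fst (snd r) x))\<^sup>2 = 0"
      using int0 integral_nonneg_eq_0_iff_AE by blast
    with D_pos have r0: "AE x in M. fst (snd r) x = 0" by eventually_elim simp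
    have "AE z in P. Re (v1 z * cnj (v1 (snd z, fst z)) * cnj (fst (snd r) (fst z)) * fst (snd r) (snd z)) /
        (2 * (w2 z - m)) = 0"
      using AE_P_fst[OF r0] by eventually_elim simp
    then have "exchange (fst (snd r)) = 0"
      unfolding exchange_def by (rule integral_eq_zero_AE)
    then have "m * Re (ip r r) \<le> Re (q r r)"
      using form_ge[OF r_fock] r int0 by (simp add: S0_def)
    then have "fock_eq a r 0" using neg[of r] r by (force simp: S0_def)
    then show ?thesis using g fock_eq_diff unfolding r_def by blast
  qed
  show ?thesis
  proof (cases "S = S0")
    case True
    then show ?thesis unfolding fock_finite_dim_def
      using E_fin E_S0 S0_span by blast
  next
    case False
    then obtain k where k: "k \<in> S" "fst k \<noteq> 0" by (auto simp: S0_def)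
    have "\<exists>g\<in>fock.span (insert k E). fock_eq a f g" if f: "f \<in> S" for f
    proof -
      \<comment> \<open>Subtracting a multiple of \<open>k\<close> removes the vacuum component.\<close>
      define c where "c = fst f / fst k"
      have "f - fock_scale c k \<in> S0"
        using fock.subspace_diff[OF S f fock.subspace_scale[OF S k(1)]] k
        by (simp add: S0_def) (simp add: c_def fock_scale_def)
      then obtain g where g: "g \<in> fock.span E" "fock_eq a (f - fock_scale c k) g" using S0_span by blast
      have "fock_eq a f (g + fock_scale c k)"
        using g(2) by (simp add: fock_eq_def plus_fun_def fun_diff_def diff_eq_eq)
      moreover have "g + fock_scale c k \<in> fock.span (insert k E)"
        using g(1) fock.span_mono[of E "insert k E"]
        by (intro fock.span_add fock.span_scale) (auto intro: fock.span_base)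
      ultimately show ?thesis by blast
    qed
    moreover have "finite (insert k E)" "insert k E \<subseteq> S"
      using E_fin E_S0 k by (auto simp: S0_def)
    ultimately show ?thesis unfolding fock_finite_dim_def by blast
  qed
qed

lemma finitely_many_eigenvalues: "finitely_many_eigenvalues_below a H m"
  by (rule finitely_many_eigenvalues_below_if) (rule negative_subspace_finite_dim)

end

section \<open>Exponents and the theorem\<close>

lemma Phi0_pos: "u \<noteq> 0 \<Longrightarrow> 0 < Phi0 \<delta> s u"
  by (simp add: Phi0_def)

lemma Phi0_add: "Phi0 \<delta> (s + t) u = Phi0 \<delta> s u * Phi0 \<delta> t u"
  by (simp add: Phi0_def powr_add)

lemma Phi0_le: "0 \<le> s \<Longrightarrow> Phi0 \<delta> s u \<le> max 1 (\<delta> powr s)"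
  by (auto simp: Phi0_def le_max_iff_disj intro!: disjI2 powr_mono2)

text \<open>
  The factor covers the case that exactly one argument lies in the ball: then \<open>Phi\<close> is \<open>1\<close>, while
  \<open>Phi0\<close> can be almost \<open>\<delta> powr s\<close>.
\<close>

lemma Phi_ge_Phi0:
  assumes "0 \<le> s"
  shows "Phi0 \<delta> s u \<le> max 1 (\<delta> powr s) * Phi \<delta> s u v" "Phi0 \<delta> s v \<le> max 1 (\<delta> powr s) * Phi \<delta> s u v"
proof -
  have *: "x \<le> max 1 (\<delta> powr s) * y" if "x \<le> y" "0 \<le> y" for x y :: real
    using that mult_right_mono[of 1 "max 1 (\<delta> powr s)" y] by simp
  show "Phi0 \<delta> s u \<le> max 1 (\<delta> powr s) * Phi \<delta> s u v"
  proof (cases "u \<in> ball 0 \<delta> \<and> v \<in> ball 0 \<delta>")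
    case True
    then show ?thesis by (intro *) (auto simp: Phi0_def Phi_def)
  next
    case False
    then have "Phi \<delta> s u v = 1" by (simp only: Phi_def if_False)
    then show ?thesis using Phi0_le[OF assms] by simp
  qed
  show "Phi0 \<delta> s v \<le> max 1 (\<delta> powr s) * Phi \<delta> s u v"
  proof (cases "u \<in> ball 0 \<delta> \<and> v \<in> ball 0 \<delta>")
    case True
    then show ?thesis by (intro *) (auto simp: Phi0_def Phi_def)
  next
    case False
    then have "Phi \<delta> s u v = 1" by (simp only: Phi_def if_False)
    then show ?thesis using Phi0_le[OF assms] by simp
  qed
qed

lemma Phi0_measurable: "(\<lambda>x. Phi0 \<delta> s (x - t)) \<in> borel_measurable (lebesgue_on S)"
proof -
  have "(\<lambda>x. Phi0 \<delta> s (x - t)) \<in> borel_measurable borel"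
    unfolding Phi0_def mem_ball_0 by measurable
  then show ?thesis
    by (intro measurable_restrict_space1 measurable_completion) simp
qed

lemma AE_lebesgue_on_neq: "AE x in lebesgue_on S. x \<noteq> (t :: 'a::euclidean_space)" if "S \<in> sets lebesgue"
proof -
  have "AE x in lebesgue. x \<noteq> t"
    using AE_lborel_singleton[of t] by (rule AE_completion)
  then show ?thesis using that by (simp add: AE_restrict_space_iff) (auto elim: AE_mp)
qed

lemma integrable_norm_powr_ball:
  fixes t :: "real^'n"
  assumes "- real CARD('n) < s" "0 < \<delta>"
  shows "integrable (lebesgue_on (cube a)) (\<lambda>x. indicator (ball t \<delta>) x * norm (x - t) powr s)"
proof -
  let ?h = "\<lambda>x. indicator (ball t \<delta>) x * norm (x - t) powr s"
  have "(\<lambda>x. norm (x - t) powr s) \<in> borel_measurable borel" by measurable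
  then have borel: "?h \<in> borel_measurable borel"
    by (intro borel_measurable_times borel_measurable_indicator) simp_all
  then have m: "?h \<in> borel_measurable (lebesgue_on (cube a))"
    by (intro measurable_restrict_space1 measurable_completion) simp
  have "(\<integral>\<^sup>+x. ennreal (norm (?h x)) \<partial>lebesgue_on (cube a)) \<le> (\<integral>\<^sup>+x. ennreal (norm (?h x)) \<partial>lebesgue)"
    using lmeasurable_cube
    by (subst nn_integral_restrict_space) (auto intro!: nn_integral_mono simp: indicator_def)
  also have "\<dots> = (\<integral>\<^sup>+x. ennreal (norm (?h x)) \<partial>lborel)" by (rule nn_integral_completion)
  also have "\<dots> = (\<integral>\<^sup>+x. indicator (ball t \<delta>) x * ennreal (norm (x - t) powr s) \<partial>lborel)"
    by (intro nn_integral_cong) (auto simp: indicator_def)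
  also have "\<dots> < \<infinity>" using assms by (intro nn_integral_norm_powr_ball_finite) simp_all
  finally show ?thesis using m by (simp add: integrable_iff_bounded)
qed

text \<open>
  The infima and the supremum need not be attained, but the strict inequality between them leaves room
  for exponents close to them. The bounds for \<open>\<alpha>\<close> and \<open>\<beta>\<close> are separate conditions, so an \<open>\<alpha>\<close> close to
  the infimum may be combined with a \<open>\<beta>\<close> close to the supremum.
\<close>

lemma admissible_exponents:
  fixes t0 :: "real^'n"
  assumes B: "assumption_B a v1 w2 m \<delta> t0" and C: "assumption_C a w1 v1 w2 m \<delta> t0"
    and exponents: "alpha_star a v1 w2 m \<delta> t0 + gamma_star a w1 v1 w2 m \<delta> t0
                      < 2 * beta_star a v1 w2 m \<delta> t0 + ereal (real CARD('n))"
  obtains \<alpha> \<beta> \<gamma> C1 C2 C3 where "0 \<le> \<alpha>" "0 \<le> \<gamma>" "0 < C1" "0 < C2" "0 < C3"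
    "bounds_B a v1 w2 m \<delta> t0 \<alpha> \<beta> C1 C2"
    "AE x in lebesgue_on (cube a). C3 * Phi0 \<delta> \<gamma> (x - t0) \<le> Delta a w1 v1 w2 m x"
    "\<alpha> + \<gamma> < 2 * \<beta> + real CARD('n)"
proof -
  let ?d = "real CARD('n)"
  let ?A = "{ereal \<alpha> | \<alpha> \<beta> C1 C2. \<alpha> \<ge> 0 \<and> C1 > 0 \<and> C2 > 0 \<and> bounds_B a v1 w2 m \<delta> t0 \<alpha> \<beta> C1 C2}"
  let ?B = "{ereal \<beta> | \<alpha> \<beta> C1 C2. \<alpha> \<ge> 0 \<and> C1 > 0 \<and> C2 > 0 \<and> bounds_B a v1 w2 m \<delta> t0 \<alpha> \<beta> C1 C2}"
  let ?G = "{ereal \<gamma> | \<gamma> C3. \<gamma> \<ge> 0 \<and> C3 > 0 \<and> bound_C a w1 v1 w2 m \<delta> t0 \<gamma> C3}"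
  let ?as = "alpha_star a v1 w2 m \<delta> t0" and ?bs = "beta_star a v1 w2 m \<delta> t0" and ?gs = "gamma_star a w1 v1 w2 m \<delta> t0"
  obtain \<alpha>0 \<beta>0 C10 C20 where 0: "\<alpha>0 \<ge> 0" "C10 > 0" "C20 > 0" "bounds_B a v1 w2 m \<delta> t0 \<alpha>0 \<beta>0 C10 C20"
    using B by (auto simp: assumption_B_def)
  obtain \<gamma>0 C30 where 1: "\<gamma>0 \<ge> 0" "C30 > 0" "bound_C a w1 v1 w2 m \<delta> t0 \<gamma>0 C30"
    using C by (auto simp: assumption_C_def)
  have "?as \<le> ereal \<alpha>0" unfolding alpha_star_def by (rule Inf_lower) (use 0 in auto)
  moreover have "0 \<le> ?as" unfolding alpha_star_def by (rule Inf_greatest) auto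
  ultimately obtain A where A: "?as = ereal A" by (cases ?as) auto
  have "?gs \<le> ereal \<gamma>0" unfolding gamma_star_def by (rule Inf_lower) (use 1 in auto)
  moreover have gs0: "0 \<le> ?gs" unfolding gamma_star_def by (rule Inf_greatest) auto
  ultimately obtain G where G: "?gs = ereal G" by (cases ?gs) auto
  have bs: "ereal \<beta>0 \<le> ?bs" unfolding beta_star_def by (rule Sup_upper) (use 0 in auto)
  have below: "?as < 2 * ?bs + ereal ?d"
    using exponents gs0 A G by (cases ?bs) auto
  have "ereal ((A + G - ?d) / 2) < ?bs"
    using exponents bs unfolding A G by (cases ?bs) auto
  then obtain b where "b \<in> ?B" "ereal ((A + G - ?d) / 2) < b"
    unfolding beta_star_def less_Sup_iff by blast
  then obtain \<alpha>1 \<beta> C11 C2 where \<beta>: "\<alpha>1 \<ge> 0" "C11 > 0" "C2 > 0" "bounds_B a v1 w2 m \<delta> t0 \<alpha>1 \<beta> C11 C2"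
    and "(A + G - ?d) / 2 < \<beta>" by auto
  \<comment> \<open>half of the gap, to be shared between \<open>\<alpha>\<close> and \<open>\<gamma>\<close>\<close>
  define \<kappa> where "\<kappa> = (2 * \<beta> + ?d - A - G) / 2"
  have \<kappa>: "0 < \<kappa>" using \<open>(A + G - ?d) / 2 < \<beta>\<close> by (simp add: \<kappa>_def field_simps)
  then have "?as < ereal (A + \<kappa>)" "?gs < ereal (G + \<kappa>)" by (simp_all add: A G)
  then obtain x y where xy: "x \<in> ?A" "x < ereal (A + \<kappa>)" "y \<in> ?G" "y < ereal (G + \<kappa>)"
    unfolding alpha_star_def gamma_star_def Inf_less_iff by blast
  from xy(1,2) obtain \<alpha> \<beta>' C1 C2' where \<alpha>: "\<alpha> \<ge> 0" "C1 > 0" "C2' > 0" "bounds_B a v1 w2 m \<delta> t0 \<alpha> \<beta>' C1 C2'"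
    and "\<alpha> < A + \<kappa>" by auto
  from xy(3,4) obtain \<gamma> C3 where \<gamma>: "\<gamma> \<ge> 0" "C3 > 0" "bound_C a w1 v1 w2 m \<delta> t0 \<gamma> C3" and "\<gamma> < G + \<kappa>" by auto
  have "AE x in lebesgue_on (cube a). C3 * Phi0 \<delta> \<gamma> (x - t0) \<le> Delta a w1 v1 w2 m x"
    using \<gamma>(3) below by (simp add: bound_C_def)
  moreover have "bounds_B a v1 w2 m \<delta> t0 \<alpha> \<beta> C1 C2"
    using \<alpha>(4) \<beta>(4) by (simp add: bounds_B_def)
  moreover have "\<alpha> + \<gamma> < 2 * \<beta> + ?d"
    using \<open>\<alpha> < A + \<kappa>\<close> \<open>\<gamma> < G + \<kappa>\<close> by (simp add: \<kappa>_def field_simps)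
  ultimately show thesis using that \<alpha> \<beta> \<gamma> by blast
qed

theorem theorem5p2:
  fixes a w0 \<epsilon> m \<delta> :: real
    and v0 :: "real^'n \<Rightarrow> complex"
    and w1 :: "real^'n \<Rightarrow> real"
    and v1 :: "(real^'n) \<times> (real^'n) \<Rightarrow> complex"
    and w2 :: "(real^'n) \<times> (real^'n) \<Rightarrow> real"
    and H :: "'n::finite fock \<Rightarrow> 'n fock"
    and t0 :: "real^'n"
  assumes "a > 0"
    and v0: "v0 \<in> L2_cube a"
    and w1: "w1 \<in> borel_measurable (lebesgue_on (cube a))"
            "\<exists>C. AE x in lebesgue_on (cube a). \<bar>w1 x\<bar> \<le> C"
    and w2: "continuous_on (cube a \<times> cube a) w2"
            "\<exists>C. AE z in lebesgue_on (cube a \<times> cube a). \<bar>w2 z\<bar> \<le> C"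
            "\<forall>x\<in>cube a. \<forall>y\<in>cube a. w2 (x, y) = w2 (y, x)"
    and v1: "v1 \<in> borel_measurable (lebesgue_on (cube a \<times> cube a))"
            "\<epsilon> > 0"
            "\<exists>C. AE x in lebesgue_on (cube a).
               (\<lambda>y. v1 (x, y)) \<in> Lp_space (lebesgue_on (cube a)) (2 + \<epsilon>) \<and>
               Lp_norm (lebesgue_on (cube a)) (2 + \<epsilon>) (\<lambda>y. v1 (x, y)) \<le> C"
            "\<exists>C. AE y in lebesgue_on (cube a).
               (\<lambda>x. v1 (x, y)) \<in> Lp_space (lebesgue_on (cube a)) (2 + 4 / \<epsilon>) \<and>
               Lp_norm (lebesgue_on (cube a)) (2 + 4 / \<epsilon>) (\<lambda>x. v1 (x, y)) \<le> C"
    and H: "H = fock_op a w0 v0 w1 v1 w2"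
    and m: "m = min_ess_spectrum a H"
    and B: "assumption_B a v1 w2 m \<delta> t0"
    and C: "assumption_C a w1 v1 w2 m \<delta> t0"
    and exponents: "alpha_star a v1 w2 m \<delta> t0 + gamma_star a w1 v1 w2 m \<delta> t0
                      < 2 * beta_star a v1 w2 m \<delta> t0 + ereal (real CARD('n))"
  shows "finitely_many_eigenvalues_below a H m"
proof -
  obtain \<alpha> \<beta> \<gamma> C1 C2 C3 where nonneg: "0 \<le> \<alpha>" "0 \<le> \<gamma>" and pos: "0 < C1" "0 < C2" "0 < C3"
    and bounds: "bounds_B a v1 w2 m \<delta> t0 \<alpha> \<beta> C1 C2"
    and Delta_ge: "AE x in lebesgue_on (cube a). C3 * Phi0 \<delta> \<gamma> (x - t0) \<le> Delta a w1 v1 w2 m x"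
    and exps: "\<alpha> + \<gamma> < 2 * \<beta> + real CARD('n)"
    by (rule admissible_exponents[OF B C exponents])
  have "0 < \<delta>" using B by (simp add: assumption_B_def)
  interpret complete_finite_measure "lebesgue_on (cube a) :: (real^'n) measure"
    by (rule complete_finite_measure_cube)
  let ?M = "lebesgue_on (cube a) :: (real^'n) measure"
  have P_eq: "lebesgue_on (cube a \<times> cube a) = P" by (rule lebesgue_on_cube_Times)
  have cube_meas: "(cube a :: (real^'n) set) \<in> sets lebesgue" using lmeasurable_cube by auto
  note v1_P = v1(1)[unfolded P_eq]

  obtain Cp where Cp: "AE x in ?M. (\<lambda>y. v1 (x, y)) \<in> Lp_space ?M (2 + \<epsilon>) \<and> Lp_norm ?M (2 + \<epsilon>) (\<lambda>y. v1 (x, y)) \<le> Cp"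
    using v1(3) by auto
  define Cv where "Cv = measure ?M (space ?M) + \<bar>Cp\<bar> powr (2 + \<epsilon>)"
  have v_sections: "AE x in ?M. (\<integral>\<^sup>+y. ennreal ((norm (v1 (x, y)))\<^sup>2) \<partial>?M) \<le> ennreal Cv"
    using Cp
  proof eventually_elim
    case (elim x)
    then show ?case
      using Lp_norm_le_imp_nn_integral_le[OF finite_measure_axioms, of "\<lambda>y. v1 (x, y)" "2 + \<epsilon>" Cp 2] \<open>0 < \<epsilon>\<close>
      by (simp add: Cv_def)
  qed
  have v4: "integrable P (\<lambda>z. norm (v1 z) ^ 4)"
    using integrable_fourth_power[OF v1_P v1(2) Cp] v1(4) by blast
  interpret section_bounded_kernel ?M v1 Cv
    by unfold_locales (rule v1_P, rule v_sections)

  \<comment> \<open>\<open>W * W\<close> is at least a multiple of \<open>\<Phi> \<alpha> x * \<Phi> \<alpha> y\<close> and \<open>D\<close> at least a multiple of \<open>\<Phi> \<gamma>\<close>, so that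
    \<open>\<omega> x * \<omega> y\<close> bounds the denominator of the squared exchange kernel from below.\<close>
  define \<Phi> where "\<Phi> = (\<lambda>s x. Phi0 \<delta> s (x - t0))"
  define \<omega> where "\<omega> = \<Phi> (\<alpha> + \<gamma>)"
  define h where "h = (\<lambda>y. C2\<^sup>2 * (indicator (ball t0 \<delta>) y * norm (y - t0) powr (2 * \<beta> - (\<alpha> + \<gamma>))))"
  have ne: "AE x in ?M. x \<noteq> t0" by (rule AE_lebesgue_on_neq[OF cube_meas])
  have \<Phi>_pos: "0 < \<Phi> s x" if "x \<noteq> t0" for s x using that by (simp add: \<Phi>_def Phi0_pos)
  have \<omega>_meas: "\<omega> \<in> borel_measurable ?M" unfolding \<omega>_def \<Phi>_def by (rule Phi0_measurable)
  have \<omega>_pos: "AE x in ?M. 0 < \<omega> x" using ne by eventually_elim (simp add: \<omega>_def \<Phi>_pos)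
  have \<omega>_eq: "\<omega> x = \<Phi> \<alpha> x * \<Phi> \<gamma> x" for x by (simp add: \<omega>_def \<Phi>_def Phi0_add)
  have h_int: "integrable ?M h"
    unfolding h_def using exps \<open>0 < \<delta>\<close> by (intro integrable_mult_right integrable_norm_powr_ball) simp_all
  have h_nonneg: "0 \<le> h x" for x by (simp add: h_def)
  have bound: "AE z in P. (norm (v1 z))\<^sup>2 / \<omega> (snd z) \<le> h (snd z) + (norm (v1 z))\<^sup>2"
    using bounds[unfolded bounds_B_def P_eq, THEN conjunct2] AE_P_snd[OF ne]
  proof eventually_elim
    case (elim z)
    let ?y = "snd z"
    show ?case
    proof (cases "?y \<in> ball t0 \<delta>")
      case True
      then have ball: "?y - t0 \<in> ball 0 \<delta>" by (simp add: dist_norm norm_minus_commute)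
      then have "norm (v1 z) \<le> C2 * norm (?y - t0) powr \<beta>"
        using elim True by (simp add: Phi0_def)
      then have "(norm (v1 z))\<^sup>2 \<le> (C2 * norm (?y - t0) powr \<beta>)\<^sup>2" by (intro power_mono) auto
      also have "\<dots> = C2\<^sup>2 * norm (?y - t0) powr (2 * \<beta>)"
        using elim by (simp add: power_mult_distrib powr_power)
      finally have "(norm (v1 z))\<^sup>2 / \<omega> ?y \<le> C2\<^sup>2 * norm (?y - t0) powr (2 * \<beta>) / \<omega> ?y"
        using \<Phi>_pos elim(2) by (intro divide_right_mono) (auto simp: \<omega>_def intro: less_imp_le)
      also have "\<dots> = h ?y"
        using True ball by (simp add: h_def \<omega>_def \<Phi>_def Phi0_def powr_diff)
      finally show ?thesis using zero_le_power2[of "norm (v1 z)"] by linarith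
    next
      case False
      then have "?y - t0 \<notin> ball 0 \<delta>" by (simp add: dist_norm norm_minus_commute)
      then have "\<omega> ?y = 1" by (simp add: \<omega>_def \<Phi>_def Phi0_def)
      then show ?thesis using h_nonneg[of ?y] by simp
    qed
  qed
  note weighted = \<omega>_meas \<omega>_pos h_int h_nonneg bound

  \<comment> \<open>\<open>W\<close> is bounded below by the weight of either variable; each bound is used once in \<open>W * W\<close>.\<close>
  define c where "c = C1 / max 1 (\<delta> powr \<alpha>)"
  have c_pos: "0 < c" using pos by (simp add: c_def less_max_iff_disj)
  have W_ge: "AE z in P. c * \<Phi> \<alpha> (fst z) \<le> w2 z - m \<and> c * \<Phi> \<alpha> (snd z) \<le> w2 z - m"
    using bounds[unfolded bounds_B_def P_eq, THEN conjunct1]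
  proof eventually_elim
    case (elim z)
    have *: "c * p \<le> C1 * r" if "p \<le> max 1 (\<delta> powr \<alpha>) * r" for p r
    proof -
      have "c * p \<le> c * (max 1 (\<delta> powr \<alpha>) * r)" using that c_pos by (intro mult_left_mono) auto
      also have "\<dots> = C1 * r"
      proof -
        have "0 < max 1 (\<delta> powr \<alpha>)" by (simp add: less_max_iff_disj)
        then show ?thesis by (simp add: c_def)
      qed
      finally show ?thesis .
    qed
    show ?case
      using *[OF Phi_ge_Phi0(1)[OF nonneg(1), of \<delta> "fst z - t0" "snd z - t0"]]
        *[OF Phi_ge_Phi0(2)[OF nonneg(1), of \<delta> "snd z - t0" "fst z - t0"]] elim
      unfolding \<Phi>_def by linarith
  qed
  have W_pos: "AE z in P. 0 < w2 z - m"
    using W_ge AE_P_fst[OF ne]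
  proof eventually_elim
    case (elim z)
    have "0 < c * \<Phi> \<alpha> (fst z)" using c_pos \<Phi>_pos[OF elim(2)] by simp
    then show ?case using elim by linarith
  qed
  have w2_P: "w2 \<in> borel_measurable P"
    unfolding P_eq[symmetric]
    by (rule continuous_imp_measurable_on_sets_lebesgue[OF w2(1)]) (rule emeasure_lebesgue_Times(1)[OF cube_meas cube_meas])
  have w2_sym: "AE z in P. w2 (snd z, fst z) = w2 z"
    unfolding P_eq[symmetric] using w2(3) by (intro AE_I2) auto
  \<comment> \<open>Trading \<open>\<Phi> \<alpha>\<close> for \<open>\<omega>\<close> costs a factor, since \<open>\<Phi> \<gamma>\<close> is bounded.\<close>
  define L where "L = max 1 (\<delta> powr \<gamma>) / c"
  define CK where "CK = L * ((\<integral>y. h y \<partial>?M) + \<bar>Cv\<bar>)"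
  have vW: "AE z in P. (norm (v1 z))\<^sup>2 / (w2 z - m) \<le> L * ((norm (v1 z))\<^sup>2 / \<omega> (snd z))"
    using W_ge AE_P_snd[OF ne]
  proof eventually_elim
    case (elim z)
    let ?y = "snd z"
    have p: "0 < \<Phi> \<alpha> ?y" "0 < \<Phi> \<gamma> ?y" using \<Phi>_pos[OF elim(2)] by auto
    have "(norm (v1 z))\<^sup>2 / (w2 z - m) \<le> (norm (v1 z))\<^sup>2 / (c * \<Phi> \<alpha> ?y)"
      using elim(1) c_pos p by (intro divide_left_mono) (auto intro!: mult_pos_pos less_le_trans[of 0 "c * \<Phi> \<alpha> ?y" "w2 z - m"])
    also have "\<dots> = (\<Phi> \<gamma> ?y / c) * ((norm (v1 z))\<^sup>2 / \<omega> ?y)"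
      using p c_pos by (simp add: \<omega>_eq)
    also have "\<dots> \<le> L * ((norm (v1 z))\<^sup>2 / \<omega> ?y)"
      unfolding L_def using Phi0_le[OF nonneg(2)] c_pos p
      by (intro mult_right_mono divide_right_mono) (auto simp: \<omega>_eq \<Phi>_def)
    finally show ?case .
  qed
  have L_pos: "0 \<le> L" using c_pos by (simp add: L_def)
  have vW_sections: "AE x in ?M. (\<integral>\<^sup>+y. ennreal ((norm (v1 (x, y)))\<^sup>2 / (w2 (x, y) - m)) \<partial>?M) \<le> ennreal CK"
    using weighted_sections_bounded[OF weighted] AE_P_sections[OF vW] measurable_sections[OF v1_P]
  proof eventually_elim
    case (elim x)
    have "(\<integral>\<^sup>+y. ennreal ((norm (v1 (x, y)))\<^sup>2 / (w2 (x, y) - m)) \<partial>?M) \<le>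
        (\<integral>\<^sup>+y. ennreal L * ennreal ((norm (v1 (x, y)))\<^sup>2 / \<omega> y) \<partial>?M)"
    proof (rule nn_integral_mono_AE)
      show "AE y in ?M. ennreal ((norm (v1 (x, y)))\<^sup>2 / (w2 (x, y) - m)) \<le> ennreal L * ennreal ((norm (v1 (x, y)))\<^sup>2 / \<omega> y)"
        using elim(2) by eventually_elim (simp add: L_pos ennreal_leI flip: ennreal_mult')
    qed
    also have "\<dots> = ennreal L * (\<integral>\<^sup>+y. ennreal ((norm (v1 (x, y)))\<^sup>2 / \<omega> y) \<partial>?M)"
      using elim(3) \<omega>_meas by (intro nn_integral_cmult) measurable
    also have "\<dots> \<le> ennreal L * ennreal ((\<integral>y. h y \<partial>?M) + \<bar>Cv\<bar>)"
      using elim(1) by (rule mult_left_mono) simp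
    also have "\<dots> = ennreal CK" using L_pos by (simp add: CK_def flip: ennreal_mult')
    finally show ?case .
  qed
  obtain B1 where B1: "AE x in ?M. \<bar>w1 x\<bar> \<le> B1" using w1(2) by auto
  obtain B2 where B2: "AE z in P. \<bar>w2 z\<bar> \<le> B2" using w2(2) unfolding P_eq by auto
  interpret T: two_particle_form ?M v1 Cv "\<lambda>x. w1 x - m" "\<lambda>z. w2 z - m" "B1 + \<bar>m\<bar>" "B2 + \<bar>m\<bar>" CK
  proof unfold_locales
    show "AE x in ?M. \<bar>w1 x - m\<bar> \<le> B1 + \<bar>m\<bar>" using B1 by eventually_elim linarith
    show "AE z in P. \<bar>w2 z - m\<bar> \<le> B2 + \<bar>m\<bar>" using B2 by eventually_elim linarith
    show "AE z in P. w2 (snd z, fst z) - m = w2 z - m" using w2_sym by eventually_elim simp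
  qed (use w1(1) w2_P W_pos vW_sections in auto)
  have D_eq: "T.D = Delta a w1 v1 w2 m" by (simp add: fun_eq_iff T.D_def Delta_def)
  have D_ge: "AE x in ?M. C3 * \<Phi> \<gamma> x \<le> T.D x" using Delta_ge by (simp add: D_eq \<Phi>_def)
  have D_pos: "AE x in ?M. 0 < T.D x"
    using D_ge ne
  proof eventually_elim
    case (elim x)
    have "0 < C3 * \<Phi> \<gamma> x" using pos \<Phi>_pos[OF elim(2)] by simp
    then show ?case using elim by linarith
  qed
  let ?k = "\<lambda>z. (norm (v1 z) * norm (v1 (snd z, fst z)))\<^sup>2 / (\<omega> (fst z) * \<omega> (snd z))"
  define K where "K = 4 * c\<^sup>2 * C3\<^sup>2"
  have K_pos: "0 < K" using c_pos pos by (simp add: K_def)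
  have k_int: "integrable P ?k" by (rule integrable_weighted_exchange[OF weighted v4])
  have "AE z in P. (norm (v1 z) * norm (v1 (snd z, fst z)))\<^sup>2 / (4 * (w2 z - m)\<^sup>2 * T.D (fst z) * T.D (snd z)) \<le> ?k z / K"
    using W_ge AE_P_fst[OF D_ge] AE_P_snd[OF D_ge] AE_P_fst[OF ne] AE_P_snd[OF ne]
  proof eventually_elim
    case (elim z)
    note p = \<Phi>_pos[OF elim(4)] \<Phi>_pos[OF elim(5)]
    have c\<Phi>: "0 < c * \<Phi> \<alpha> (fst z)" "0 < c * \<Phi> \<alpha> (snd z)" "0 < C3 * \<Phi> \<gamma> (fst z)" "0 < C3 * \<Phi> \<gamma> (snd z)"
      using c_pos pos p by simp_all
    have W_D: "0 < w2 z - m" "0 < T.D (fst z)" "0 < T.D (snd z)"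
      using c\<Phi> elim by linarith+
    have "(c * \<Phi> \<alpha> (fst z)) * (c * \<Phi> \<alpha> (snd z)) \<le> (w2 z - m) * (w2 z - m)"
      using elim(1) c\<Phi> W_D by (intro mult_mono) (auto intro: less_imp_le)
    moreover have "(C3 * \<Phi> \<gamma> (fst z)) * (C3 * \<Phi> \<gamma> (snd z)) \<le> T.D (fst z) * T.D (snd z)"
      using elim(2,3) c\<Phi> W_D by (intro mult_mono) (auto intro: less_imp_le)
    ultimately have "4 * (((c * \<Phi> \<alpha> (fst z)) * (c * \<Phi> \<alpha> (snd z))) * ((C3 * \<Phi> \<gamma> (fst z)) * (C3 * \<Phi> \<gamma> (snd z))))
        \<le> 4 * (((w2 z - m) * (w2 z - m)) * (T.D (fst z) * T.D (snd z)))"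
      using c\<Phi> W_D by (rule_tac mult_left_mono[OF mult_mono]) (simp_all add: less_imp_le)
    then have le: "\<omega> (fst z) * \<omega> (snd z) * K \<le> 4 * (w2 z - m)\<^sup>2 * T.D (fst z) * T.D (snd z)"
      by (simp add: \<omega>_eq K_def power2_eq_square mult_ac
          del: left_diff_distrib_numeral right_diff_distrib_numeral)
    have "0 < \<omega> (fst z) * \<omega> (snd z) * K"
      using p K_pos by (simp add: \<omega>_def)
    then show ?case
      unfolding divide_divide_eq_left by (rule frac_le[OF zero_le_power2 order_refl _ le])
  qed
  then have "AE z in P. ennreal ((norm (v1 z) * norm (v1 (snd z, fst z)))\<^sup>2 /
      (4 * (w2 z - m)\<^sup>2 * T.D (fst z) * T.D (snd z))) \<le> ennreal (?k z / K)"
    by eventually_elim (rule ennreal_leI)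
  then have "(\<integral>\<^sup>+z. ennreal ((norm (v1 z) * norm (v1 (snd z, fst z)))\<^sup>2 /
               (4 * (w2 z - m)\<^sup>2 * T.D (fst z) * T.D (snd z))) \<partial>P) \<le> (\<integral>\<^sup>+z. ennreal (?k z / K) \<partial>P)"
    by (rule nn_integral_mono_AE)
  also have "\<dots> = ennreal (\<integral>z. ?k z / K \<partial>P)"
  proof (rule nn_integral_eq_integral)
    show "AE z in P. 0 \<le> ?k z / K"
      using AE_P_fst[OF \<omega>_pos] AE_P_snd[OF \<omega>_pos] by eventually_elim (use K_pos in simp)
  qed (rule Bochner_Integration.integrable_divide[OF k_int])
  also have "\<dots> \<le> ennreal \<bar>\<integral>z. ?k z / K \<partial>P\<bar>" by (rule ennreal_leI) simp
  finally have HS: "(\<integral>\<^sup>+z. ennreal ((norm (v1 z) * norm (v1 (snd z, fst z)))\<^sup>2 /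
               (4 * (w2 z - m)\<^sup>2 * T.D (fst z) * T.D (snd z))) \<partial>P) \<le> ennreal \<bar>\<integral>z. ?k z / K \<partial>P\<bar>" .
  interpret F: fock_model_below a w0 v0 w1 v1 w2 Cv "B1 + \<bar>m\<bar>" "B2 + \<bar>m\<bar>" CK m "\<bar>\<integral>z. ?k z / K \<partial>P\<bar>"
  proof unfold_locales
    show "bounded_weight ?M w1" "bounded_weight (lebesgue_on (cube a \<times> cube a)) w2"
      using w1 w2_P B2 unfolding bounded_weight_def P_eq by blast+
    show "AE z in lebesgue_on (cube a \<times> cube a). w2 (snd z, fst z) = w2 z"
      unfolding P_eq by (rule w2_sym)
  qed (use v0 v1(1) v_sections D_pos HS in auto)
  show ?thesis unfolding H by (rule F.finitely_many_eigenvalues)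
qed

end
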